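(* Let $E$ be complete, let $(T^{E}_{m},T^{\mathbb{K}}_{m})_{m\in\mathcal{M}}$ be a strong, consistent family for $(\mathcal{FV},E)$, let $\mathcal{FV}(\Omega)$ be a semi-Montel space and $U$ a set of uniqueness for $\mathcal{FV}(\Omega)$. If (a) $\mathcal{FV}(\Omega)$ is webbed, or (b) $\mathcal{FV}(\Omega)$ is $B_r$-complete, or (c) $\mathcal{FV}(\Omega)$ is an infra-(s)-space, then the restriction map \[ R_{U,E'}\colon S(\mathcal{FV}(\Omega)\varepsilon E)\to \mathcal{FV}_{E'}(U,E),\quad f\mapsto (T^{E}_{m}(f)(x))_{(m,x)\in U}, \] is surjective.
   Context: $\mathbb{K}\in\{\mathbb{R},\mathbb{C}\}$; $E$ is a non-trivial locally convex Hausdorff space (lcHs) over $\mathbb{K}$ with a directed fundamental system of seminorms $(p_\alpha)_{\alpha\in\mathfrak{A}}$ (for $E=\mathbb{K}$: $\{|\cdot|\}$); $E'$ its dual. Webbed, $B_r$-complete and infra-(s)-space are the standard notions (Jarchow, Köthe); semi-Montel means every bounded set is relatively compact. Weighted function spaces: Let $\Omega,J,L$ be non-empty sets, $(M_l)_{l\in L}$ non-empty sets and $\mathcal{V}=((\nu_{j,l,m})_{m\in M_l})_{j\in J,l\in L}$ functions $\nu_{j,l,m}\colon\Omega\to[0,\infty)$ such that for all $x\in\Omega$, $l\in L$ there is $j\in J$ with $\nu_{j,l,m}(x)>0$ for all $m\in M_l$. Let $\mathcal{M}_{\mathrm{top}}:=\bigcup_lM_l$, and $\mathcal{M}_0,\mathcal{M}_r$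 sets, the three pairwise disjoint, $\mathcal{M}$ their union; $(\omega_m)_{m\in\mathcal{M}}$ non-empty sets with $\Omega\subset\omega_m$ for $m\in\mathcal{M}_{\mathrm{top}}$. For $F\in\{E,\mathbb{K}\}$ let $T^F_m\colon\operatorname{dom}T^F_m\subset F^\Omega\to F^{\omega_m}$ be linear, $m\in\mathcal{M}$. $\mathcal{FV}(\Omega,F)$ is the set of $f\in\bigcap_{m\in\mathcal{M}}\operatorname{dom}T^F_m\cap\bigcap_{m\in\mathcal{M}_0}\ker T^F_m$ with $|f|_{j,l,\alpha}:=\sup_{x\in\Omega,m\in M_l}p_\alpha(T^F_m(f)(x))\nu_{j,l,m}(x)<\infty$ for all $j,l,\alpha$, topologised by these seminorms; $\mathcal{FV}(\Omega):=\mathcal{FV}(\Omega,\mathbb{K})$. $T^F_{m,x}(f):=T^F_m(f)(x)$. Such a space is a dom-space if its seminorm system is directed and, in the scalar case, all point evaluations $\delta_x\colon f\mapsto f(x)$ are continuous. $\mathcal{FV}(\Omega)\varepsilon E$ is the space of continuous linear maps $\mathcal{FV}(\Omega)'_\kappa\to E$ ($\kappa$: uniform convergence on absolutely convex compact sets) with topology of uniform convergence on equicontinuous sets; $S(u)(x):=u(\delta_x)$. With $\mathcal{FV}(\Omega)$, $\mathcal{FV}(\Omega,E)$ dom-spaces built from the same data with operators $T^{\mathbb{K}}_m$, $T^E_m$, the family $(T^E_m,T^{\mathbb{K}}_m)_{m\in\mathcal{M}}$ is consistent if for all $u\in\mathcal{FV}(\Omega)\varepsilon E$, $m\in\mathcal{M}$,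 $x\in\omega_m$: $S(u)\in\operatorname{dom}T^E_m$, $T^{\mathbb{K}}_{m,x}|_{\mathcal{FV}(\Omega)}\in\mathcal{FV}(\Omega)'$, and $T^E_m(S(u))(x)=u(T^{\mathbb{K}}_{m,x})$; it is strong if for all $e'\in E'$, $f\in\mathcal{FV}(\Omega,E)$, $m$: $e'\circ f\in\operatorname{dom}T^{\mathbb{K}}_m$ and $T^{\mathbb{K}}_m(e'\circ f)=e'\circ T^E_m(f)$ on $\omega_m$. $U\subset\bigcup_m\{m\}\times\omega_m$ is a set of uniqueness for $\mathcal{FV}(\Omega)$ if $T^{\mathbb{K}}_{m,x}\in\mathcal{FV}(\Omega)'$ for $(m,x)\in U$ and $f\in\mathcal{FV}(\Omega)$, $T^{\mathbb{K}}_m(f)(x)=0$ for all $(m,x)\in U$ imply $f=0$. $\mathcal{FV}_{E'}(U,E)$ is the set of $f\colon U\to E$ such that for each $e'\in E'$ there is $f_{e'}\in\mathcal{FV}(\Omega)$ with $T^{\mathbb{K}}_m(f_{e'})(x)=e'(f(m,x))$ for all $(m,x)\in U$. *)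

theory Defs
  imports "HOL-Analysis.Analysis" "HOL-Library.Function_Algebras"
begin

text \<open>Conventions. The scalar field K is represented as a subset of the complex numbers,
  K = real numbers or K = all complex numbers. A (real or complex) vector space is a carrier set V
  inside a type with an abelian group structure and an explicit scalar multiplication sc
  (only scalars in K matter). A locally convex space is given by a carrier V and a set P of
  seminorms; its topology is the one generated by P.\<close>

definition vs :: "complex set \<Rightarrow> (complex \<Rightarrow> 'v::ab_group_add \<Rightarrow> 'v) \<Rightarrow> 'v set \<Rightarrow> bool" where
  "vs K sc V \<longleftrightarrow> 0 \<in> V \<and> (\<forall>x\<in>V. \<forall>y\<in>V. x + y \<in> V) \<and> (\<forall>a\<in>K. \<forall>x\<in>V. sc a x \<in> V)
     \<and> (\<forall>a\<in>K. \<forall>x\<in>V. \<forall>y\<in>V. sc a (x + y) = sc a x + sc a y)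
     \<and> (\<forall>a\<in>K. \<forall>b\<in>K. \<forall>x\<in>V. sc (a + b) x = sc a x + sc b x)
     \<and> (\<forall>a\<in>K. \<forall>b\<in>K. \<forall>x\<in>V. sc (a * b) x = sc a (sc b x))
     \<and> (\<forall>x\<in>V. sc 1 x = x)"

definition subspace_of :: "complex set \<Rightarrow> (complex \<Rightarrow> 'v::ab_group_add \<Rightarrow> 'v) \<Rightarrow> 'v set \<Rightarrow> bool" where
  "subspace_of K sc Q \<longleftrightarrow> 0 \<in> Q \<and> (\<forall>x\<in>Q. \<forall>y\<in>Q. x + y \<in> Q) \<and> (\<forall>a\<in>K. \<forall>x\<in>Q. sc a x \<in> Q)"

definition seminorm_on :: "complex set \<Rightarrow> (complex \<Rightarrow> 'v::ab_group_add \<Rightarrow> 'v) \<Rightarrow> 'v set \<Rightarrow> ('v \<Rightarrow> real) \<Rightarrow> bool" where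
  "seminorm_on K sc V p \<longleftrightarrow> (\<forall>x\<in>V. 0 \<le> p x) \<and> (\<forall>x\<in>V. \<forall>y\<in>V. p (x + y) \<le> p x + p y)
     \<and> (\<forall>a\<in>K. \<forall>x\<in>V. p (sc a x) = cmod a * p x)"

definition lcHs :: "complex set \<Rightarrow> (complex \<Rightarrow> 'v::ab_group_add \<Rightarrow> 'v) \<Rightarrow> 'v set \<Rightarrow> ('v \<Rightarrow> real) set \<Rightarrow> bool" where
  "lcHs K sc V P \<longleftrightarrow> vs K sc V \<and> (\<forall>p\<in>P. seminorm_on K sc V p) \<and> (\<forall>x\<in>V. (\<forall>p\<in>P. p x = 0) \<longrightarrow> x = 0)"

definition directed_sns :: "'v set \<Rightarrow> ('v \<Rightarrow> real) set \<Rightarrow> bool" where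
  "directed_sns V P \<longleftrightarrow> (\<forall>p\<in>P. \<forall>q\<in>P. \<exists>r\<in>P. \<exists>C>0. \<forall>x\<in>V. max (p x) (q x) \<le> C * r x)"

definition lc_top :: "'v::ab_group_add set \<Rightarrow> ('v \<Rightarrow> real) set \<Rightarrow> 'v topology" where
  "lc_top V P = topology (\<lambda>U. U \<subseteq> V \<and> (\<forall>x\<in>U. \<exists>F \<epsilon>. finite F \<and> F \<subseteq> P \<and> \<epsilon> > 0 \<and>
      {y\<in>V. \<forall>p\<in>F. p (y - x) < \<epsilon>} \<subseteq> U))"

definition zero_nbhd :: "'v::ab_group_add set \<Rightarrow> ('v \<Rightarrow> real) set \<Rightarrow> 'v set \<Rightarrow> bool" where
  "zero_nbhd V P U \<longleftrightarrow> U \<subseteq> V \<and> (\<exists>W. openin (lc_top V P) W \<and> 0 \<in> W \<and> W \<subseteq> U)"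

definition lin_map :: "complex set \<Rightarrow> (complex \<Rightarrow> 'v::ab_group_add \<Rightarrow> 'v) \<Rightarrow> 'v set
    \<Rightarrow> (complex \<Rightarrow> 'w::ab_group_add \<Rightarrow> 'w) \<Rightarrow> 'w set \<Rightarrow> ('v \<Rightarrow> 'w) \<Rightarrow> bool" where
  "lin_map K sc1 V sc2 W A \<longleftrightarrow> (\<forall>x\<in>V. A x \<in> W) \<and> (\<forall>x\<in>V. \<forall>y\<in>V. A (x + y) = A x + A y)
     \<and> (\<forall>a\<in>K. \<forall>x\<in>V. A (sc1 a x) = sc2 a (A x))"

definition fsc :: "complex \<Rightarrow> ('a \<Rightarrow> complex) \<Rightarrow> ('a \<Rightarrow> complex)" where
  "fsc c f = (\<lambda>x. c * f x)"

text \<open>Topological dual (continuous K-linear functionals; represented extensionally, i.e.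
  vanishing outside the carrier).\<close>
definition lc_dual :: "complex set \<Rightarrow> (complex \<Rightarrow> 'v::ab_group_add \<Rightarrow> 'v) \<Rightarrow> 'v set \<Rightarrow> ('v \<Rightarrow> real) set
    \<Rightarrow> ('v \<Rightarrow> complex) set" where
  "lc_dual K sc V P = {\<phi>. lin_map K sc V (*) K \<phi> \<and> continuous_map (lc_top V P) euclidean \<phi>
      \<and> (\<forall>x. x \<notin> V \<longrightarrow> \<phi> x = 0)}"

definition bounded_set :: "'v set \<Rightarrow> ('v \<Rightarrow> real) set \<Rightarrow> 'v set \<Rightarrow> bool" where
  "bounded_set V P B \<longleftrightarrow> B \<subseteq> V \<and> (\<forall>p\<in>P. bdd_above (p ` B))"

definition semi_montel :: "'v::ab_group_add set \<Rightarrow> ('v \<Rightarrow> real) set \<Rightarrow> bool" where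
  "semi_montel V P \<longleftrightarrow> (\<forall>B. bounded_set V P B \<longrightarrow> compactin (lc_top V P) ((lc_top V P) closure_of B))"

definition lc_complete :: "'v::ab_group_add set \<Rightarrow> ('v \<Rightarrow> real) set \<Rightarrow> bool" where
  "lc_complete V P \<longleftrightarrow> (\<forall>F. F \<noteq> bot \<and> eventually (\<lambda>x. x \<in> V) F
      \<and> (\<forall>p\<in>P. \<forall>\<epsilon>>0. \<exists>A. eventually (\<lambda>x. x \<in> A) F \<and> (\<forall>x\<in>A. \<forall>y\<in>A. p (x - y) < \<epsilon>))
      \<longrightarrow> (\<exists>x\<in>V. limitin (lc_top V P) id x F))"

definition abs_convex :: "complex set \<Rightarrow> (complex \<Rightarrow> 'v::ab_group_add \<Rightarrow> 'v) \<Rightarrow> 'v set \<Rightarrow> bool" where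
  "abs_convex K sc C \<longleftrightarrow> (\<forall>x\<in>C. \<forall>y\<in>C. \<forall>a\<in>K. \<forall>b\<in>K. cmod a + cmod b \<le> 1 \<longrightarrow> sc a x + sc b y \<in> C)"

text \<open>Webbed space: existence of a C-web (Jarchow 5.2).\<close>
definition webbed :: "complex set \<Rightarrow> (complex \<Rightarrow> 'v::ab_group_add \<Rightarrow> 'v) \<Rightarrow> 'v set \<Rightarrow> ('v \<Rightarrow> real) set \<Rightarrow> bool" where
  "webbed K sc V P \<longleftrightarrow> (\<exists>C :: nat list \<Rightarrow> 'v set. C [] = V \<and> (\<forall>ns. C ns = (\<Union>n. C (ns @ [n])))
     \<and> (\<forall>s :: nat \<Rightarrow> nat. \<exists>\<rho> :: nat \<Rightarrow> real. (\<forall>k. \<rho> k > 0) \<and>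
         (\<forall>(lam::nat \<Rightarrow> real) (x::nat \<Rightarrow> 'v). (\<forall>k. 0 \<le> lam k \<and> lam k \<le> \<rho> k \<and> x k \<in> C (map s [0..<Suc k])) \<longrightarrow>
            (\<exists>y\<in>V. limitin (lc_top V P) (\<lambda>n. \<Sum>k<n. sc (complex_of_real (lam k)) (x k)) y sequentially))))"

definition weak_star_sns :: "'v set \<Rightarrow> (('v \<Rightarrow> complex) \<Rightarrow> real) set" where
  "weak_star_sns V = {(\<lambda>\<phi>. cmod (\<phi> x)) | x. x \<in> V}"

definition polar :: "complex set \<Rightarrow> (complex \<Rightarrow> 'v::ab_group_add \<Rightarrow> 'v) \<Rightarrow> 'v set \<Rightarrow> ('v \<Rightarrow> real) set
    \<Rightarrow> 'v set \<Rightarrow> ('v \<Rightarrow> complex) set" where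
  "polar K sc V P U = {\<phi> \<in> lc_dual K sc V P. \<forall>x\<in>U. cmod (\<phi> x) \<le> 1}"

definition Br_complete :: "complex set \<Rightarrow> (complex \<Rightarrow> 'v::ab_group_add \<Rightarrow> 'v) \<Rightarrow> 'v set \<Rightarrow> ('v \<Rightarrow> real) set \<Rightarrow> bool" where
  "Br_complete K sc V P \<longleftrightarrow> (\<forall>Q. Q \<subseteq> lc_dual K sc V P \<and> subspace_of K fsc Q
      \<and> (lc_top (lc_dual K sc V P) (weak_star_sns V)) closure_of Q = lc_dual K sc V P
      \<and> (\<forall>U. zero_nbhd V P U \<longrightarrow>
             closedin (subtopology (lc_top (lc_dual K sc V P) (weak_star_sns V)) (polar K sc V P U))
                      (Q \<inter> polar K sc V P U))
      \<longrightarrow> Q = lc_dual K sc V P)"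

definition barrel :: "complex set \<Rightarrow> (complex \<Rightarrow> 'v::ab_group_add \<Rightarrow> 'v) \<Rightarrow> 'v set \<Rightarrow> ('v \<Rightarrow> real) set \<Rightarrow> 'v set \<Rightarrow> bool" where
  "barrel K sc V P B \<longleftrightarrow> B \<subseteq> V \<and> abs_convex K sc B \<and> closedin (lc_top V P) B
     \<and> (\<forall>x\<in>V. \<exists>r>0. \<forall>a\<in>K. cmod a \<le> r \<longrightarrow> sc a x \<in> B)"

definition barrelled :: "complex set \<Rightarrow> (complex \<Rightarrow> 'v::ab_group_add \<Rightarrow> 'v) \<Rightarrow> 'v set \<Rightarrow> ('v \<Rightarrow> real) set \<Rightarrow> bool" where
  "barrelled K sc V P \<longleftrightarrow> (\<forall>B. barrel K sc V P B \<longrightarrow> zero_nbhd V P B)"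

definition infra_s :: "complex set \<Rightarrow> (complex \<Rightarrow> 'v::ab_group_add \<Rightarrow> 'v) \<Rightarrow> 'v set \<Rightarrow> ('v \<Rightarrow> real) set \<Rightarrow> bool" where
  "infra_s K sc V P \<longleftrightarrow> (\<forall>G Q A. lcHs K sc G Q \<and> barrelled K sc G Q \<and> lin_map K sc G sc V A
      \<and> closedin (prod_topology (lc_top G Q) (lc_top V P)) {(x, A x) | x. x \<in> G}
      \<longrightarrow> continuous_map (lc_top G Q) (lc_top V P) A)"

definition Mall :: "'l set \<Rightarrow> ('l \<Rightarrow> 'm set) \<Rightarrow> 'm set \<Rightarrow> 'm set \<Rightarrow> 'm set" where
  "Mall L Ml M0 Mr = (\<Union>l\<in>L. Ml l) \<union> M0 \<union> Mr"

definition FV_vals :: "'y set \<Rightarrow> ('l \<Rightarrow> 'm set) \<Rightarrow> ('j \<Rightarrow> 'l \<Rightarrow> 'm \<Rightarrow> 'y \<Rightarrow> real)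
    \<Rightarrow> ('m \<Rightarrow> ('y \<Rightarrow> 'f) \<Rightarrow> 'y \<Rightarrow> 'f) \<Rightarrow> 'j \<Rightarrow> 'l \<Rightarrow> ('f \<Rightarrow> real) \<Rightarrow> ('y \<Rightarrow> 'f) \<Rightarrow> real set" where
  "FV_vals Omega Ml nu T j l p f = {p (T m f x) * nu j l m x | x m. x \<in> Omega \<and> m \<in> Ml l}"

text \<open>FV(Omega,F) for the value space F with carrier VF and seminorms PF. Elements of F^Omega are
  represented as functions on the ambient type of Omega vanishing outside Omega.\<close>
definition FV_space :: "'f::zero set \<Rightarrow> ('f \<Rightarrow> real) set \<Rightarrow> 'y set \<Rightarrow> 'j set \<Rightarrow> 'l set \<Rightarrow> ('l \<Rightarrow> 'm set)
    \<Rightarrow> ('j \<Rightarrow> 'l \<Rightarrow> 'm \<Rightarrow> 'y \<Rightarrow> real) \<Rightarrow> 'm set \<Rightarrow> 'm set \<Rightarrow> ('m \<Rightarrow> 'y set)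
    \<Rightarrow> ('m \<Rightarrow> ('y \<Rightarrow> 'f) set) \<Rightarrow> ('m \<Rightarrow> ('y \<Rightarrow> 'f) \<Rightarrow> 'y \<Rightarrow> 'f) \<Rightarrow> ('y \<Rightarrow> 'f) set" where
  "FV_space VF PF Omega J L Ml nu M0 Mr om domT T =
     {f. (\<forall>x. f x \<in> VF) \<and> (\<forall>x. x \<notin> Omega \<longrightarrow> f x = 0)
       \<and> (\<forall>m\<in>Mall L Ml M0 Mr. f \<in> domT m)
       \<and> (\<forall>m\<in>M0. \<forall>x\<in>om m. T m f x = 0)
       \<and> (\<forall>j\<in>J. \<forall>l\<in>L. \<forall>p\<in>PF. bdd_above (FV_vals Omega Ml nu T j l p f))}"

definition FV_sns :: "('f \<Rightarrow> real) set \<Rightarrow> 'y set \<Rightarrow> 'j set \<Rightarrow> 'l set \<Rightarrow> ('l \<Rightarrow> 'm set)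
    \<Rightarrow> ('j \<Rightarrow> 'l \<Rightarrow> 'm \<Rightarrow> 'y \<Rightarrow> real) \<Rightarrow> ('m \<Rightarrow> ('y \<Rightarrow> 'f) \<Rightarrow> 'y \<Rightarrow> 'f) \<Rightarrow> (('y \<Rightarrow> 'f) \<Rightarrow> real) set" where
  "FV_sns PF Omega J L Ml nu T =
     {(\<lambda>f. Sup (FV_vals Omega Ml nu T j l p f)) | j l p. j \<in> J \<and> l \<in> L \<and> p \<in> PF}"

definition lin_op :: "complex set \<Rightarrow> (complex \<Rightarrow> 'f::ab_group_add \<Rightarrow> 'f) \<Rightarrow> 'f set \<Rightarrow> 'y set \<Rightarrow> 'y set
    \<Rightarrow> ('y \<Rightarrow> 'f) set \<Rightarrow> (('y \<Rightarrow> 'f) \<Rightarrow> 'y \<Rightarrow> 'f) \<Rightarrow> bool" where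
  "lin_op K sc VF Omega om D T \<longleftrightarrow>
     D \<subseteq> {f. (\<forall>x. f x \<in> VF) \<and> (\<forall>x. x \<notin> Omega \<longrightarrow> f x = 0)}
     \<and> subspace_of K (\<lambda>c f. (\<lambda>x. sc c (f x))) D
     \<and> (\<forall>f\<in>D. \<forall>x\<in>om. T f x \<in> VF)
     \<and> (\<forall>f\<in>D. \<forall>g\<in>D. \<forall>x\<in>om. T (f + g) x = T f x + T g x)
     \<and> (\<forall>a\<in>K. \<forall>f\<in>D. \<forall>x\<in>om. T (\<lambda>y. sc a (f y)) x = sc a (T f x))"

definition delta_on :: "('y \<Rightarrow> complex) set \<Rightarrow> 'y \<Rightarrow> ('y \<Rightarrow> complex) \<Rightarrow> complex" where
  "delta_on V x = (\<lambda>f. if f \<in> V then f x else 0)"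

definition Tfun_on :: "('y \<Rightarrow> complex) set \<Rightarrow> (('y \<Rightarrow> complex) \<Rightarrow> 'y \<Rightarrow> complex) \<Rightarrow> 'y \<Rightarrow> ('y \<Rightarrow> complex) \<Rightarrow> complex" where
  "Tfun_on V Tm x = (\<lambda>f. if f \<in> V then Tm f x else 0)"

definition kappa_sns :: "complex set \<Rightarrow> (complex \<Rightarrow> 'v::ab_group_add \<Rightarrow> 'v) \<Rightarrow> 'v set \<Rightarrow> ('v \<Rightarrow> real) set
    \<Rightarrow> (('v \<Rightarrow> complex) \<Rightarrow> real) set" where
  "kappa_sns K sc V P = {(\<lambda>\<phi>. SUP x\<in>C. cmod (\<phi> x)) | C. C \<subseteq> V \<and> C \<noteq> {} \<and> abs_convex K sc C
       \<and> compactin (lc_top V P) C}"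

definition eps_prod :: "complex set \<Rightarrow> ('y \<Rightarrow> complex) set \<Rightarrow> (('y \<Rightarrow> complex) \<Rightarrow> real) set
    \<Rightarrow> (complex \<Rightarrow> 'e::ab_group_add \<Rightarrow> 'e) \<Rightarrow> 'e set \<Rightarrow> ('e \<Rightarrow> real) set
    \<Rightarrow> ((('y \<Rightarrow> complex) \<Rightarrow> complex) \<Rightarrow> 'e) set" where
  "eps_prod K V P scE VE PE =
     {u. lin_map K fsc (lc_dual K fsc V P) scE VE u
       \<and> continuous_map (lc_top (lc_dual K fsc V P) (kappa_sns K fsc V P)) (lc_top VE PE) u
       \<and> (\<forall>\<phi>. \<phi> \<notin> lc_dual K fsc V P \<longrightarrow> u \<phi> = 0)}"

definition S_map :: "('y \<Rightarrow> complex) set \<Rightarrow> 'y set \<Rightarrow> ((('y \<Rightarrow> complex) \<Rightarrow> complex) \<Rightarrow> 'e::zero) \<Rightarrow> 'y \<Rightarrow> 'e" where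
  "S_map V Omega u = (\<lambda>x. if x \<in> Omega then u (delta_on V x) else 0)"

end

theory Submission
  imports Defs
begin

text \<open>Given \<open>F\<close> in the target space, let \<open>R e'\<close> be the unique function with
  \<open>T m (R e') x = e' (F (m, x))\<close> on \<open>U\<close>. For a continuous seminorm \<open>p\<close> of \<open>E\<close> let \<open>B p\<close> be the set of
  functionals dominated by \<open>p\<close>. The set \<open>R ` B p\<close> is a Banach disc: its span, normed by the gauge, is
  complete because the pointwise sum of a convergent series of functionals in \<open>B p\<close> is again in \<open>B p\<close>.
  The point functionals belonging to \<open>U\<close> separate points and are continuous for both
  topologies, so the inclusion of this Banach space into the function space has closed graph. Each of the
  three hypotheses supplies a closed graph theorem, hence \<open>R ` B p\<close> is bounded and, by the semi-Montel
  property, relatively compact. On its compact closure every continuous functional \<open>\<phi>\<close> is uniformly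
  approximated by linear combinations of point functionals; the same combinations of values of \<open>F\<close>
  converge in the complete space \<open>E\<close> to a vector \<open>u \<phi>\<close> with \<open>e' (u \<phi>) = \<phi> (R e')\<close>. The map \<open>u\<close> is the
  required element of the \<open>\<epsilon>\<close>-product.\<close>

section \<open>Vector spaces on a carrier and the Hahn-Banach theorem\<close>

text \<open>The difficulty is that \<open>F\<close> controls the image of \<open>B p\<close> under
  \<open>R\<close> only through the point functionals of \<open>U\<close>, and these need not
  determine the topology of the function space; boundedness in every seminorm has to be forced by a
  closed graph theorem, whose domain is a Banach space manufactured from the disc. That domain is
  realised inside the function space itself, not inside the dual of \<open>E\<close>, so that the
  map to be tested is an inclusion and its graph is a diagonal. Once boundedness is known,
  compactness serves twice: on a compact disc finitely many point functionals decide the size of a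
  continuous functional, and the compact discs are the sets over which the topology \<kappa> takes
  suprema, so the operator is continuous by the identity that defines it. Starting from the
  transpose \<open>R\<close> avoids the bidual of \<open>E\<close>: each value
  \<open>u \<phi>\<close> is a limit of explicit combinations of values of \<open>F\<close>, and
  this is where completeness of \<open>E\<close> enters.\<close>

locale kvs =
  fixes K :: "complex set" and sc :: "complex \<Rightarrow> 'v::ab_group_add \<Rightarrow> 'v" and V :: "'v set"
  assumes K: "K = \<real> \<or> K = UNIV" and vs: "vs K sc V"
begin

lemma K_of_real [simp]: "complex_of_real r \<in> K"
  using K by auto

lemma K_closed [simp]:
  "0 \<in> K" "1 \<in> K" "- 1 \<in> K"
  "a \<in> K \<Longrightarrow> b \<in> K \<Longrightarrow> a + b \<in> K" "a \<in> K \<Longrightarrow> b \<in> K \<Longrightarrow> a - b \<in> K"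
  "a \<in> K \<Longrightarrow> b \<in> K \<Longrightarrow> a * b \<in> K" "a \<in> K \<Longrightarrow> - a \<in> K" "a \<in> K \<Longrightarrow> inverse a \<in> K"
  "a \<in> K \<Longrightarrow> b \<in> K \<Longrightarrow> a / b \<in> K" "numeral n \<in> K"
  using K by auto

lemma zero_mem [simp]: "0 \<in> V" and add_mem [simp]: "x \<in> V \<Longrightarrow> y \<in> V \<Longrightarrow> x + y \<in> V"
  and sc_mem [simp]: "a \<in> K \<Longrightarrow> x \<in> V \<Longrightarrow> sc a x \<in> V"
  and sc_add: "a \<in> K \<Longrightarrow> x \<in> V \<Longrightarrow> y \<in> V \<Longrightarrow> sc a (x + y) = sc a x + sc a y"
  and add_sc: "a \<in> K \<Longrightarrow> b \<in> K \<Longrightarrow> x \<in> V \<Longrightarrow> sc (a + b) x = sc a x + sc b x"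
  and sc_sc: "a \<in> K \<Longrightarrow> b \<in> K \<Longrightarrow> x \<in> V \<Longrightarrow> sc a (sc b x) = sc (a * b) x"
  and sc_one [simp]: "x \<in> V \<Longrightarrow> sc 1 x = x"
  using vs unfolding vs_def by (blast, blast, blast, blast, blast, metis, blast)

lemma sc_zero [simp]: "x \<in> V \<Longrightarrow> sc 0 x = 0"
  using add_sc[of 0 0 x] by simp

lemma sc_zero_right [simp]: "a \<in> K \<Longrightarrow> sc a 0 = 0"
  using sc_add[of a 0 0] by simp

lemma sc_minus_one: "x \<in> V \<Longrightarrow> sc (- 1) x = - x"
  using add_sc[of 1 "- 1" x] by (simp add: eq_neg_iff_add_eq_0 add.commute)

lemma minus_mem [simp]: "x \<in> V \<Longrightarrow> - x \<in> V"
  using sc_mem[of "- 1" x] by (simp add: sc_minus_one)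

lemma diff_mem [simp]: "x \<in> V \<Longrightarrow> y \<in> V \<Longrightarrow> x - y \<in> V"
  using add_mem[of x "- y"] by simp

lemma sc_minus: "a \<in> K \<Longrightarrow> x \<in> V \<Longrightarrow> sc a (- x) = - sc a x"
  using sc_add[of a x "- x"] by (simp add: eq_neg_iff_add_eq_0 add.commute)

lemma sc_diff: "a \<in> K \<Longrightarrow> x \<in> V \<Longrightarrow> y \<in> V \<Longrightarrow> sc a (x - y) = sc a x - sc a y"
  using sc_add[of a x "- y"] by (simp add: sc_minus)

lemma minus_sc: "a \<in> K \<Longrightarrow> x \<in> V \<Longrightarrow> sc (- a) x = - sc a x"
  using add_sc[of a "- a" x] by (simp add: eq_neg_iff_add_eq_0 add.commute)

lemma sum_mem [simp]: "(\<And>i. i \<in> I \<Longrightarrow> f i \<in> V) \<Longrightarrow> sum f I \<in> V"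
  by (induction I rule: infinite_finite_induct) auto

lemma seminorm_nonneg: "seminorm_on K sc V p \<Longrightarrow> x \<in> V \<Longrightarrow> 0 \<le> p x"
  and seminorm_add: "seminorm_on K sc V p \<Longrightarrow> x \<in> V \<Longrightarrow> y \<in> V \<Longrightarrow> p (x + y) \<le> p x + p y"
  and seminorm_sc: "seminorm_on K sc V p \<Longrightarrow> a \<in> K \<Longrightarrow> x \<in> V \<Longrightarrow> p (sc a x) = cmod a * p x"
  unfolding seminorm_on_def by blast+

lemma seminorm_zero: "seminorm_on K sc V p \<Longrightarrow> p 0 = 0"
  using seminorm_sc[of p 0 0] by simp

lemma seminorm_minus: "seminorm_on K sc V p \<Longrightarrow> x \<in> V \<Longrightarrow> p (- x) = p x"
  using seminorm_sc[of p "- 1" x] by (simp add: sc_minus_one)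

lemma seminorm_diff: "seminorm_on K sc V p \<Longrightarrow> x \<in> V \<Longrightarrow> y \<in> V \<Longrightarrow> p (x - y) \<le> p x + p y"
  using seminorm_add[of p x "- y"] by (simp add: seminorm_minus)

lemma seminorm_commute: "seminorm_on K sc V p \<Longrightarrow> x \<in> V \<Longrightarrow> y \<in> V \<Longrightarrow> p (x - y) = p (y - x)"
  using seminorm_minus[of p "x - y"] by simp

lemma seminorm_triangle:
  "seminorm_on K sc V p \<Longrightarrow> x \<in> V \<Longrightarrow> y \<in> V \<Longrightarrow> z \<in> V \<Longrightarrow> p (x - z) \<le> p (x - y) + p (y - z)"
  using seminorm_add[of p "x - y" "y - z"] by simp

section \<open>Sublinear functionals and minimal elements among them\<close>

definition sublinear :: "('v \<Rightarrow> real) \<Rightarrow> bool" where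
  "sublinear q \<longleftrightarrow> (\<forall>x\<in>V. \<forall>y\<in>V. q (x + y) \<le> q x + q y)
     \<and> (\<forall>r>0. \<forall>x\<in>V. q (sc (complex_of_real r) x) = r * q x)"

lemma sublinear_add: "sublinear q \<Longrightarrow> x \<in> V \<Longrightarrow> y \<in> V \<Longrightarrow> q (x + y) \<le> q x + q y"
  and sublinear_pos: "sublinear q \<Longrightarrow> r > 0 \<Longrightarrow> x \<in> V \<Longrightarrow> q (sc (complex_of_real r) x) = r * q x"
  unfolding sublinear_def by blast+

lemma sublinear_zero: "sublinear q \<Longrightarrow> q 0 = 0"
  using sublinear_pos[of q 2 0] sc_zero_right[of 2] K_of_real[of 2] by simp

lemma sublinear_scale: "sublinear q \<Longrightarrow> r \<ge> 0 \<Longrightarrow> x \<in> V \<Longrightarrow> q (sc (complex_of_real r) x) = r * q x"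
  using sublinear_pos[of q r x] by (cases "r = 0") (auto simp: sublinear_zero)

lemma sublinear_minus: "sublinear q \<Longrightarrow> x \<in> V \<Longrightarrow> - q (- x) \<le> q x"
  using sublinear_add[of q x "- x"] sublinear_zero[of q] by simp

text \<open>The Hahn-Banach theorem is obtained from minimal sublinear functionals: pushing a minimal one
  down in the direction of \<open>v\<close> cannot change it, which forces additivity.\<close>

lemma sublinear_pushdown:
  assumes q: "sublinear q" and v: "v \<in> V"
  shows "\<exists>q'. sublinear q' \<and> (\<forall>x\<in>V. \<forall>t\<ge>0. q' x \<le> q (x + sc (complex_of_real t) v) - t * q v)"
proof -
  define h where "h x t = q (x + sc (complex_of_real t) v) - t * q v" for x t
  define q' where "q' x = (INF t\<in>{0..}. h x t)" for x
  \<comment> \<open>Writing \<open>t * v\<close> as the sum of \<open>- x\<close> and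
    \<open>x + t * v\<close> bounds \<open>h x\<close> below independently of \<open>t\<close>, so
    the infimum is a genuine one.\<close>
  have lower: "- q (- x) \<le> h x t" if "x \<in> V" "t \<ge> 0" for x t
  proof -
    have "q (- x + (x + sc (complex_of_real t) v)) \<le> q (- x) + q (x + sc (complex_of_real t) v)"
      using that v by (intro sublinear_add[OF q]) auto
    then show ?thesis
      using that v sublinear_scale[OF q \<open>t \<ge> 0\<close> v] by (simp add: h_def)
  qed
  have le: "q' x \<le> h x t" if "x \<in> V" "t \<ge> 0" for x t
    unfolding q'_def using that lower[OF that(1)] by (intro cINF_lower bdd_belowI2[where m="- q (- x)"]) auto
  have greatest: "c \<le> q' x" if "\<And>t. t \<ge> 0 \<Longrightarrow> c \<le> h x t" for c x
    unfolding q'_def using that by (intro cINF_greatest) auto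
  have add: "q' (x + y) \<le> q' x + q' y" if x: "x \<in> V" and y: "y \<in> V" for x y
  proof -
    have *: "q' (x + y) \<le> h x s + h y t" if "s \<ge> 0" "t \<ge> 0" for s t
    proof -
      have "q' (x + y) \<le> h (x + y) (s + t)"
        using x y that by (intro le) auto
      also have "\<dots> \<le> h x s + h y t"
        using sublinear_add[OF q, of "x + sc (complex_of_real s) v" "y + sc (complex_of_real t) v"] x y v
        by (simp add: h_def add_sc algebra_simps)
      finally show ?thesis .
    qed
    have "q' (x + y) - h x s \<le> q' y" if "s \<ge> 0" for s
      using *[OF that] by (intro greatest) (simp add: algebra_simps)
    then have "q' (x + y) - q' y \<le> q' x"
      by (intro greatest) (simp add: algebra_simps)
    then show ?thesis by simp
  qed
  have hom_le: "q' (sc (complex_of_real r) x) \<le> r * q' x" if r: "r > 0" and x: "x \<in> V" for r x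
  proof -
    have "q' (sc (complex_of_real r) x) / r \<le> h x t" if "t \<ge> 0" for t
    proof -
      have "q' (sc (complex_of_real r) x) \<le> h (sc (complex_of_real r) x) (r * t)"
        using r x that by (intro le) auto
      also have "sc (complex_of_real r) x + sc (complex_of_real (r * t)) v
          = sc (complex_of_real r) (x + sc (complex_of_real t) v)"
        using r x v by (simp add: sc_add sc_sc)
      then have "h (sc (complex_of_real r) x) (r * t) = r * h x t"
        using sublinear_pos[OF q r, of "x + sc (complex_of_real t) v"] x v
        by (simp add: h_def algebra_simps)
      finally show ?thesis using r by (simp add: field_simps)
    qed
    from greatest[OF this] show ?thesis using r by (simp add: field_simps)
  qed
  have "q' (sc (complex_of_real r) x) = r * q' x" if r: "r > 0" and x: "x \<in> V" for r x
  proof (rule antisym)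
    \<comment> \<open>The inequality already proved, applied with factor \<open>1 / r\<close> to the
      scaled vector, is the reverse inequality.\<close>
    have "q' (sc (complex_of_real (1 / r)) (sc (complex_of_real r) x))
        \<le> (1 / r) * q' (sc (complex_of_real r) x)"
      using r x by (intro hom_le) auto
    moreover have "sc (complex_of_real (1 / r)) (sc (complex_of_real r) x) = x"
      using sc_sc[of "complex_of_real (1 / r)" "complex_of_real r" x] x r
      by simp
    ultimately show "r * q' x \<le> q' (sc (complex_of_real r) x)"
      using r by (simp add: field_simps)
  qed (rule hom_le[OF r x])
  with add have "sublinear q'" unfolding sublinear_def by blast
  with le show ?thesis unfolding h_def by blast
qed

text \<open>Zorn's lemma for the reversed pointwise order. Infima of chains are finite because every
  sublinear \<open>q\<close> below \<open>p\<close> satisfies \<open>- p (- x) \<le> q x\<close>.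
  Members of \<open>A\<close> vanish outside \<open>V\<close>, which makes comparison on
  \<open>V\<close> the same as the order on functions, to which Zorn's lemma applies.\<close>

lemma minimal_sublinear:
  assumes p: "sublinear p"
  shows "\<exists>q. sublinear q \<and> (\<forall>x\<in>V. q x \<le> p x)
    \<and> (\<forall>q'. sublinear q' \<longrightarrow> (\<forall>x\<in>V. q' x \<le> q x) \<longrightarrow> (\<forall>x\<in>V. q' x = q x))"
proof -
  define A where "A = {q. sublinear q \<and> (\<forall>x\<in>V. q x \<le> p x) \<and> (\<forall>x. x \<notin> V \<longrightarrow> q x = 0)}"
  define ext :: "('v \<Rightarrow> real) \<Rightarrow> 'v \<Rightarrow> real" where "ext q x = (if x \<in> V then q x else 0)" for q x
  have sub_ext: "sublinear (ext q)" if "sublinear q" for q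
    using that unfolding sublinear_def ext_def by auto
  have "\<exists>m\<in>A. \<forall>a\<in>A. m \<ge> a \<longrightarrow> a = m"
  proof (rule predicate_Zorn)
    show "partial_order_on A (relation_of (\<lambda>a b. a \<ge> b) A)"
      by (rule partial_order_on_relation_ofI) auto
  next
    fix C assume "C \<in> Chains (relation_of (\<lambda>a b. a \<ge> b) A)"
    then have CA: "C \<subseteq> A" and chain: "\<And>a b. a \<in> C \<Longrightarrow> b \<in> C \<Longrightarrow> a \<ge> b \<or> b \<ge> a"
      unfolding Chains_def relation_of_def by auto
    show "\<exists>u\<in>A. \<forall>a\<in>C. a \<ge> u"
    proof (cases "C = {}")
      case True
      have "ext p \<in> A"
        using sub_ext[OF p] by (auto simp: A_def ext_def)
      with True show ?thesis by blast
    next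
      case False
      define u where "u = ext (\<lambda>x. INF q\<in>C. q x)"
      have lower: "- p (- x) \<le> q x" if "q \<in> C" "x \<in> V" for q x
        using sublinear_minus[of q x] CA that minus_mem[OF that(2)] unfolding A_def by fastforce
      have le: "u x \<le> q x" if "q \<in> C" for q x
      proof (cases "x \<in> V")
        case True
        then show ?thesis
          unfolding u_def ext_def using that lower
          by (auto intro!: cINF_lower bdd_belowI2[where m="- p (- x)"])
      next
        case False
        then show ?thesis using that CA unfolding u_def ext_def A_def by force
      qed
      have greatest: "c \<le> u x" if "\<And>q. q \<in> C \<Longrightarrow> c \<le> q x" "x \<in> V" for c x
        unfolding u_def ext_def using that False by (auto intro!: cINF_greatest)
      have subC: "sublinear q" if "q \<in> C" for q using that CA unfolding A_def by auto
      have add: "u (x + y) \<le> u x + u y" if x: "x \<in> V" and y: "y \<in> V" for x y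
      proof -
        have *: "u (x + y) \<le> q1 x + q2 y" if q: "q1 \<in> C" "q2 \<in> C" for q1 q2
        proof -
          \<comment> \<open>Subadditivity of the infimum rests on comparability: the smaller of
            \<open>q1\<close> and \<open>q2\<close> lies below both.\<close>
          obtain q where "q \<in> C" "q \<le> q1" "q \<le> q2"
            using chain[OF q] q by auto
          then show ?thesis
            using le[of q "x + y"] sublinear_add[OF subC x y, of q]
            by (smt (verit) le_fun_def)
        qed
        have "u (x + y) - q1 x \<le> u y" if "q1 \<in> C" for q1
          using *[OF that] y by (intro greatest) (auto simp: algebra_simps)
        then have "u (x + y) - u y \<le> u x"
          using x by (intro greatest) (auto simp: algebra_simps)
        then show ?thesis by simp
      qed
      have hom_le: "u (sc (complex_of_real r) x) \<le> r * u x" if r: "r > 0" and x: "x \<in> V" for r x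
      proof -
        have "u (sc (complex_of_real r) x) / r \<le> q x" if "q \<in> C" for q
          using le[OF that, of "sc (complex_of_real r) x"] sublinear_pos[OF subC[OF that] r x] r
          by (simp add: field_simps)
        then have "u (sc (complex_of_real r) x) / r \<le> u x"
          by (rule greatest[OF _ x])
        then show ?thesis using r by (simp add: field_simps)
      qed
      have hom_ge: "r * u x \<le> u (sc (complex_of_real r) x)" if r: "r > 0" and x: "x \<in> V" for r x
        using r x le subC by (intro greatest) (auto simp: sublinear_pos)
      have "sublinear u"
        unfolding sublinear_def using add hom_le hom_ge by (meson antisym)
      moreover have "u x \<le> p x" if "x \<in> V" for x
        using False le[of _ x] CA that unfolding A_def by force
      ultimately have "u \<in> A" by (auto simp: A_def u_def ext_def)
      with le show ?thesis by (auto simp: le_fun_def)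
    qed
  qed
  then obtain m where m: "m \<in> A" "\<And>a. a \<in> A \<Longrightarrow> a \<le> m \<Longrightarrow> a = m" by blast
  have "\<forall>x\<in>V. q' x = m x" if q': "sublinear q'" "\<forall>x\<in>V. q' x \<le> m x" for q'
  proof -
    have "ext q' \<in> A"
      using sub_ext[OF q'(1)] q'(2) m(1) unfolding A_def ext_def by force
    moreover have "ext q' \<le> m"
      using q'(2) m(1) unfolding A_def ext_def le_fun_def by auto
    ultimately have "ext q' = m" by (rule m(2))
    then show ?thesis unfolding ext_def by auto
  qed
  with m(1) show ?thesis unfolding A_def by blast
qed

text \<open>Pushing \<open>p\<close> down along \<open>x0\<close> before passing to a minimal
  functional fixes the value at \<open>x0\<close>: with \<open>t = 1\<close> the pushed functional
  is at most \<open>- p x0\<close> at \<open>- x0\<close>, so a linear functional below it must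
  attain \<open>p\<close> at \<open>x0\<close>.\<close>

lemma linear_below_sublinear:
  assumes p: "sublinear p" and x0: "x0 \<in> V"
  shows "\<exists>f. (\<forall>x\<in>V. \<forall>y\<in>V. f (x + y) = f x + f y)
    \<and> (\<forall>r. \<forall>x\<in>V. f (sc (complex_of_real r) x) = r * f x) \<and> (\<forall>x\<in>V. f x \<le> p x) \<and> f x0 = p x0"
proof -
  obtain p' where p': "sublinear p'"
    "\<And>x t. x \<in> V \<Longrightarrow> t \<ge> 0 \<Longrightarrow> p' x \<le> p (x + sc (complex_of_real t) x0) - t * p x0"
    using sublinear_pushdown[OF p x0] by blast
  obtain f where f: "sublinear f" "\<And>x. x \<in> V \<Longrightarrow> f x \<le> p' x"
    and min: "\<And>q'. sublinear q' \<Longrightarrow> \<forall>x\<in>V. q' x \<le> f x \<Longrightarrow> \<forall>x\<in>V. q' x = f x"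
    using minimal_sublinear[OF p'(1)] by blast
  have add: "f (x + v) = f x + f v" if x: "x \<in> V" and v: "v \<in> V" for x v
  proof -
    obtain q' where q': "sublinear q'"
      "\<And>x t. x \<in> V \<Longrightarrow> t \<ge> 0 \<Longrightarrow> q' x \<le> f (x + sc (complex_of_real t) v) - t * f v"
      using sublinear_pushdown[OF f(1) v] by blast
    \<comment> \<open>\<open>t = 0\<close> places the push along \<open>v\<close> below
      \<open>f\<close>, so minimality makes it equal to \<open>f\<close>; \<open>t = 1\<close> then
      gives the missing half \<open>f x + f v \<le> f (x + v)\<close> of additivity.\<close>
    have "\<forall>x\<in>V. q' x = f x"
      using q'(2)[of _ 0] v by (intro min q'(1)) auto
    then show ?thesis
      using q'(2)[OF x, of 1] sublinear_add[OF f(1) x v] x v by auto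
  qed
  have neg: "f (- x) = - f x" if "x \<in> V" for x
    using add[of x "- x"] that sublinear_zero[OF f(1)] by simp
  have "f (sc (complex_of_real r) x) = r * f x" if x: "x \<in> V" for r x
  proof (cases "r \<ge> 0")
    case False
    then have "f (sc (complex_of_real (- r)) x) = - r * f x"
      by (intro sublinear_pos f(1) x) auto
    moreover have "sc (complex_of_real (- r)) x = - sc (complex_of_real r) x"
      using x by (simp add: minus_sc)
    ultimately show ?thesis using x by (simp add: neg)
  qed (use sublinear_scale[OF f(1) _ x] in auto)
  moreover have below: "f x \<le> p x" if "x \<in> V" for x
    using f(2)[OF that] p'(2)[OF that, of 0] x0 that by auto
  moreover have "f x0 = p x0"
  proof (rule antisym)
    have "f (- x0) \<le> - p x0"
      using f(2)[of "- x0"] p'(2)[of "- x0" 1] x0 sublinear_zero[OF p] by auto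
    then show "p x0 \<le> f x0" using neg[OF x0] by simp
  qed (rule below[OF x0])
  ultimately show ?thesis using add by blast
qed

text \<open>One value is prescribed instead of extending from a subspace, which is the norming form
  needed by \<open>Dual_norming\<close>. For complex scalars the real functional \<open>f\<close> is
  complexified to \<open>f x - \<i> * f (\<i> * x)\<close>, and the modulus is bounded by rotating
  the value onto the positive real axis.\<close>

lemma hahn_banach:
  assumes p: "seminorm_on K sc V p" and x0: "x0 \<in> V"
  shows "\<exists>\<phi>. lin_map K sc V (*) K \<phi> \<and> (\<forall>x\<in>V. cmod (\<phi> x) \<le> p x) \<and> p x0 \<le> cmod (\<phi> x0)
    \<and> (\<forall>x. x \<notin> V \<longrightarrow> \<phi> x = 0)"
proof -
  have "sublinear p"
    using p unfolding sublinear_def seminorm_on_def by auto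
  from linear_below_sublinear[OF this x0] obtain f where
    add: "\<And>x y. x \<in> V \<Longrightarrow> y \<in> V \<Longrightarrow> f (x + y) = f x + f y"
    and sc: "\<And>r x. x \<in> V \<Longrightarrow> f (sc (complex_of_real r) x) = r * f x"
    and le: "\<And>x. x \<in> V \<Longrightarrow> f x \<le> p x" and eq: "f x0 = p x0" by blast
  have neg: "f (- x) = - f x" if "x \<in> V" for x
    using sc[OF that, of "- 1"] sc_minus_one[OF that] by simp
  show ?thesis
  proof (cases "K = UNIV")
    case True
    define \<phi> where "\<phi> x = (if x \<in> V then Complex (f x) (- f (sc \<i> x)) else 0)" for x
    have iV: "sc \<i> x \<in> V" if "x \<in> V" for x using True that by auto
    have decomp: "sc a x = sc (complex_of_real (Re a)) x + sc (complex_of_real (Im a)) (sc \<i> x)" if "x \<in> V" for a x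
    proof -
      have a: "a = complex_of_real (Re a) + complex_of_real (Im a) * \<i>"
        by (simp add: complex_eq_iff)
      have "sc (complex_of_real (Re a) + complex_of_real (Im a) * \<i>) x
          = sc (complex_of_real (Re a)) x + sc (complex_of_real (Im a)) (sc \<i> x)"
        using that True by (simp add: add_sc sc_sc)
      then show ?thesis by (simp flip: a)
    qed
    have fsc: "f (sc a x) = Re a * f x + Im a * f (sc \<i> x)" if "x \<in> V" for a x
      using that iV by (subst decomp[OF that]) (simp add: add sc)
    have phi_sc: "\<phi> (sc a x) = a * \<phi> x" if x: "x \<in> V" for a x
    proof -
      have "sc \<i> (sc a x) = sc (\<i> * a) x" using x True by (simp add: sc_sc)
      then have "f (sc \<i> (sc a x)) = - Im a * f x + Re a * f (sc \<i> x)"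
        using fsc[OF x, of "\<i> * a"] by simp
      then show ?thesis
        using x True fsc[OF x, of a] by (simp add: \<phi>_def complex_eq_iff)
    qed
    have bound: "cmod (\<phi> x) \<le> p x" if x: "x \<in> V" for x
    proof (cases "\<phi> x = 0")
      case True
      then show ?thesis using seminorm_nonneg[OF p x] by simp
    next
      case False
      define a where "a = cnj (\<phi> x) / cmod (\<phi> x)"
      have a1: "cmod a = 1" using False by (simp add: a_def norm_divide)
      have "a * \<phi> x = cmod (\<phi> x)"
        using False complex_norm_square[of "\<phi> x"] by (simp add: a_def field_simps power2_eq_square)
      then have "cmod (\<phi> x) = Re (\<phi> (sc a x))" by (simp add: phi_sc[OF x])
      also have "\<dots> = f (sc a x)" using x True \<open>K = UNIV\<close> by (simp add: \<phi>_def)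
      also have "\<dots> \<le> p (sc a x)" using x \<open>K = UNIV\<close> by (intro le) auto
      also have "\<dots> = p x" using seminorm_sc[OF p _ x, of a] a1 \<open>K = UNIV\<close> by simp
      finally show ?thesis .
    qed
    have "\<phi> (x + y) = \<phi> x + \<phi> y" if "x \<in> V" "y \<in> V" for x y
      using that True iV by (simp add: \<phi>_def add sc_add complex_eq_iff)
    with phi_sc True have "lin_map K sc V (*) K \<phi>"
      unfolding lin_map_def by auto
    moreover have "p x0 \<le> cmod (\<phi> x0)"
      using complex_Re_le_cmod[of "\<phi> x0"] x0 eq by (simp add: \<phi>_def)
    ultimately show ?thesis using bound by (intro exI[of _ \<phi>]) (auto simp: \<phi>_def)
  next
    case False
    then have KR: "K = \<real>" using K by auto
    define \<phi> where "\<phi> x = (if x \<in> V then complex_of_real (f x) else 0)" for x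
    have "lin_map K sc V (*) K \<phi>"
      unfolding lin_map_def KR using sc KR by (auto simp: \<phi>_def add sc elim!: Reals_cases)
    moreover have "cmod (\<phi> x) \<le> p x" if "x \<in> V" for x
      using le[of x] le[of "- x"] that by (simp add: \<phi>_def neg seminorm_minus[OF p])
    ultimately show ?thesis using x0 eq by (intro exI[of _ \<phi>]) (auto simp: \<phi>_def)
  qed
qed

end

section \<open>Locally convex topologies and duals\<close>

text \<open>Neighbourhoods are cut out by finite subsets of \<open>P\<close>: intersecting two of
  them unites the finite sets and takes the smaller radius. This also covers the weak* and \<kappa>
  seminorms, for which no directedness is established.\<close>

lemma openin_lc_top:
  "openin (lc_top V P) U \<longleftrightarrow> U \<subseteq> V \<and> (\<forall>x\<in>U. \<exists>F e. finite F \<and> F \<subseteq> P \<and> e > 0 \<and>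
      {y\<in>V. \<forall>p\<in>F. p (y - x) < e} \<subseteq> U)"
proof -
  define nb where "nb x U \<longleftrightarrow> (\<exists>F e. finite F \<and> F \<subseteq> P \<and> (e::real) > 0 \<and>
      {y\<in>V. \<forall>p\<in>F. p (y - x) < e} \<subseteq> U)" for x U
  define good where "good U \<longleftrightarrow> U \<subseteq> V \<and> (\<forall>x\<in>U. nb x U)" for U
  have nb_Int: "nb x (S \<inter> T)" if S: "nb x S" and T: "nb x T" for x S T
  proof -
    obtain F e where F: "finite F" "F \<subseteq> P" "e > 0" "{y\<in>V. \<forall>p\<in>F. p (y - x) < e} \<subseteq> S"
      using S unfolding nb_def by (elim exE conjE)
    obtain G d where G: "finite G" "G \<subseteq> P" "d > 0" "{y\<in>V. \<forall>p\<in>G. p (y - x) < d} \<subseteq> T"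
      using T unfolding nb_def by (elim exE conjE)
    show ?thesis
      unfolding nb_def using F G by (intro exI[of _ "F \<union> G"] exI[of _ "min e d"]) auto
  qed
  have nb_mono: "nb x T" if "nb x S" "S \<subseteq> T" for x S T
    using that unfolding nb_def by (meson order_trans)
  have "good (S \<inter> T)" if "good S" "good T" for S T
    using that nb_Int unfolding good_def by auto
  moreover have "good (\<Union>\<K>)" if "\<forall>S\<in>\<K>. good S" for \<K>
    using that nb_mono[OF _ Union_upper] unfolding good_def by (simp add: Sup_le_iff) blast
  ultimately have "istopology good" unfolding istopology_def by blast
  moreover have "lc_top V P = topology good"
    unfolding lc_top_def good_def[abs_def] nb_def ..
  ultimately have "openin (lc_top V P) U = good U"
    by (simp add: topology_inverse')
  then show ?thesis unfolding good_def nb_def .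
qed

lemma topspace_lc_top [simp]: "topspace (lc_top V P) = V"
proof (rule antisym)
  show "topspace (lc_top V P) \<subseteq> V"
    using openin_topspace[of "lc_top V P"] unfolding openin_lc_top by blast
  have "openin (lc_top V P) V"
    unfolding openin_lc_top by (auto intro!: exI[of _ "{}"] exI[of _ "1::real"])
  then show "V \<subseteq> topspace (lc_top V P)" by (rule openin_subset)
qed

locale lcs = kvs K sc V for K :: "complex set" and sc :: "complex \<Rightarrow> 'v::ab_group_add \<Rightarrow> 'v" and V +
  fixes P :: "('v \<Rightarrow> real) set"
  assumes sn: "p \<in> P \<Longrightarrow> seminorm_on K sc V p"
begin

abbreviation "Dual \<equiv> lc_dual K sc V P"

lemma openin_ball:
  assumes x: "x \<in> V" and F: "finite F" "F \<subseteq> P"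
  shows "openin (lc_top V P) {y\<in>V. \<forall>p\<in>F. p (y - x) < e}"
  unfolding openin_lc_top
proof (intro conjI ballI)
  fix y assume "y \<in> {y\<in>V. \<forall>p\<in>F. p (y - x) < e}"
  then have y: "y \<in> V" "\<And>p. p \<in> F \<Longrightarrow> p (y - x) < e" by auto
  \<comment> \<open>Inserting \<open>1\<close> keeps \<open>Min\<close> meaningful when
    \<open>F\<close> is empty.\<close>
  define d where "d = Min (insert 1 ((\<lambda>p. e - p (y - x)) ` F))"
  have "d > 0" unfolding d_def using F y by (subst Min_gr_iff) auto
  moreover have "p (z - x) < e" if "z \<in> V" "\<forall>p\<in>F. p (z - y) < d" "p \<in> F" for z p
  proof -
    have "d \<le> e - p (y - x)" unfolding d_def using F that by (intro Min_le) auto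
    then show ?thesis
      using seminorm_triangle[OF sn, of p z y x] that x y(1) F by force
  qed
  ultimately show "\<exists>G d. finite G \<and> G \<subseteq> P \<and> d > 0 \<and>
      {z\<in>V. \<forall>p\<in>G. p (z - y) < d} \<subseteq> {y\<in>V. \<forall>p\<in>F. p (y - x) < e}"
    using F by (intro exI[of _ F] exI[of _ d]) auto
qed auto

lemma limitin_lc_top:
  "limitin (lc_top V P) f l A \<longleftrightarrow> l \<in> V \<and> (\<forall>\<^sub>F n in A. f n \<in> V)
     \<and> (\<forall>p\<in>P. \<forall>e>0. \<forall>\<^sub>F n in A. p (f n - l) < e)" (is "?L \<longleftrightarrow> ?R")
proof
  assume L: ?L
  have l: "l \<in> V" using limitin_topspace[OF L] by simp
  have 1: "\<forall>\<^sub>F n in A. f n \<in> V"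
    using L openin_topspace[of "lc_top V P"] l unfolding limitin_def by auto
  have "\<forall>\<^sub>F n in A. p (f n - l) < e" if p: "p \<in> P" and e: "e > 0" for p e
  proof -
    have "openin (lc_top V P) {y\<in>V. \<forall>p'\<in>{p}. p' (y - l) < e}"
      using p l by (intro openin_ball) auto
    moreover have "l \<in> {y\<in>V. \<forall>p'\<in>{p}. p' (y - l) < e}"
      using l e seminorm_zero[OF sn[OF p]] by simp
    ultimately have "\<forall>\<^sub>F n in A. f n \<in> {y\<in>V. \<forall>p'\<in>{p}. p' (y - l) < e}"
      using L unfolding limitin_def by blast
    then show ?thesis by eventually_elim auto
  qed
  with l 1 show ?R by blast
next
  assume R: ?R
  show ?L unfolding limitin_def
  proof (intro conjI allI impI)
    fix U assume U: "openin (lc_top V P) U \<and> l \<in> U"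
    then obtain F e where F: "finite F" "F \<subseteq> P" "e > 0" "{y\<in>V. \<forall>p\<in>F. p (y - l) < e} \<subseteq> U"
      unfolding openin_lc_top by fast
    have "\<forall>\<^sub>F n in A. \<forall>p\<in>F. p (f n - l) < e"
      using F R by (intro eventually_ball_finite) auto
    with conjunct1[OF conjunct2[OF R]] show "\<forall>\<^sub>F n in A. f n \<in> U"
      by eventually_elim (use F in auto)
  qed (use R in auto)
qed

lemma closure_of_lc_top:
  "x \<in> lc_top V P closure_of S \<longleftrightarrow> x \<in> V \<and> (\<forall>F e. finite F \<and> F \<subseteq> P \<and> e > 0
      \<longrightarrow> (\<exists>y\<in>S. y \<in> V \<and> (\<forall>p\<in>F. p (y - x) < e)))" (is "?L \<longleftrightarrow> ?R")
proof
  assume L: ?L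
  then have x: "x \<in> V" by (simp add: in_closure_of)
  have "\<exists>y\<in>S. y \<in> V \<and> (\<forall>p\<in>F. p (y - x) < e)" if F: "finite F" "F \<subseteq> P" "e > 0" for F e
  proof -
    define B where "B = {y\<in>V. \<forall>p\<in>F. p (y - x) < e}"
    have "x \<in> B" "openin (lc_top V P) B"
      using x F openin_ball[OF x F(1,2), of e] by (auto simp: B_def seminorm_zero sn subset_iff)
    moreover have "\<forall>T. x \<in> T \<and> openin (lc_top V P) T \<longrightarrow> (\<exists>y. y \<in> S \<and> y \<in> T)"
      using L by (simp add: in_closure_of)
    ultimately obtain y where "y \<in> S" "y \<in> B" by blast
    then show ?thesis unfolding B_def by auto
  qed
  with x show ?R by blast
next
  assume R: ?R
  show ?L unfolding in_closure_of
  proof (intro conjI allI impI)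
    fix U assume "x \<in> U \<and> openin (lc_top V P) U"
    then obtain F e where F: "finite F" "F \<subseteq> P" "e > 0" "{y\<in>V. \<forall>p\<in>F. p (y - x) < e} \<subseteq> U"
      unfolding openin_lc_top by fast
    with R obtain y where "y \<in> S" "y \<in> V" "\<forall>p\<in>F. p (y - x) < e" by meson
    with F show "\<exists>y. y \<in> S \<and> y \<in> U" by blast
  qed (use R in auto)
qed

lemma zero_nbhd_iff:
  "zero_nbhd V P U \<longleftrightarrow> U \<subseteq> V \<and> (\<exists>F e. finite F \<and> F \<subseteq> P \<and> e > 0 \<and> {y\<in>V. \<forall>p\<in>F. p y < e} \<subseteq> U)"
proof
  assume "zero_nbhd V P U"
  then obtain W where W: "openin (lc_top V P) W" "0 \<in> W" "W \<subseteq> U" "U \<subseteq> V"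
    unfolding zero_nbhd_def by blast
  then obtain F e where "finite F" "F \<subseteq> P" "e > 0" "{y\<in>V. \<forall>p\<in>F. p (y - 0) < e} \<subseteq> W"
    unfolding openin_lc_top by fast
  with W show "U \<subseteq> V \<and> (\<exists>F e. finite F \<and> F \<subseteq> P \<and> e > 0 \<and> {y\<in>V. \<forall>p\<in>F. p y < e} \<subseteq> U)"
    by (intro conjI exI[of _ F] exI[of _ e]) auto
next
  assume "U \<subseteq> V \<and> (\<exists>F e. finite F \<and> F \<subseteq> P \<and> e > 0 \<and> {y\<in>V. \<forall>p\<in>F. p y < e} \<subseteq> U)"
  then obtain F e where F: "U \<subseteq> V" "finite F" "F \<subseteq> P" "e > 0" "{y\<in>V. \<forall>p\<in>F. p y < e} \<subseteq> U" by blast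
  then show "zero_nbhd V P U" unfolding zero_nbhd_def
    using openin_ball[of 0 F e]
    by (intro conjI exI[of _ "{y\<in>V. \<forall>p\<in>F. p y < e}"]) (auto simp: seminorm_zero sn subset_iff)
qed

lemma lin_map_zero: "lin_map K sc V (*) K \<phi> \<Longrightarrow> \<phi> 0 = 0"
  unfolding lin_map_def by (metis K_closed(1) mult_zero_left sc_zero zero_mem)

lemma lin_map_diff: "lin_map K sc V (*) K \<phi> \<Longrightarrow> x \<in> V \<Longrightarrow> y \<in> V \<Longrightarrow> \<phi> (x - y) = \<phi> x - \<phi> y"
  unfolding lin_map_def by (metis add_diff_cancel_right' diff_add_cancel diff_mem)

section \<open>Continuous functionals and their estimates by finite sums of seminorms\<close>

lemma mem_DualI:
  assumes lin: "lin_map K sc V (*) K \<phi>" and out: "\<And>x. x \<notin> V \<Longrightarrow> \<phi> x = 0"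
    and F: "finite F" "F \<subseteq> P" and C: "C \<ge> 0"
    and bound: "\<And>x. x \<in> V \<Longrightarrow> cmod (\<phi> x) \<le> C * (\<Sum>p\<in>F. p x)"
  shows "\<phi> \<in> Dual"
proof -
  have "openin (lc_top V P) {x\<in>V. \<phi> x \<in> W}" if W: "open W" for W
    unfolding openin_lc_top
  proof (intro conjI ballI)
    fix x assume "x \<in> {x\<in>V. \<phi> x \<in> W}"
    then have x: "x \<in> V" "\<phi> x \<in> W" by auto
    obtain r where r: "r > 0" "ball (\<phi> x) r \<subseteq> W" using W x open_contains_ball by blast
    \<comment> \<open>The \<open>+ 1\<close> keeps the denominator positive when
      \<open>C = 0\<close> or \<open>F\<close> is empty.\<close>
    define e where "e = r / (C * card F + 1)"
    have den: "C * card F + 1 > 0" using C by (simp add: add_nonneg_pos)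
    then have e: "e > 0" using r by (simp add: e_def)
    have "\<phi> y \<in> W" if y: "y \<in> V" "\<forall>p\<in>F. p (y - x) < e" for y
    proof -
      have "cmod (\<phi> y - \<phi> x) \<le> C * (\<Sum>p\<in>F. p (y - x))"
        using bound[of "y - x"] x y by (simp add: lin_map_diff[OF lin])
      also have "\<dots> \<le> C * (\<Sum>p\<in>F. e)"
        using y C by (intro mult_left_mono sum_mono) (auto simp: less_imp_le)
      also have "\<dots> < r"
        using den r C by (simp add: e_def field_simps)
      finally show ?thesis using r(2) by (auto simp: dist_norm norm_minus_commute)
    qed
    then show "\<exists>F e. finite F \<and> F \<subseteq> P \<and> e > 0 \<and> {y\<in>V. \<forall>p\<in>F. p (y - x) < e} \<subseteq> {x\<in>V. \<phi> x \<in> W}"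
      using F e by (intro exI[of _ F] exI[of _ e]) auto
  qed auto
  then have "continuous_map (lc_top V P) euclidean \<phi>"
    by (simp add: continuous_map_def)
  with lin out show ?thesis unfolding lc_dual_def by blast
qed

lemma Dual_lin: "\<phi> \<in> Dual \<Longrightarrow> lin_map K sc V (*) K \<phi>"
  and Dual_cont: "\<phi> \<in> Dual \<Longrightarrow> continuous_map (lc_top V P) euclidean \<phi>"
  and Dual_outside: "\<phi> \<in> Dual \<Longrightarrow> x \<notin> V \<Longrightarrow> \<phi> x = 0"
  unfolding lc_dual_def by auto

lemma Dual_mem_K: "\<phi> \<in> Dual \<Longrightarrow> x \<in> V \<Longrightarrow> \<phi> x \<in> K"
  and Dual_add: "\<phi> \<in> Dual \<Longrightarrow> x \<in> V \<Longrightarrow> y \<in> V \<Longrightarrow> \<phi> (x + y) = \<phi> x + \<phi> y"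
  and Dual_sc: "\<phi> \<in> Dual \<Longrightarrow> a \<in> K \<Longrightarrow> x \<in> V \<Longrightarrow> \<phi> (sc a x) = a * \<phi> x"
  using Dual_lin[of \<phi>] unfolding lin_map_def by auto

lemma Dual_diff: "\<phi> \<in> Dual \<Longrightarrow> x \<in> V \<Longrightarrow> y \<in> V \<Longrightarrow> \<phi> (x - y) = \<phi> x - \<phi> y"
  using lin_map_diff[OF Dual_lin] by blast

lemma Dual_zero: "\<phi> \<in> Dual \<Longrightarrow> \<phi> 0 = 0"
  using lin_map_zero[OF Dual_lin] .

lemma Dual_bound:
  assumes "\<phi> \<in> Dual"
  shows "\<exists>F C. finite F \<and> F \<subseteq> P \<and> C \<ge> 0 \<and> (\<forall>x\<in>V. cmod (\<phi> x) \<le> C * (\<Sum>p\<in>F. p x))"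
proof -
  have "openin (lc_top V P) {x\<in>V. \<phi> x \<in> ball 0 1}"
    using openin_continuous_map_preimage[OF Dual_cont[OF assms], of "ball 0 1"] by simp
  moreover have "0 \<in> {x\<in>V. \<phi> x \<in> ball 0 1}" using Dual_zero[OF assms] by simp
  ultimately obtain F e where F: "finite F" "F \<subseteq> P" "e > 0"
    and sub: "{y\<in>V. \<forall>p\<in>F. p (y - 0) < e} \<subseteq> {x\<in>V. \<phi> x \<in> ball 0 1}"
    unfolding openin_lc_top by meson
  have "cmod (\<phi> x) \<le> (1 / e) * (\<Sum>p\<in>F. p x)" if x: "x \<in> V" for x
  proof -
    have pos: "0 \<le> p x" if "p \<in> F" for p using that F seminorm_nonneg[OF sn x] by blast
    \<comment> \<open>Scaling uses any \<open>r\<close> strictly above the sum, because the sum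
      itself may be \<open>0\<close>; \<open>dense_ge\<close> then lets \<open>r\<close> decrease to
      it.\<close>
    have "e * cmod (\<phi> x) \<le> r" if r: "r > (\<Sum>p\<in>F. p x)" for r
    proof -
      have "0 \<le> (\<Sum>p\<in>F. p x)" by (rule sum_nonneg) (rule pos)
      with r have r0: "r > 0" by linarith
      have "p (sc (complex_of_real (e / r)) x) < e" if "p \<in> F" for p
      proof -
        have px: "p x < r" using member_le_sum[of p F "\<lambda>p. p x"] that F pos r by force
        have "p (sc (complex_of_real (e / r)) x) = e / r * p x"
          using seminorm_sc[OF sn K_of_real x, of p "e / r"] that F r0 by (auto simp: norm_divide)
        also have "\<dots> < e" using px F r0 by (simp add: field_simps)
        finally show ?thesis .
      qed
      then have "sc (complex_of_real (e / r)) x \<in> {y\<in>V. \<forall>p\<in>F. p (y - 0) < e}"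
        using sc_mem[OF K_of_real x, of "e / r"] by simp
      then have "sc (complex_of_real (e / r)) x \<in> {x\<in>V. \<phi> x \<in> ball 0 1}"
        using sub by blast
      moreover have "cmod (\<phi> (sc (complex_of_real (e / r)) x)) = e / r * cmod (\<phi> x)"
        unfolding Dual_sc[OF assms K_of_real x] using r0 F by (simp add: norm_mult norm_divide)
      ultimately have "e / r * cmod (\<phi> x) < 1" by simp
      then show ?thesis
        using r0 by (simp add: field_simps)
    qed
    then have "e * cmod (\<phi> x) \<le> (\<Sum>p\<in>F. p x)" by (rule dense_ge)
    then show ?thesis using F by (simp add: field_simps)
  qed
  with F show ?thesis by (intro exI[of _ F] exI[of _ "1 / e"]) auto
qed

lemma Dual_limit:
  "\<phi> \<in> Dual \<Longrightarrow> limitin (lc_top V P) f l A \<Longrightarrow> ((\<lambda>n. \<phi> (f n)) \<longlongrightarrow> \<phi> l) A"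
  using continuous_map_limit[OF Dual_cont, of \<phi> f l A] by (simp add: o_def)

lemma Dual_norming:
  assumes p: "p \<in> P" and x: "x \<in> V"
  shows "\<exists>\<phi>\<in>Dual. (\<forall>y\<in>V. cmod (\<phi> y) \<le> p y) \<and> p x \<le> cmod (\<phi> x)"
proof -
  obtain \<phi> where \<phi>: "lin_map K sc V (*) K \<phi>" "\<And>y. y \<in> V \<Longrightarrow> cmod (\<phi> y) \<le> p y" "p x \<le> cmod (\<phi> x)"
    "\<And>x. x \<notin> V \<Longrightarrow> \<phi> x = 0"
    using hahn_banach[OF sn[OF p] x] by blast
  have "\<phi> \<in> Dual"
    using \<phi> p by (intro mem_DualI[of \<phi> "{p}" 1]) auto
  with \<phi> show ?thesis by blast
qed

lemma Dual_add_mem: assumes "\<phi> \<in> Dual" "\<psi> \<in> Dual" shows "\<phi> + \<psi> \<in> Dual"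
proof -
  obtain F C where F: "finite F" "F \<subseteq> P" "C \<ge> 0" "\<And>x. x \<in> V \<Longrightarrow> cmod (\<phi> x) \<le> C * (\<Sum>p\<in>F. p x)"
    using Dual_bound[OF assms(1)] by blast
  obtain G D where G: "finite G" "G \<subseteq> P" "D \<ge> 0" "\<And>x. x \<in> V \<Longrightarrow> cmod (\<psi> x) \<le> D * (\<Sum>p\<in>G. p x)"
    using Dual_bound[OF assms(2)] by blast
  have "cmod ((\<phi> + \<psi>) x) \<le> (C + D) * (\<Sum>p\<in>F \<union> G. p x)" if x: "x \<in> V" for x
  proof -
    have pos: "0 \<le> p x" if "p \<in> F \<union> G" for p
      using that F(2) G(2) seminorm_nonneg[OF sn x] by blast
    have "cmod ((\<phi> + \<psi>) x) \<le> cmod (\<phi> x) + cmod (\<psi> x)"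
      by (simp add: norm_triangle_ineq)
    also have "\<dots> \<le> C * (\<Sum>p\<in>F. p x) + D * (\<Sum>p\<in>G. p x)"
      using F G x by (intro add_mono) auto
    also have "\<dots> \<le> C * (\<Sum>p\<in>F \<union> G. p x) + D * (\<Sum>p\<in>F \<union> G. p x)"
      using F G pos by (intro add_mono mult_left_mono sum_mono2) auto
    finally show ?thesis by (simp add: algebra_simps)
  qed
  then show ?thesis
    using F G Dual_lin[OF assms(1)] Dual_lin[OF assms(2)] Dual_outside[OF assms(1)] Dual_outside[OF assms(2)]
    by (intro mem_DualI[of _ "F \<union> G" "C + D"]) (auto simp: lin_map_def algebra_simps)
qed

lemma Dual_fsc_mem: assumes "\<phi> \<in> Dual" and a: "a \<in> K" shows "fsc a \<phi> \<in> Dual"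
proof -
  obtain F C where F: "finite F" "F \<subseteq> P" "C \<ge> 0" "\<And>x. x \<in> V \<Longrightarrow> cmod (\<phi> x) \<le> C * (\<Sum>p\<in>F. p x)"
    using Dual_bound[OF assms(1)] by blast
  have "cmod (fsc a \<phi> x) \<le> (cmod a * C) * (\<Sum>p\<in>F. p x)" if "x \<in> V" for x
    using mult_left_mono[OF F(4)[OF that], of "cmod a"] by (simp add: fsc_def norm_mult)
  then show ?thesis
    using F a Dual_lin[OF assms(1)] Dual_outside[OF assms(1)]
    by (intro mem_DualI[of _ F "cmod a * C"]) (auto simp: lin_map_def fsc_def algebra_simps)
qed

lemma Dual_zero_mem: "0 \<in> Dual"
  by (rule mem_DualI[of _ "{}" 0]) (simp_all add: lin_map_def)

lemma kvs_Dual: "kvs K fsc Dual"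
proof
  have "fsc a (\<phi> + \<psi>) = fsc a \<phi> + fsc a \<psi>" "fsc (a + b) \<phi> = fsc a \<phi> + fsc b \<phi>"
    "fsc (a * b) \<phi> = fsc a (fsc b \<phi>)" "fsc 1 \<phi> = \<phi>" for a b and \<phi> \<psi> :: "'v \<Rightarrow> complex"
    by (simp_all add: fsc_def fun_eq_iff algebra_simps)
  then show "vs K fsc Dual"
    unfolding vs_def using Dual_add_mem Dual_fsc_mem Dual_zero_mem by blast
qed (rule K)

end

section \<open>Gauges of Banach discs\<close>

definition meagre :: "'a topology \<Rightarrow> 'a set \<Rightarrow> bool" where
  "meagre X S \<longleftrightarrow> (\<exists>\<C>. countable \<C> \<and> (\<forall>T\<in>\<C>. closedin X T \<and> X interior_of T = {}) \<and> S \<subseteq> \<Union>\<C>)"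

lemma meagre_UN:
  assumes "\<And>n::nat. meagre X (S n)"
  shows "meagre X (\<Union>n. S n)"
proof -
  have "\<exists>\<C>. \<forall>n. countable (\<C> n) \<and> (\<forall>T\<in>\<C> n. closedin X T \<and> X interior_of T = {}) \<and> S n \<subseteq> \<Union>(\<C> n)"
    using assms unfolding meagre_def by (rule choice[OF allI])
  then obtain \<C> where "\<forall>n. countable (\<C> n) \<and> (\<forall>T\<in>\<C> n. closedin X T \<and> X interior_of T = {}) \<and> S n \<subseteq> \<Union>(\<C> n)"
    by blast
  then have \<C>: "\<And>n. countable (\<C> n)" "\<And>n T. T \<in> \<C> n \<Longrightarrow> closedin X T \<and> X interior_of T = {}"
    "\<And>n. S n \<subseteq> \<Union>(\<C> n)"
    by simp_all
  show ?thesis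
    unfolding meagre_def
  proof (intro exI[of _ "\<Union>n. \<C> n"] conjI ballI)
    show "(\<Union>n. S n) \<subseteq> \<Union>(\<Union>n. \<C> n)"
    proof
      fix x assume "x \<in> (\<Union>n. S n)"
      then obtain n where "x \<in> S n" by blast
      with \<C>(3)[of n] obtain T where "T \<in> \<C> n" "x \<in> T" by blast
      then show "x \<in> \<Union>(\<Union>n. \<C> n)" by blast
    qed
    show "countable (\<Union>n. \<C> n)" by (rule countable_UN) (use \<C>(1) in auto)
  qed (use \<C>(2) in blast)+
qed

text \<open>Otherwise the closure of \<open>S\<close> alone would be a cover witnessing that
  \<open>S\<close> is meagre.\<close>

lemma not_meagreD:
  assumes "\<not> meagre X S" "S \<subseteq> topspace X"
  shows "X interior_of (X closure_of S) \<noteq> {}"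
proof
  assume "X interior_of (X closure_of S) = {}"
  then have "meagre X S"
    unfolding meagre_def using closure_of_subset[OF assms(2)]
    by (intro exI[of _ "{X closure_of S}"]) auto
  with assms show False by blast
qed

lemma (in Metric_space) not_meagre_mspace:
  assumes "mcomplete" "M \<noteq> {}"
  shows "\<not> meagre mtopology M"
proof
  assume "meagre mtopology M"
  then obtain \<C> where "countable \<C>" "\<And>T. T \<in> \<C> \<Longrightarrow> closedin mtopology T \<and> mtopology interior_of T = {}" "M \<subseteq> \<Union>\<C>"
    unfolding meagre_def by auto
  then have "mtopology interior_of \<Union>\<C> = {}" and "\<Union>\<C> = M"
    using metric_Baire_category_alt[OF assms(1), of \<C>] closedin_subset by fastforce+
  then show False
    using assms(2) interior_of_topspace[of mtopology] by simp
qed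

section \<open>The Minkowski functional of an absolutely convex set\<close>

locale disc = kvs K sc V for K :: "complex set" and sc :: "complex \<Rightarrow> 'v::ab_group_add \<Rightarrow> 'v" and V +
  fixes D :: "'v set"
  assumes D_sub: "D \<subseteq> V" and D_acx: "abs_convex K sc D" and D_ne: "D \<noteq> {}"
begin

lemma D_mem [simp]: "d \<in> D \<Longrightarrow> d \<in> V"
  using D_sub by blast

lemma D_comb: "d \<in> D \<Longrightarrow> e \<in> D \<Longrightarrow> a \<in> K \<Longrightarrow> b \<in> K \<Longrightarrow> cmod a + cmod b \<le> 1 \<Longrightarrow> sc a d + sc b e \<in> D"
  using D_acx unfolding abs_convex_def by blast

lemma D_scale: "d \<in> D \<Longrightarrow> a \<in> K \<Longrightarrow> cmod a \<le> 1 \<Longrightarrow> sc a d \<in> D"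
  using D_comb[of d d a 0] by simp

lemma D_zero: "0 \<in> D"
  using D_ne D_scale[of _ 0] by force

definition radii :: "'v \<Rightarrow> real set" where
  "radii x = {r. r > 0 \<and> (\<exists>d\<in>D. x = sc (complex_of_real r) d)}"

text \<open>Because \<open>D\<close> is absolutely convex, the union of its positive multiples is
  already its linear span.\<close>

definition dspan :: "'v set" where
  "dspan = {x. radii x \<noteq> {}}"

definition gauge :: "'v \<Rightarrow> real" where
  "gauge x = Inf (radii x)"

lemma dspan_sub: "dspan \<subseteq> V"
  unfolding dspan_def radii_def by auto

lemma of_real_cancel: "s \<noteq> 0 \<Longrightarrow> complex_of_real s * complex_of_real (r / s) = complex_of_real r"
  by simp

lemma radii_add: "r \<in> radii x \<Longrightarrow> s \<in> radii y \<Longrightarrow> r + s \<in> radii (x + y)"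
proof -
  assume "r \<in> radii x" "s \<in> radii y"
  then obtain d e where d: "r > 0" "d \<in> D" "x = sc (complex_of_real r) d"
    and e: "s > 0" "e \<in> D" "y = sc (complex_of_real s) e"
    unfolding radii_def by auto
  define z where "z = sc (complex_of_real (r / (r + s))) d + sc (complex_of_real (s / (r + s))) e"
  have "cmod (complex_of_real (r / (r + s))) + cmod (complex_of_real (s / (r + s))) = r / (r + s) + s / (r + s)"
    using d(1) e(1) by (simp only: norm_of_real) simp
  also have "\<dots> = 1" using d(1) e(1) by (simp add: add_divide_distrib[symmetric])
  finally have "z \<in> D"
    unfolding z_def using d e by (intro D_comb) (simp_all only: K_of_real)
  have rs0: "r + s \<noteq> 0" using d(1) e(1) by simp
  have rs: "complex_of_real (r + s) * complex_of_real (r / (r + s)) = complex_of_real r"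
    "complex_of_real (r + s) * complex_of_real (s / (r + s)) = complex_of_real s"
    by (rule of_real_cancel[OF rs0])+
  have "sc (complex_of_real (r + s)) z = x + y"
    unfolding z_def d(3) e(3) using d(2) e(2) rs
    by (simp only: sc_add sc_mem D_mem K_of_real sc_sc)
  then show ?thesis
    using \<open>z \<in> D\<close> d(1) e(1) unfolding radii_def by force
qed

lemma radii_sc: "r \<in> radii x \<Longrightarrow> a \<in> K \<Longrightarrow> a \<noteq> 0 \<Longrightarrow> cmod a * r \<in> radii (sc a x)"
proof -
  assume "r \<in> radii x" and a: "a \<in> K" "a \<noteq> 0"
  then obtain d where d: "r > 0" "d \<in> D" "x = sc (complex_of_real r) d"
    unfolding radii_def by auto
  have "sc (a / cmod a) d \<in> D"
    using a d by (intro D_scale) (auto simp: norm_divide)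
  moreover have "complex_of_real (cmod a * r) * (a / cmod a) = a * complex_of_real r"
    using a by simp
  then have "sc (complex_of_real (cmod a * r)) (sc (a / cmod a) d) = sc a x"
    unfolding d(3) using a d(2) by (simp only: sc_sc D_mem K_of_real K_closed)
  ultimately show ?thesis
    using a d(1) unfolding radii_def by force
qed

lemma radii_mono: "r \<in> radii x \<Longrightarrow> r \<le> s \<Longrightarrow> s \<in> radii x"
proof -
  assume "r \<in> radii x" and rs: "r \<le> s"
  then obtain d where d: "r > 0" "d \<in> D" "x = sc (complex_of_real r) d"
    unfolding radii_def by auto
  have "sc (complex_of_real (r / s)) d \<in> D"
    using d rs by (intro D_scale) (simp_all only: K_of_real norm_of_real, simp)
  moreover have "complex_of_real s * complex_of_real (r / s) = complex_of_real r"
    using d(1) rs by (auto intro!: of_real_cancel)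
  then have "sc (complex_of_real s) (sc (complex_of_real (r / s)) d) = x"
    unfolding d(3) using d(2) by (simp only: sc_sc D_mem K_of_real)
  ultimately show ?thesis
    using d(1) rs unfolding radii_def by force
qed

lemma radii_zero: "r > 0 \<Longrightarrow> r \<in> radii 0"
  unfolding radii_def using D_zero by (auto intro!: bexI[of _ 0])

lemma radii_bdd: "bdd_below (radii x)"
  by (rule bdd_belowI[of _ 0]) (auto simp: radii_def)

lemma gauge_le: "r \<in> radii x \<Longrightarrow> gauge x \<le> r"
  unfolding gauge_def by (rule cInf_lower[OF _ radii_bdd])

lemma gauge_greatest: "x \<in> dspan \<Longrightarrow> (\<And>r. r \<in> radii x \<Longrightarrow> c \<le> r) \<Longrightarrow> c \<le> gauge x"
  unfolding gauge_def dspan_def by (auto intro: cInf_greatest)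

text \<open>The infimum need not be attained, so only radii strictly above the gauge are available;
  \<open>radii_mono\<close> supplies all of those.\<close>

lemma gauge_less: "x \<in> dspan \<Longrightarrow> gauge x < r \<Longrightarrow> r \<in> radii x"
  unfolding gauge_def dspan_def using cInf_lessD[of "radii x" r] radii_mono by fastforce

lemma gauge_lessE:
  assumes "x \<in> dspan" "gauge x < r"
  obtains d where "d \<in> D" "x = sc (complex_of_real r) d"
  using gauge_less[OF assms] unfolding radii_def by blast

lemma radii_scaled: "r > 0 \<Longrightarrow> d \<in> D \<Longrightarrow> r \<in> radii (sc (complex_of_real r) d)"
  unfolding radii_def by auto

lemma D_dspan: "d \<in> D \<Longrightarrow> d \<in> dspan" and gauge_D: "d \<in> D \<Longrightarrow> gauge d \<le> 1"
  using radii_scaled[of 1 d] gauge_le[of 1 d] by (auto simp: dspan_def)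

lemma kvs_dspan: "kvs K sc dspan"
proof
  have zero: "0 \<in> dspan" using radii_zero[of 1] unfolding dspan_def by auto
  have "sc a x \<in> dspan" if "a \<in> K" "x \<in> dspan" for a x
  proof (cases "a = 0")
    case True
    then show ?thesis using zero that dspan_sub by auto
  next
    case False
    then show ?thesis using radii_sc[of _ x a] that unfolding dspan_def by blast
  qed
  moreover have "x + y \<in> dspan" if "x \<in> dspan" "y \<in> dspan" for x y
    using radii_add that unfolding dspan_def by blast
  ultimately show "vs K sc dspan"
    using zero dspan_sub unfolding vs_def by (simp add: subset_iff sc_add add_sc sc_sc)
qed (rule K)

lemma gauge_seminorm: "seminorm_on K sc dspan gauge"
  unfolding seminorm_on_def
proof (intro conjI ballI)
  interpret G: kvs K sc dspan by (rule kvs_dspan)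
  have nonneg: "0 \<le> gauge x" if "x \<in> dspan" for x
    using that by (intro gauge_greatest) (auto simp: radii_def)
  then show "0 \<le> gauge x" if "x \<in> dspan" for x using that .
  show "gauge (x + y) \<le> gauge x + gauge y" if x: "x \<in> dspan" and y: "y \<in> dspan" for x y
  proof -
    have "gauge (x + y) - s \<le> gauge x" if "s \<in> radii y" for s
      using gauge_le[OF radii_add[OF _ that, of _ x]] by (intro gauge_greatest[OF x]) (simp add: algebra_simps)
    then have "gauge (x + y) - gauge x \<le> gauge y"
      by (intro gauge_greatest[OF y]) (simp add: algebra_simps)
    then show ?thesis by simp
  qed
  have le: "gauge (sc a x) \<le> cmod a * gauge x" if a: "a \<in> K" "a \<noteq> 0" and x: "x \<in> dspan" for a x
  proof -
    have "gauge (sc a x) / cmod a \<le> gauge x"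
      using a gauge_le[OF radii_sc[OF _ a, of _ x]]
      by (intro gauge_greatest[OF x]) (simp add: field_simps)
    then show ?thesis using a by (simp add: field_simps)
  qed
  have zero: "gauge 0 = 0"
  proof (rule antisym)
    show "gauge 0 \<le> 0"
      by (rule dense_ge) (use gauge_le radii_zero in blast)
  qed (rule nonneg[OF G.zero_mem])
  show "gauge (sc a x) = cmod a * gauge x" if a: "a \<in> K" and x: "x \<in> dspan" for a x
  proof (cases "a = 0")
    case False
    have "gauge (sc (inverse a) (sc a x)) \<le> cmod (inverse a) * gauge (sc a x)"
      using a False x by (intro le) auto
    also have "sc (inverse a) (sc a x) = x"
      using a False x by (simp add: G.sc_sc)
    finally have "cmod a * gauge x \<le> gauge (sc a x)"
      using False by (simp add: norm_inverse norm_divide field_simps)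
    with le[OF a False x] show ?thesis by simp
  qed (use zero x in simp)
qed

sublocale G: lcs K sc dspan "{gauge}"
  using kvs_dspan gauge_seminorm by (intro lcs.intro lcs_axioms.intro) auto

text \<open>Homogeneity carries the bound to multiples of \<open>D\<close>, and the infimum over
  radii carries it to the gauge. \<open>c\<close> cannot be negative, as \<open>h 0 = 0\<close> and
  \<open>0\<close> lies in \<open>D\<close>; for \<open>c = 0\<close>, where one cannot divide,
  \<open>h x \<le> 0\<close> is read off from a single radius.\<close>

lemma gauge_bound:
  assumes x: "x \<in> dspan" and D: "\<And>d. d \<in> D \<Longrightarrow> h d \<le> c"
    and hom: "\<And>r d. r > 0 \<Longrightarrow> d \<in> D \<Longrightarrow> h (sc (complex_of_real r) d) = r * (h d :: real)"
  shows "h x \<le> c * gauge x"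
proof -
  have h: "h x \<le> c * r" if r: "r \<in> radii x" for r
  proof -
    obtain d where "r > 0" "d \<in> D" "x = sc (complex_of_real r) d"
      using r unfolding radii_def by auto
    then show ?thesis using hom[of r d] D[of d] by (simp add: mult.commute)
  qed
  obtain r0 where r0: "r0 \<in> radii x" using x unfolding dspan_def by auto
  show ?thesis
  proof (cases "c > 0")
    case True
    then have "h x / c \<le> gauge x" using h by (intro gauge_greatest[OF x]) (simp add: field_simps)
    then show ?thesis using True by (simp add: field_simps)
  next
    case False
    have "h 0 = 0" using hom[OF _ D_zero, of 2] sc_zero_right[of "complex_of_real 2"] by simp
    then have "c = 0" using D[OF D_zero] False by simp
    then show ?thesis using h[OF r0] by simp
  qed
qed

end

text \<open>In \<open>series\<close> below, \<open>s n\<close> plays the role of the sum of all \<open>b (n + k) / 2 ^ (k + 1)\<close>; this form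
  needs no topology and suffices for the gauge of \<open>D\<close> to be a complete norm on its span.\<close>

locale banach_disc = disc K sc V D for K :: "complex set" and sc :: "complex \<Rightarrow> 'v::ab_group_add \<Rightarrow> 'v" and V D +
  assumes series: "(\<And>n. b n \<in> D) \<Longrightarrow>
      \<exists>s. (\<forall>n. s n \<in> D) \<and> (\<forall>n::nat. s n = sc (1 / 2) (b n) + sc (1 / 2) (s (Suc n)))"
    and separated: "x \<in> dspan \<Longrightarrow> gauge x = 0 \<Longrightarrow> x = 0"
begin

text \<open>\<open>Metric_space\<close> demands nonnegativity and symmetry on the whole type, hence
  the default \<open>0\<close> off the span.\<close>

definition gdist :: "'v \<Rightarrow> 'v \<Rightarrow> real" where
  "gdist x y = (if x \<in> dspan \<and> y \<in> dspan then gauge (x - y) else 0)"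

sublocale Metric_space dspan gdist
proof
  show "0 \<le> gdist x y" for x y
    using G.seminorm_nonneg[OF gauge_seminorm] by (simp add: gdist_def)
  show "gdist x y = gdist y x" for x y
    using G.seminorm_commute[OF gauge_seminorm] by (simp add: gdist_def)
  show "gdist x y = 0 \<longleftrightarrow> x = y" if "x \<in> dspan" "y \<in> dspan" for x y
    using separated[of "x - y"] that G.seminorm_zero[OF gauge_seminorm] by (auto simp: gdist_def)
  show "gdist x z \<le> gdist x y + gdist y z" if "x \<in> dspan" "y \<in> dspan" "z \<in> dspan" for x y z
    using G.seminorm_triangle[OF gauge_seminorm that] that by (simp add: gdist_def)
qed

lemma mball_eq: "x \<in> dspan \<Longrightarrow> mball x r = {y\<in>dspan. gauge (y - x) < r}"
  using G.seminorm_commute[OF gauge_seminorm, of x] by (auto simp: mball_def gdist_def)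

lemma mtopology_eq: "mtopology = lc_top dspan {gauge}"
proof -
  define N where "N x S \<longleftrightarrow> (\<exists>F e. finite F \<and> F \<subseteq> {gauge} \<and> (e::real) > 0 \<and> {y\<in>dspan. \<forall>p\<in>F. p (y - x) < e} \<subseteq> S)" for x S
  have "(\<exists>r>0. mball x r \<subseteq> S) \<longleftrightarrow> N x S" (is "?L \<longleftrightarrow> ?R") if x: "x \<in> dspan" for S x
  proof
    assume ?L
    then show ?R unfolding mball_eq[OF x] N_def
      by (elim exE conjE) (rule exI[of _ "{gauge}"], auto)
  next
    assume ?R
    then obtain F e where "F \<subseteq> {gauge}" "e > 0" "{y\<in>dspan. \<forall>p\<in>F. p (y - x) < e} \<subseteq> S"
      unfolding N_def by (elim exE conjE)
    then have "mball x e \<subseteq> S"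
      unfolding mball_eq[OF x] by auto
    with \<open>e > 0\<close> show ?L by blast
  qed
  then have "openin mtopology S \<longleftrightarrow> openin (lc_top dspan {gauge}) S" for S
    unfolding openin_mtopology openin_lc_top N_def[symmetric] by blast
  then show ?thesis by (simp add: topology_eq)
qed

text \<open>Along a subsequence the increments are \<open>(1/2) ^ Suc k\<close> times elements
  \<open>b k\<close> of \<open>D\<close>. The remainders \<open>s k\<close> from
  \<open>series\<close> make \<open>\<sigma> (m 0) + s 0\<close> the limit, since its difference
  from \<open>\<sigma> (m k)\<close> is \<open>(1/2) ^ k\<close> times \<open>s k\<close> and so has
  gauge at most \<open>(1/2) ^ k\<close>.\<close>

lemma mcomplete: "mcomplete"
  unfolding mcomplete_def
proof (intro allI impI)
  fix \<sigma> assume "MCauchy \<sigma>"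
  then have \<sigma>: "\<And>n. \<sigma> n \<in> dspan"
    and cauchy: "\<And>e. e > 0 \<Longrightarrow> \<exists>N. \<forall>n n'. N \<le> n \<longrightarrow> N \<le> n' \<longrightarrow> gdist (\<sigma> n) (\<sigma> n') < e"
    unfolding MCauchy_def by auto
  have "\<exists>N. \<forall>k n n'. N k \<le> n \<longrightarrow> N k \<le> n' \<longrightarrow> gdist (\<sigma> n) (\<sigma> n') < (1/2) ^ Suc k"
    by (intro choice allI cauchy) auto
  then obtain N where "\<forall>k n n'. N k \<le> n \<longrightarrow> N k \<le> n' \<longrightarrow> gdist (\<sigma> n) (\<sigma> n') < (1/2) ^ Suc k"
    by blast
  then have N: "\<And>k n n'. N k \<le> n \<Longrightarrow> N k \<le> n' \<Longrightarrow> gauge (\<sigma> n - \<sigma> n') < (1/2) ^ Suc k"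
    using \<sigma> unfolding gdist_def by simp
  \<comment> \<open>Summing the indices \<open>N i\<close> makes the subsequence monotone while
    staying beyond \<open>N k\<close>.\<close>
  define m where "m k = (\<Sum>i\<le>k. N i)" for k
  have mN: "N k \<le> m k" "m k \<le> m (Suc k)" for k
    unfolding m_def by (auto intro: member_le_sum)
  have "\<exists>d\<in>D. \<sigma> (m (Suc k)) - \<sigma> (m k) = sc (complex_of_real ((1/2) ^ Suc k)) d" for k
    using gauge_lessE[OF _ N[of k "m (Suc k)" "m k"]] mN[of k] \<sigma> by (metis G.diff_mem order_trans)
  then obtain b where b: "\<And>k. b k \<in> D" "\<And>k. \<sigma> (m (Suc k)) - \<sigma> (m k) = sc (complex_of_real ((1/2) ^ Suc k)) (b k)"
    by metis
  obtain s where s: "\<And>n. s n \<in> D" "\<And>n. s n = sc (1 / 2) (b n) + sc (1 / 2) (s (Suc n))"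
    using series[of b, OF b(1)] by blast
  define x where "x = \<sigma> (m 0) + s 0"
  have x: "x \<in> dspan" unfolding x_def using \<sigma> s(1) D_dspan by auto
  have eq: "x - \<sigma> (m k) = sc (complex_of_real ((1/2) ^ k)) (s k)" for k
  proof (induction k)
    case 0
    show ?case using s(1) by (simp add: x_def)
  next
    case (Suc k)
    have half: "complex_of_real ((1/2) ^ k) * (1 / 2) = complex_of_real ((1/2) ^ Suc k)"
      by simp
    have h: "1 / 2 \<in> K" using K_of_real[of "1/2"] by simp
    have "x - \<sigma> (m (Suc k)) = (x - \<sigma> (m k)) - (\<sigma> (m (Suc k)) - \<sigma> (m k))" by simp
    also have "\<dots> = sc (complex_of_real ((1/2) ^ k)) (sc (1 / 2) (b k) + sc (1 / 2) (s (Suc k)))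
        - sc (complex_of_real ((1/2) ^ Suc k)) (b k)"
      unfolding Suc b(2) s(2)[symmetric] ..
    also have "\<dots> = sc (complex_of_real ((1/2) ^ Suc k)) (s (Suc k))"
      using b(1)[of k] s(1)[of "Suc k"] h
      by (simp only: sc_add sc_mem D_mem K_of_real sc_sc half) simp
    finally show ?case .
  qed
  have "limitin mtopology \<sigma> x sequentially"
    unfolding mtopology_eq G.limitin_lc_top
  proof (intro conjI ballI allI impI)
    fix p and e :: real assume p: "p \<in> {gauge}" and e: "e > 0"
    obtain k where k: "(1/2 :: real) ^ k < e / 2"
      using real_arch_pow_inv[of "e / 2" "1/2"] e by auto
    have "gauge (\<sigma> n - x) < e" if n: "n \<ge> m k" for n
    proof -
      have "gauge (\<sigma> n - x) \<le> gauge (\<sigma> n - \<sigma> (m k)) + gauge (\<sigma> (m k) - x)"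
        using \<sigma> x by (intro G.seminorm_triangle[OF gauge_seminorm]) auto
      also have "gauge (\<sigma> (m k) - x) = gauge (x - \<sigma> (m k))"
        using \<sigma> x by (intro G.seminorm_commute[OF gauge_seminorm]) auto
      also have "\<dots> \<le> (1/2) ^ k"
        unfolding eq using s(1) by (intro gauge_le radii_scaled) auto
      also have "gauge (\<sigma> n - \<sigma> (m k)) < (1/2) ^ Suc k"
        using mN[of k] n by (intro N) auto
      finally have "gauge (\<sigma> n - x) < (1/2) * (1/2) ^ k + (1/2) ^ k" by simp
      moreover have "(0::real) \<le> (1/2) ^ k" by simp
      ultimately show ?thesis using k by linarith
    qed
    then show "\<forall>\<^sub>F n in sequentially. p (\<sigma> n - x) < e"
      using p by (auto simp: eventually_sequentially)
  qed (use x \<sigma> in auto)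
  then show "\<exists>x. limitin mtopology \<sigma> x sequentially" ..
qed

lemma dspan_not_meagre: "\<not> meagre (lc_top dspan {gauge}) dspan"
  using not_meagre_mspace[OF mcomplete] G.zero_mem unfolding mtopology_eq by blast

lemma interior_ball:
  assumes "lc_top dspan {gauge} interior_of S \<noteq> {}"
  obtains x r where "x \<in> S" "x \<in> dspan" "r > 0" "\<And>y. y \<in> dspan \<Longrightarrow> gauge (y - x) < r \<Longrightarrow> y \<in> S"
proof -
  obtain x U where x: "x \<in> U" "U \<subseteq> S" and U: "openin mtopology U"
    using assms unfolding interior_of_def mtopology_eq by blast
  then obtain r where r: "r > 0" "mball x r \<subseteq> U" unfolding openin_mtopology by blast
  moreover have "x \<in> dspan" using x U openin_subset by fastforce
  ultimately show thesis using x by (intro that[of x r]) (auto simp: mball_eq)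
qed

text \<open>Baire's theorem: the dilates \<open>Z n\<close> of a barrel are closed and cover the
  complete space \<open>dspan\<close>, so one of them contains a ball. Half the difference of
  \<open>x + z\<close> and \<open>x - z\<close> moves its centre to \<open>0\<close>, and undoing
  the dilation divides the radius by \<open>Suc n\<close>.\<close>

lemma barrelled: "barrelled K sc dspan {gauge}"
  unfolding barrelled_def
proof (intro allI impI)
  fix W assume "barrel K sc dspan {gauge} W"
  then have sub: "W \<subseteq> dspan" and acx: "abs_convex K sc W" and closed: "closedin (lc_top dspan {gauge}) W"
    and absorb: "\<And>x. x \<in> dspan \<Longrightarrow> \<exists>r>0. \<forall>a\<in>K. cmod a \<le> r \<longrightarrow> sc a x \<in> W"
    unfolding barrel_def by auto
  define t where "t n = complex_of_real (1 / real (Suc n))" for n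
  have t: "t n \<in> K" "t n \<noteq> 0" "cmod (t n) = 1 / real (Suc n)" "cmod (t n) \<le> 1" for n
    unfolding t_def by (simp_all only: K_of_real norm_of_real) (auto simp del: of_nat_Suc)
  define Z where "Z n = {x\<in>dspan. sc (t n) x \<in> W}" for n
  have closedZ: "closedin (lc_top dspan {gauge}) (Z n)" for n
    unfolding closedin_def topspace_lc_top mtopology_eq[symmetric] topspace_mtopology openin_mtopology
  proof (intro conjI allI impI)
    fix x assume "x \<in> dspan - Z n"
    then have x: "x \<in> dspan" "sc (t n) x \<in> dspan - W" using t unfolding Z_def by auto
    moreover have "openin mtopology (dspan - W)"
      using closed unfolding closedin_def mtopology_eq by simp
    ultimately obtain r where r: "r > 0" "mball (sc (t n) x) r \<subseteq> dspan - W"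
      unfolding openin_mtopology by blast
    have "mball x r \<subseteq> dspan - Z n"
    proof
      fix y assume "y \<in> mball x r"
      then have y: "y \<in> dspan" "gauge (y - x) < r" using x by (auto simp: mball_eq)
      have "gauge (sc (t n) y - sc (t n) x) = cmod (t n) * gauge (y - x)"
        using G.seminorm_sc[OF gauge_seminorm t(1), of "y - x" n] x y t(1) by (simp add: G.sc_diff)
      also have "\<dots> \<le> 1 * gauge (y - x)"
        using t x y G.seminorm_nonneg[OF gauge_seminorm] by (intro mult_right_mono) auto
      finally have "sc (t n) y \<in> mball (sc (t n) x) r"
        using x y t by (subst mball_eq) auto
      with r y show "y \<in> dspan - Z n" unfolding Z_def by auto
    qed
    with r show "\<exists>r>0. mball x r \<subseteq> dspan - Z n" by blast
  qed (auto simp: Z_def)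
  have "dspan = (\<Union>n. Z n)"
  proof (intro antisym subsetI)
    fix x assume x: "x \<in> dspan"
    from absorb[OF x] obtain r where r: "r > 0" "\<And>a. a \<in> K \<Longrightarrow> cmod a \<le> r \<Longrightarrow> sc a x \<in> W" by blast
    obtain n where n: "1 / real (Suc n) < r"
      using nat_approx_posE[OF r(1)] by blast
    have "sc (t n) x \<in> W" using r t n by (intro r(2)) (auto simp del: of_nat_Suc)
    with x show "x \<in> (\<Union>n. Z n)" unfolding Z_def by blast
  qed (auto simp: Z_def)
  then obtain n where "\<not> meagre (lc_top dspan {gauge}) (Z n)"
    using meagre_UN[of "lc_top dspan {gauge}" Z] dspan_not_meagre by auto
  then have "lc_top dspan {gauge} interior_of (Z n) \<noteq> {}"
    using not_meagreD[of "lc_top dspan {gauge}" "Z n"] closure_of_closedin[OF closedZ]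
    by (auto simp: Z_def)
  then obtain x r where x: "x \<in> dspan" "r > 0" "\<And>y. y \<in> dspan \<Longrightarrow> gauge (y - x) < r \<Longrightarrow> y \<in> Z n"
    by (rule interior_ball) blast
  have ball: "sc (t n) z \<in> W" if z: "z \<in> dspan" "gauge z < r" for z
  proof -
    have "sc (t n) (x + z) \<in> W" "sc (t n) (x - z) \<in> W"
      using x z G.seminorm_minus[OF gauge_seminorm z(1)] x(3)[of "x + z"] x(3)[of "x - z"]
      by (auto simp: Z_def)
    then have "sc (1/2) (sc (t n) (x + z)) + sc (- 1/2) (sc (t n) (x - z)) \<in> W"
      using acx unfolding abs_convex_def by (auto simp: norm_divide)
    also have "sc (1/2) (sc (t n) (x + z)) + sc (- 1/2) (sc (t n) (x - z)) = sc (t n) z"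
    proof -
      define w where "w = sc (t n) z" 
      define v where "v = sc (t n) x" 
      have w: "w \<in> dspan" "v \<in> dspan" using t z x by (auto simp: w_def v_def)
      have "sc (1/2) (v + w) + sc (- (1/2)) (v - w) = sc (1/2) w + sc (1/2) w"
        using w by (simp add: G.sc_add G.minus_sc G.sc_diff)
      also have "\<dots> = w" using w G.add_sc[of "1/2" "1/2" w] by simp
      finally show ?thesis using x z t by (simp add: G.sc_add G.sc_diff w_def v_def)
    qed
    finally show ?thesis .
  qed
  have "y \<in> W" if y: "y \<in> dspan" "gauge y < r / real (Suc n)" for y
  proof -
    have "gauge (sc (complex_of_real (real (Suc n))) y) = real (Suc n) * gauge y"
      using G.seminorm_sc[OF gauge_seminorm K_of_real y(1), of "real (Suc n)"] by (simp del: of_nat_Suc)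
    also have "\<dots> < r" using y(2) by (simp add: field_simps del: of_nat_Suc)
    finally have "sc (t n) (sc (complex_of_real (real (Suc n))) y) \<in> W"
      using y(1) by (intro ball) (simp_all only: G.sc_mem K_of_real)
    moreover have inv: "t n * complex_of_real (real (Suc n)) = 1"
      unfolding t_def by (simp flip: of_real_mult del: of_nat_Suc)
    have "sc (t n) (sc (complex_of_real (real (Suc n))) y) = y"
      unfolding G.sc_sc[OF t(1)[of n] K_of_real y(1)] inv using y(1) by simp
    ultimately show ?thesis by (simp only:)
  qed
  then show "zero_nbhd dspan {gauge} W"
    unfolding G.zero_nbhd_iff using sub x(2)
    by (intro conjI exI[of _ "{gauge}"] exI[of _ "r / real (Suc n)"]) (auto simp del: of_nat_Suc)
qed

end

section \<open>Approximation of functionals\<close>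

context kvs
begin

lemma abs_convex_comb:
  "abs_convex K sc C \<Longrightarrow> x \<in> C \<Longrightarrow> y \<in> C \<Longrightarrow> a \<in> K \<Longrightarrow> b \<in> K \<Longrightarrow> cmod a + cmod b \<le> 1 \<Longrightarrow> sc a x + sc b y \<in> C"
  unfolding abs_convex_def by blast

lemma abs_convex_scale:
  "abs_convex K sc C \<Longrightarrow> C \<subseteq> V \<Longrightarrow> x \<in> C \<Longrightarrow> a \<in> K \<Longrightarrow> cmod a \<le> 1 \<Longrightarrow> sc a x \<in> C"
  using abs_convex_comb[of C x x a 0] by (auto simp: subset_iff)

text \<open>A functional that is small on the part of \<open>C\<close> where \<open>g\<close> vanishes becomes small on all of \<open>C\<close>
  after subtracting a multiple of \<open>g\<close>: any two of the intervals of admissible coefficients meet.\<close>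

lemma real_functional_correction:
  fixes f g :: "'v \<Rightarrow> real"
  assumes CV: "C \<subseteq> V" and C: "\<And>x y a b. x \<in> C \<Longrightarrow> y \<in> C \<Longrightarrow> \<bar>a\<bar> + \<bar>b\<bar> \<le> 1 \<Longrightarrow>
      sc (complex_of_real a) x + sc (complex_of_real b) y \<in> C"
    and f: "\<And>x y a b. x \<in> C \<Longrightarrow> y \<in> C \<Longrightarrow> f (sc (complex_of_real a) x + sc (complex_of_real b) y) = a * f x + b * f y"
    and g: "\<And>x y a b. x \<in> C \<Longrightarrow> y \<in> C \<Longrightarrow> g (sc (complex_of_real a) x + sc (complex_of_real b) y) = a * g x + b * g y"
    and bound: "\<And>x. x \<in> C \<Longrightarrow> g x = 0 \<Longrightarrow> \<bar>f x\<bar> \<le> \<epsilon>"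
  shows "\<exists>c. \<forall>x\<in>C. \<bar>f x - c * g x\<bar> \<le> \<epsilon>"
proof (cases "\<forall>x\<in>C. g x = 0")
  case True
  then show ?thesis using bound by (intro exI[of _ 0]) auto
next
  case False
  have neg: "\<exists>y\<in>C. f y = - f x \<and> g y = - g x" if "x \<in> C" for x
    using C[of x x "- 1" 0] f[of x x "- 1" 0] g[of x x "- 1" 0] that by auto
  \<comment> \<open>\<open>A\<close> collects the left endpoints of the admissible intervals for
    \<open>c\<close> at points with \<open>g x > 0\<close>; \<open>neg\<close> reflects points with
    \<open>g x < 0\<close> onto these.\<close>
  define A where "A = {(f x - \<epsilon>) / g x | x. x \<in> C \<and> g x > 0}"
  have sep: "(f x - \<epsilon>) / g x \<le> (f y + \<epsilon>) / g y" if x: "x \<in> C" "g x > 0" and y: "y \<in> C" "g y > 0" for x y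
  proof -
    define s where "s = g x + g y"
    have s: "s > 0" using x y by (simp add: s_def)
    \<comment> \<open>The coefficients cancel \<open>g\<close> and their moduli sum to
      \<open>1\<close>, so \<open>z\<close> stays in \<open>C\<close> and the bound on the kernel of
      \<open>g\<close> applies.\<close>
    define z where "z = sc (complex_of_real (g y / s)) x + sc (complex_of_real (- (g x / s))) y"
    have "\<bar>g y / s\<bar> + \<bar>- (g x / s)\<bar> = (g y + g x) / s"
      using x y s by (simp add: add_divide_distrib)
    then have "z \<in> C" unfolding z_def using x y s by (intro C) (auto simp: s_def)
    moreover have "g z = 0" "f z = (g y * f x - g x * f y) / s"
      unfolding z_def f[OF x(1) y(1)] g[OF x(1) y(1)] by (simp_all add: diff_divide_distrib)
    ultimately have "\<bar>(g y * f x - g x * f y) / s\<bar> \<le> \<epsilon>" using bound[of z] by simp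
    then have "(g y * f x - g x * f y) / s \<le> \<epsilon>" by linarith
    then have "g y * f x - g x * f y \<le> \<epsilon> * (g x + g y)" using s by (simp add: s_def field_simps)
    then show ?thesis using x y by (simp add: field_simps)
  qed
  obtain x0 where x0: "x0 \<in> C" "g x0 > 0"
    using False neg by (metis linorder_neqE_linordered_idom neg_0_less_iff_less)
  have bdd: "bdd_above A"
    unfolding A_def by (rule bdd_aboveI[of _ "(f x0 + \<epsilon>) / g x0"]) (use sep x0 in auto)
  have ne: "A \<noteq> {}" unfolding A_def using x0 by auto
  define c where "c = Sup A"
  have pos: "\<bar>f x - c * g x\<bar> \<le> \<epsilon>" if x: "x \<in> C" "g x > 0" for x
  proof -
    have "(f x - \<epsilon>) / g x \<le> c"
      unfolding c_def by (rule cSup_upper[OF _ bdd]) (use x in \<open>auto simp: A_def\<close>)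
    moreover have "c \<le> (f x + \<epsilon>) / g x"
      unfolding c_def by (rule cSup_least[OF ne]) (use sep x in \<open>auto simp: A_def\<close>)
    ultimately show ?thesis using x by (simp add: field_simps abs_le_iff)
  qed
  have "\<bar>f x - c * g x\<bar> \<le> \<epsilon>" if x: "x \<in> C" for x
  proof (cases "g x" "0::real" rule: linorder_cases)
    case less
    obtain y where y: "y \<in> C" "f y = - f x" "g y = - g x" using neg[OF x] by blast
    have "\<bar>f y - c * g y\<bar> \<le> \<epsilon>" using y less by (intro pos) auto
    then show ?thesis using y by (simp add: abs_minus_commute)
  qed (use bound pos x in auto)
  then show ?thesis by blast
qed

text \<open>\<open>C\<close> is invariant under scalars of modulus \<open>1\<close>, so a bound on
  real parts over all of \<open>C\<close> is a bound on moduli.\<close>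

lemma unimodular_rotation:
  assumes KC: "K = UNIV" and lin: "lin_map K sc V (*) K h" and CV: "C \<subseteq> V" and acx: "abs_convex K sc C"
    and re: "\<And>x. x \<in> C \<Longrightarrow> \<bar>Re (h x)\<bar> \<le> \<epsilon>" and x: "x \<in> C"
  shows "cmod (h x) \<le> \<epsilon>"
proof (cases "h x = 0")
  case True
  then show ?thesis using re[OF x] by simp
next
  case False
  define a where "a = cnj (h x) / cmod (h x)"
  have a1: "cmod a = 1" using False by (simp add: a_def norm_divide)
  have ah: "a * h x = cmod (h x)"
    using False complex_norm_square[of "h x"] by (simp add: a_def field_simps power2_eq_square)
  have "h (sc a x) = a * h x" using lin x CV KC unfolding lin_map_def by auto
  moreover have "sc a x \<in> C" using abs_convex_scale[OF acx CV x] a1 KC by simp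
  ultimately have "\<bar>Re (complex_of_real (cmod (h x)))\<bar> \<le> \<epsilon>" using re[of "sc a x"] ah by simp
  then show ?thesis by simp
qed

lemma lin_map_comb:
  assumes "lin_map K sc V (*) K f" "lin_map K sc V (*) K g" "c \<in> K"
  shows "lin_map K sc V (*) K (\<lambda>x. f x - c * g x)"
  using assms unfolding lin_map_def by (auto simp: algebra_simps)

text \<open>The real lemma is used twice without increasing \<epsilon>: on the part of
  \<open>C\<close> where \<open>Re (g x) = 0\<close> it removes \<open>Im (g x)\<close>, and on all
  of \<open>C\<close> it then removes \<open>Re (g x)\<close>.\<close>

lemma functional_correction:
  assumes CV: "C \<subseteq> V" and acx: "abs_convex K sc C"
    and f: "lin_map K sc V (*) K f" and g: "lin_map K sc V (*) K g"
    and bound: "\<And>x. x \<in> C \<Longrightarrow> g x = 0 \<Longrightarrow> cmod (f x) \<le> \<epsilon>"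
  shows "\<exists>c\<in>K. \<forall>x\<in>C. cmod (f x - c * g x) \<le> \<epsilon>"
proof -
  have comb: "h (sc (complex_of_real a) x + sc (complex_of_real b) y) = complex_of_real a * h x + complex_of_real b * h y"
    if "lin_map K sc V (*) K h" "x \<in> V" "y \<in> V" for h a b x y
    using that unfolding lin_map_def by auto
  have Ccomb: "sc (complex_of_real a) x + sc (complex_of_real b) y \<in> C"
    if "x \<in> C" "y \<in> C" "\<bar>a\<bar> + \<bar>b\<bar> \<le> 1" for x y a b
    using that by (intro abs_convex_comb[OF acx]) auto
  define C1 where "C1 = {x\<in>C. Re (g x) = 0}"
  have "\<exists>b. \<forall>x\<in>C1. \<bar>Re (f x) - b * Im (g x)\<bar> \<le> \<epsilon>"
  proof (rule real_functional_correction)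
    show "\<bar>Re (f x)\<bar> \<le> \<epsilon>" if "x \<in> C1" "Im (g x) = 0" for x
      using bound[of x] that abs_Re_le_cmod[of "f x"] by (auto simp: C1_def complex_eq_iff)
    show "sc (complex_of_real a) x + sc (complex_of_real b) y \<in> C1"
      if "x \<in> C1" "y \<in> C1" "\<bar>a\<bar> + \<bar>b\<bar> \<le> 1" for x y a b
      using Ccomb[of x y a b] that comb[OF g, of x y a b] CV by (auto simp: C1_def subset_iff)
  qed (use CV comb[OF f] comb[OF g] in \<open>auto simp: C1_def subset_iff\<close>)
  then obtain b where b: "\<And>x. x \<in> C1 \<Longrightarrow> \<bar>Re (f x) - b * Im (g x)\<bar> \<le> \<epsilon>" by blast
  have "\<exists>a. \<forall>x\<in>C. \<bar>(Re (f x) - b * Im (g x)) - a * Re (g x)\<bar> \<le> \<epsilon>"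
  proof (rule real_functional_correction)
    show "\<bar>Re (f x) - b * Im (g x)\<bar> \<le> \<epsilon>" if "x \<in> C" "Re (g x) = 0" for x
      using b[of x] that by (auto simp: C1_def)
  qed (use CV Ccomb comb[OF f] comb[OF g] in \<open>auto simp: subset_iff algebra_simps\<close>)
  then obtain a where a: "\<And>x. x \<in> C \<Longrightarrow> \<bar>(Re (f x) - b * Im (g x)) - a * Re (g x)\<bar> \<le> \<epsilon>" by blast
  show ?thesis
  proof (cases "K = UNIV")
    case True
    \<comment> \<open>The sign is dictated by
      \<open>Re (c * g x) = a * Re (g x) + b * Im (g x)\<close>.\<close>
    define c where "c = Complex a (- b)"
    have "\<bar>Re (f x - c * g x)\<bar> \<le> \<epsilon>" if "x \<in> C" for x
      using a[OF that] by (simp add: c_def algebra_simps)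
    with True show ?thesis
      using unimodular_rotation[OF True lin_map_comb[OF f g, of c] CV acx, of \<epsilon>] by (intro bexI[of _ c]) auto
  next
    case False
    then have KR: "K = \<real>" using K by auto
    have real: "f x \<in> \<real>" "g x \<in> \<real>" if "x \<in> C" for x
      using f g that CV unfolding lin_map_def KR by auto
    have "cmod (f x - complex_of_real a * g x) \<le> \<epsilon>" if x: "x \<in> C" for x
    proof -
      obtain r s where "f x = complex_of_real r" "g x = complex_of_real s"
        using real[OF x] by (auto elim!: Reals_cases)
      then show ?thesis using a[OF x] by (simp flip: of_real_mult of_real_diff)
    qed
    then show ?thesis by (intro bexI[of _ "complex_of_real a"]) auto
  qed
qed

text \<open>A quantitative form of the fact that a functional vanishing on the common kernel of
  finitely many others is a combination of them. The induction hypothesis is applied on the part of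
  \<open>C\<close> where \<open>g j\<close> vanishes, and \<open>functional_correction\<close>
  returns to all of \<open>C\<close> with the same \<epsilon>.\<close>

lemma functional_approximation:
  assumes "finite I" and CV: "C \<subseteq> V" and acx: "abs_convex K sc C"
    and f: "lin_map K sc V (*) K f" and g: "\<And>i. i \<in> I \<Longrightarrow> lin_map K sc V (*) K (g i)"
    and bound: "\<And>x. x \<in> C \<Longrightarrow> (\<forall>i\<in>I. g i x = 0) \<Longrightarrow> cmod (f x) \<le> \<epsilon>"
  shows "\<exists>c. (\<forall>i. c i \<in> K) \<and> (\<forall>x\<in>C. cmod (f x - (\<Sum>i\<in>I. c i * g i x)) \<le> \<epsilon>)"
  using assms
proof (induction I arbitrary: C f rule: finite_induct)
  case empty
  then show ?case by (intro exI[of _ "\<lambda>_. 0"]) auto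
next
  case (insert j I)
  define C' where "C' = {x\<in>C. g j x = 0}"
  have gj: "lin_map K sc V (*) K (g j)" using insert.prems by blast
  have "\<exists>c. (\<forall>i. c i \<in> K) \<and> (\<forall>x\<in>C'. cmod (f x - (\<Sum>i\<in>I. c i * g i x)) \<le> \<epsilon>)"
  proof (rule insert.IH)
    show "abs_convex K sc C'"
      using insert.prems(1,2) gj unfolding abs_convex_def lin_map_def C'_def by (auto simp: subset_iff)
  qed (use insert.prems in \<open>auto simp: C'_def\<close>)
  then obtain c where c: "\<And>i. c i \<in> K" "\<And>x. x \<in> C' \<Longrightarrow> cmod (f x - (\<Sum>i\<in>I. c i * g i x)) \<le> \<epsilon>"
    by blast
  have "lin_map K sc V (*) K (\<lambda>x. f x - (\<Sum>i\<in>J. c i * g i x))" if "finite J" "J \<subseteq> I" for J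
    using that
  proof (induction J rule: finite_induct)
    case (insert i J)
    then have "lin_map K sc V (*) K (\<lambda>x. (f x - (\<Sum>i\<in>J. c i * g i x)) - c i * g i x)"
      using insert.prems \<open>\<And>i. i \<in> Set.insert j I \<Longrightarrow> lin_map K sc V (*) K (g i)\<close> c
      by (intro lin_map_comb) auto
    then show ?case using insert.hyps by (simp add: algebra_simps)
  qed (use insert.prems in simp)
  from this[OF insert.hyps(1)] have "lin_map K sc V (*) K (\<lambda>x. f x - (\<Sum>i\<in>I. c i * g i x))" by simp
  from functional_correction[OF insert.prems(1,2) this gj, of \<epsilon>] c(2)
  obtain d where d: "d \<in> K" "\<And>x. x \<in> C \<Longrightarrow> cmod ((f x - (\<Sum>i\<in>I. c i * g i x)) - d * g j x) \<le> \<epsilon>"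
    unfolding C'_def by auto
  have "(\<Sum>i\<in>I. (c(j := d)) i * g i x) = (\<Sum>i\<in>I. c i * g i x)" for x
    using insert.hyps by (intro sum.cong) auto
  then have eq: "f x - (\<Sum>i\<in>Set.insert j I. (c(j := d)) i * g i x)
      = (f x - (\<Sum>i\<in>I. c i * g i x)) - d * g j x" for x
    using insert.hyps by simp
  show ?case
  proof (intro exI[of _ "c(j := d)"] conjI allI ballI)
    show "(c(j := d)) i \<in> K" for i using c(1) d(1) by simp
    show "cmod (f x - (\<Sum>i\<in>Set.insert j I. (c(j := d)) i * g i x)) \<le> \<epsilon>" if "x \<in> C" for x
      unfolding eq by (rule d(2)[OF that])
  qed
qed

end

section \<open>Bounded Banach discs in infra-(s) and B_r-complete spaces\<close>

lemma (in lcs) Dual_sum: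
  "finite I \<Longrightarrow> \<phi> \<in> Dual \<Longrightarrow> (\<And>i. i \<in> I \<Longrightarrow> f i \<in> V) \<Longrightarrow> \<phi> (\<Sum>i\<in>I. f i) = (\<Sum>i\<in>I. \<phi> (f i))"
  by (induction I rule: finite_induct) (auto simp: Dual_zero Dual_add)

lemma (in lcs) lin_map_eval: "x \<in> V \<Longrightarrow> lin_map K fsc Dual (*) K (\<lambda>\<phi>. \<phi> x)"
  unfolding lin_map_def by (auto simp: Dual_mem_K fsc_def)

text \<open>This is weak* density of a separating subspace in its concrete form. Either some member
  of \<open>Q\<close> vanishes on the old points but not at \<open>x\<close> and corrects the value
  there, or \<open>x\<close> turns out to be a linear combination of the old points and the value at
  \<open>x\<close> is already right.\<close>

lemma (in lcs) Dual_interpolation: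
  assumes Q: "Q \<subseteq> Dual" "subspace_of K fsc Q"
    and sep: "\<And>x. x \<in> V \<Longrightarrow> (\<forall>\<psi>\<in>Q. \<psi> x = 0) \<Longrightarrow> x = 0"
    and \<phi>: "\<phi> \<in> Dual" and X: "finite X" "X \<subseteq> V"
  shows "\<exists>\<psi>\<in>Q. \<forall>x\<in>X. \<psi> x = \<phi> x"
  using X
proof (induction X rule: finite_induct)
  case empty
  then show ?case using Q unfolding subspace_of_def by auto
next
  case (insert x X)
  interpret DV: kvs K fsc Dual by (rule kvs_Dual)
  have x: "x \<in> V" and X: "X \<subseteq> V" using insert.prems by auto
  from insert.IH[OF X] obtain \<eta> where \<eta>: "\<eta> \<in> Q" "\<And>y. y \<in> X \<Longrightarrow> \<eta> y = \<phi> y" by blast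
  show ?case
  proof (cases "\<exists>\<theta>\<in>Q. (\<forall>y\<in>X. \<theta> y = 0) \<and> \<theta> x \<noteq> 0")
    case True
    then obtain \<theta> where \<theta>: "\<theta> \<in> Q" "\<And>y. y \<in> X \<Longrightarrow> \<theta> y = 0" "\<theta> x \<noteq> 0" by blast
    define a where "a = (\<phi> x - \<eta> x) / \<theta> x"
    have "a \<in> K"
      unfolding a_def using \<phi> \<eta> \<theta> Q x by (auto simp: Dual_mem_K subset_iff)
    then have "\<eta> + fsc a \<theta> \<in> Q"
      using \<eta> \<theta> Q(2) unfolding subspace_of_def by blast
    moreover have "(\<eta> + fsc a \<theta>) y = \<phi> y" if "y \<in> Set.insert x X" for y
      using that \<theta> \<eta> by (auto simp: fsc_def a_def)
    ultimately show ?thesis by blast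
  next
    case False
    \<comment> \<open>The approximation lemma is used in the dual, with evaluations as functionals,
      \<open>Q\<close> as the disc and \<epsilon> = \<open>0\<close>, so the representation of
      \<open>x\<close> on \<open>Q\<close> is exact.\<close>
    have "\<exists>c. (\<forall>y. c y \<in> K) \<and> (\<forall>\<psi>\<in>Q. cmod (\<psi> x - (\<Sum>y\<in>X. c y * \<psi> y)) \<le> 0)"
    proof (rule DV.functional_approximation)
      show "abs_convex K fsc Q"
        using Q(2) unfolding abs_convex_def subspace_of_def by blast
    qed (use insert.hyps Q False lin_map_eval x X in auto)
    then obtain c where c: "\<And>y. c y \<in> K" "\<And>\<psi>. \<psi> \<in> Q \<Longrightarrow> \<psi> x = (\<Sum>y\<in>X. c y * \<psi> y)"
      by auto
    define z where "z = (\<Sum>y\<in>X. sc (c y) y)"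
    have zV: "z \<in> V" unfolding z_def using X c(1) by (auto intro!: sum_mem)
    have eval: "\<psi> z = (\<Sum>y\<in>X. c y * \<psi> y)" if "\<psi> \<in> Dual" for \<psi>
      unfolding z_def using that X c(1) insert.hyps
      by (subst Dual_sum) (auto simp: Dual_sc subset_iff intro!: sum.cong)
    have "x - z = 0"
      using x zV c(2) eval Q(1) by (intro sep) (auto simp: Dual_diff subset_iff)
    then have "\<phi> x = \<eta> x"
      using eval[OF \<phi>] eval[of \<eta>] \<eta> Q(1) by (auto simp: subset_iff)
    with \<eta> show ?thesis by auto
  qed
qed

text \<open>\<Psi> is the only link assumed between the gauge and the seminorms in \<open>P\<close>:
  its members are bounded on \<open>D\<close>, each with its own constant, while nothing is assumed
  about other functionals.\<close>

locale separated_disc = lcs K sc V P + banach_disc K sc V D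
  for K :: "complex set" and sc :: "complex \<Rightarrow> 'v::ab_group_add \<Rightarrow> 'v" and V P D +
  fixes \<Psi> :: "('v \<Rightarrow> complex) set"
  assumes Psi_Dual: "\<Psi> \<subseteq> Dual" and Psi_separating: "x \<in> V \<Longrightarrow> (\<And>\<psi>. \<psi> \<in> \<Psi> \<Longrightarrow> \<psi> x = 0) \<Longrightarrow> x = 0"
    and Psi_bounded: "\<psi> \<in> \<Psi> \<Longrightarrow> \<exists>c. \<forall>d\<in>D. cmod (\<psi> d) \<le> c"
begin

lemma restrict_Dual:
  assumes "\<phi> \<in> Dual" and c: "\<And>d. d \<in> D \<Longrightarrow> cmod (\<phi> d) \<le> c"
  shows "(\<lambda>x. if x \<in> dspan then \<phi> x else 0) \<in> lc_dual K sc dspan {gauge}"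
proof (rule G.mem_DualI[where F="{gauge}" and C=c])
  show "lin_map K sc dspan (*) K (\<lambda>x. if x \<in> dspan then \<phi> x else 0)"
    using assms(1) dspan_sub unfolding lin_map_def by (auto simp: Dual_mem_K Dual_add Dual_sc subset_iff)
  show "c \<ge> 0" using c[OF D_zero] norm_ge_zero order_trans by blast
  fix x assume x: "x \<in> dspan"
  have "cmod (\<phi> x) \<le> c * gauge x"
    using assms by (intro gauge_bound[OF x]) (auto simp: Dual_sc norm_mult)
  with x show "cmod (if x \<in> dspan then \<phi> x else 0) \<le> c * (\<Sum>p\<in>{gauge}. p x)" by simp
qed auto

lemma continuous_on_dspan:
  assumes "\<phi> \<in> Dual" and "\<And>d. d \<in> D \<Longrightarrow> cmod (\<phi> d) \<le> c"
  shows "continuous_map (lc_top dspan {gauge}) euclidean \<phi>"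
  by (rule continuous_map_eq[OF G.Dual_cont[OF restrict_Dual[OF assms]]]) simp_all

text \<open>Elements of \<open>D\<close> may have gauge \<open>1\<close> and the ball is open, so
  \<open>d\<close> is shrunk by \<open>e / 2\<close>; this is where the factor \<open>2\<close>
  comes from.\<close>

lemma ball_bound:
  fixes h :: "'v \<Rightarrow> real"
  assumes hom: "\<And>r x. r > 0 \<Longrightarrow> x \<in> V \<Longrightarrow> h (sc (complex_of_real r) x) = r * h x"
    and e: "e > 0" and le: "\<And>x. x \<in> dspan \<Longrightarrow> gauge x < e \<Longrightarrow> h x \<le> c" and d: "d \<in> D"
  shows "h d \<le> 2 * c / e"
proof -
  have "gauge (sc (complex_of_real (e / 2)) d) \<le> e / 2"
    using e d by (intro gauge_le radii_scaled) auto
  then have "h (sc (complex_of_real (e / 2)) d) \<le> c"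
    using e d D_dspan by (intro le G.sc_mem K_of_real) auto
  then show ?thesis using hom[of "e / 2" d] e d by (simp add: field_simps)
qed

text \<open>The Banach-Steinhaus theorem: the set where all of \<open>S\<close> is at most
  \<open>1\<close> is a barrel in \<open>dspan\<close>. Boundedness of each single \<phi> on
  \<open>D\<close> makes it closed, pointwise boundedness makes it absorbing.\<close>

lemma equicontinuous:
  assumes S: "S \<subseteq> Dual" and bdd: "\<And>\<phi>. \<phi> \<in> S \<Longrightarrow> \<exists>c. \<forall>d\<in>D. cmod (\<phi> d) \<le> c"
    and pointwise: "\<And>x. x \<in> V \<Longrightarrow> \<exists>c. \<forall>\<phi>\<in>S. cmod (\<phi> x) \<le> c"
  shows "\<exists>e>0. \<forall>x\<in>dspan. gauge x < e \<longrightarrow> (\<forall>\<phi>\<in>S. cmod (\<phi> x) \<le> 1)"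
proof -
  define W where "W = {x\<in>dspan. \<forall>\<phi>\<in>S. cmod (\<phi> x) \<le> 1}"
  define A where "A \<phi> = {x \<in> topspace (lc_top dspan {gauge}). \<phi> x \<in> cball 0 1}" for \<phi> :: "'v \<Rightarrow> complex"
  have closedA: "closedin (lc_top dspan {gauge}) (A \<phi>)" if "\<phi> \<in> S" for \<phi>
    unfolding A_def using continuous_on_dspan[of \<phi>] bdd[OF that] S that
    by (intro closedin_continuous_map_preimage) auto
  have "barrel K sc dspan {gauge} W"
    unfolding barrel_def
  proof (intro conjI ballI)
    show "W \<subseteq> dspan" unfolding W_def by blast
    have W_eq: "W = \<Inter>(insert dspan (A ` S))" unfolding W_def A_def by auto
    show "closedin (lc_top dspan {gauge}) W"
      unfolding W_eq using closedA closedin_topspace[of "lc_top dspan {gauge}"]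
      by (intro closedin_Inter) auto
    show "abs_convex K sc W"
      unfolding abs_convex_def
    proof (intro ballI impI)
      fix x y a b assume *: "x \<in> W" "y \<in> W" "a \<in> K" "b \<in> K" "cmod a + cmod b \<le> 1"
      then have mem: "x \<in> dspan" "y \<in> dspan" "x \<in> V" "y \<in> V" using dspan_sub by (auto simp: W_def)
      have "cmod (\<phi> (sc a x + sc b y)) \<le> 1" if \<phi>: "\<phi> \<in> S" for \<phi>
      proof -
        have "cmod (\<phi> (sc a x + sc b y)) \<le> cmod a * cmod (\<phi> x) + cmod b * cmod (\<phi> y)"
          using \<phi> S * mem norm_triangle_ineq[of "a * \<phi> x" "b * \<phi> y"]
          by (auto simp: Dual_add Dual_sc norm_mult subset_iff)
        also have "\<dots> \<le> cmod a * 1 + cmod b * 1"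
          using \<phi> * by (intro add_mono mult_left_mono) (auto simp: W_def)
        finally show ?thesis using * by simp
      qed
      then show "sc a x + sc b y \<in> W" using * mem by (auto simp: W_def)
    qed
    fix x assume x: "x \<in> dspan"
    then obtain c where c: "\<And>\<phi>. \<phi> \<in> S \<Longrightarrow> cmod (\<phi> x) \<le> c" using pointwise dspan_sub by blast
    show "\<exists>r>0. \<forall>a\<in>K. cmod a \<le> r \<longrightarrow> sc a x \<in> W"
    \<comment> \<open>\<open>c\<close> may be \<open>0\<close>, or negative when \<open>S\<close> is
      empty, hence \<open>\<bar>c\<bar> + 1\<close>.\<close>
    proof (intro exI[of _ "1 / (\<bar>c\<bar> + 1)"] conjI ballI impI)
      fix a assume a: "a \<in> K" "cmod a \<le> 1 / (\<bar>c\<bar> + 1)"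
      have "cmod (\<phi> (sc a x)) \<le> 1" if \<phi>: "\<phi> \<in> S" for \<phi>
      proof -
        have "cmod (\<phi> (sc a x)) = cmod a * cmod (\<phi> x)"
          using \<phi> S a x dspan_sub by (auto simp: Dual_sc norm_mult subset_iff)
        also have "\<dots> \<le> 1 / (\<bar>c\<bar> + 1) * (\<bar>c\<bar> + 1)"
          using a c[OF \<phi>] by (intro mult_mono) auto
        also have "\<dots> = 1" by (smt (verit) nonzero_eq_divide_eq)
        finally show ?thesis .
      qed
      then show "sc a x \<in> W" using a x by (auto simp: W_def)
    qed (simp add: add_nonneg_pos)
  qed
  then have "zero_nbhd dspan {gauge} W"
    using barrelled unfolding barrelled_def by blast
  then obtain F e where F: "F \<subseteq> {gauge}" "e > 0" "{y\<in>dspan. \<forall>p\<in>F. p y < e} \<subseteq> W"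
    unfolding G.zero_nbhd_iff by (elim exE conjE)
  then show ?thesis by (intro exI[of _ e]) (auto simp: W_def)
qed

lemma zero_nbhd_absorbs:
  assumes U: "zero_nbhd V P U" and x: "x \<in> V"
  shows "\<exists>r>0. sc (complex_of_real r) x \<in> U"
proof -
  obtain F e where F: "finite F" "F \<subseteq> P" "e > 0" "{y\<in>V. \<forall>p\<in>F. p y < e} \<subseteq> U"
    using U unfolding zero_nbhd_iff by (elim exE conjE)
  define s where "s = 1 + (\<Sum>p\<in>F. p x)"
  have pos: "0 \<le> p x" if "p \<in> F" for p using that F seminorm_nonneg[OF sn x] by blast
  have "0 \<le> (\<Sum>p\<in>F. p x)" by (rule sum_nonneg) (rule pos)
  then have s: "s > 0" by (simp add: s_def)
  have "p (sc (complex_of_real (e / s)) x) < e" if p: "p \<in> F" for p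
  proof -
    have "p x < s" using member_le_sum[of p F "\<lambda>p. p x"] p F pos by (force simp: s_def)
    have "p (sc (complex_of_real (e / s)) x) = e / s * p x"
      using seminorm_sc[OF sn K_of_real x, of p "e / s"] p F s by (auto simp: norm_divide)
    also have "\<dots> < e" using \<open>p x < s\<close> F s by (simp add: field_simps)
    finally show ?thesis .
  qed
  then have "sc (complex_of_real (e / s)) x \<in> U"
    using F(4) sc_mem[OF K_of_real x, of "e / s"] by blast
  with s F show ?thesis by (intro exI[of _ "e / s"]) auto
qed

text \<open>Neighbourhoods of \<open>0\<close> are absorbing; this supplies the pointwise bound that
  \<open>equicontinuous\<close> needs for subsets of a polar.\<close>

lemma polar_pointwise_bounded:
  assumes U: "zero_nbhd V P U" and x: "x \<in> V"
  shows "\<exists>c. \<forall>\<phi>\<in>polar K sc V P U. cmod (\<phi> x) \<le> c"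
proof -
  obtain r where r: "r > 0" "sc (complex_of_real r) x \<in> U" using zero_nbhd_absorbs[OF assms] by blast
  have "cmod (\<phi> x) \<le> 1 / r" if \<phi>: "\<phi> \<in> polar K sc V P U" for \<phi>
  proof -
    have "\<phi> \<in> Dual" "cmod (\<phi> (sc (complex_of_real r) x)) \<le> 1"
      using \<phi> r unfolding polar_def by auto
    then have "r * cmod (\<phi> x) \<le> 1" using Dual_sc[of \<phi> "complex_of_real r" x] x r by (simp add: norm_mult)
    then show ?thesis using r by (simp add: field_simps)
  qed
  then show ?thesis by blast
qed

text \<open>The definition of \<^const>\<open>infra_s\<close> only tests barrelled spaces inside the same type with the same
  scalar multiplication; the inclusion of the span of \<open>D\<close> is such a test map.\<close>

lemma bounded_if_infra_s:
  assumes sp: "infra_s K sc V P" and p: "p \<in> P"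
  shows "\<exists>c. \<forall>d\<in>D. p d \<le> c"
proof -
  have "lcHs K sc dspan {gauge}"
    using kvs.vs[OF kvs_dspan] gauge_seminorm separated unfolding lcHs_def by auto
  moreover have "lin_map K sc dspan sc V (\<lambda>x. x)"
    using dspan_sub unfolding lin_map_def by auto
  moreover have "closedin (prod_topology (lc_top dspan {gauge}) (lc_top V P)) {(x, x) | x. x \<in> dspan}"
    unfolding closedin_def
  proof (intro conjI)
    show "{(x, x) |x. x \<in> dspan} \<subseteq> topspace (prod_topology (lc_top dspan {gauge}) (lc_top V P))"
      using dspan_sub by auto
    show "openin (prod_topology (lc_top dspan {gauge}) (lc_top V P))
      (topspace (prod_topology (lc_top dspan {gauge}) (lc_top V P)) - {(x, x) |x. x \<in> dspan})"
      unfolding openin_prod_topology_alt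
    proof (intro allI impI)
      fix x y assume "(x, y) \<in> topspace (prod_topology (lc_top dspan {gauge}) (lc_top V P)) - {(x, x) |x. x \<in> dspan}"
      then have xy: "x \<in> dspan" "y \<in> V" "x \<noteq> y" by auto
      then have "x - y \<in> V" "x - y \<noteq> 0" using dspan_sub by auto
      \<comment> \<open>A functional in \<Psi> tells \<open>x\<close> from \<open>y\<close> and is
        continuous on both sides, so preimages of disjoint open sets form a box around
        \<open>(x, y)\<close> that misses the graph.\<close>
      with Psi_separating[of "x - y"] obtain \<psi> where \<psi>: "\<psi> \<in> \<Psi>" "\<psi> (x - y) \<noteq> 0" by blast
      then have \<psi>D: "\<psi> \<in> Dual" and "\<psi> x \<noteq> \<psi> y"
        using xy(2) subsetD[OF dspan_sub xy(1)] subsetD[OF Psi_Dual] Dual_diff[of \<psi> x y] by auto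
      from hausdorff[OF this(2)] obtain A B where AB: "open A" "open B" "\<psi> x \<in> A" "\<psi> y \<in> B" "A \<inter> B = {}"
        by blast
      obtain c where "\<And>d. d \<in> D \<Longrightarrow> cmod (\<psi> d) \<le> c" using Psi_bounded[OF \<psi>(1)] by blast
      from openin_continuous_map_preimage[OF continuous_on_dspan[OF \<psi>D this], of A] AB(1)
      have A: "openin (lc_top dspan {gauge}) {x\<in>dspan. \<psi> x \<in> A}" by simp
      from openin_continuous_map_preimage[OF Dual_cont[OF \<psi>D], of B] AB(2)
      have B: "openin (lc_top V P) {x\<in>V. \<psi> x \<in> B}" by simp
      show "\<exists>S T. openin (lc_top dspan {gauge}) S \<and> openin (lc_top V P) T \<and> x \<in> S \<and> y \<in> T \<and>
          S \<times> T \<subseteq> topspace (prod_topology (lc_top dspan {gauge}) (lc_top V P)) - {(x, x) |x. x \<in> dspan}"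
        using A B AB xy
        by (intro exI[of _ "{x\<in>dspan. \<psi> x \<in> A}"] exI[of _ "{x\<in>V. \<psi> x \<in> B}"]) auto
    qed
  qed
  ultimately have "continuous_map (lc_top dspan {gauge}) (lc_top V P) (\<lambda>x. x)"
    using sp barrelled unfolding infra_s_def by blast
  moreover have "openin (lc_top V P) {y\<in>V. \<forall>q\<in>{p}. q (y - 0) < 1}"
    using p by (intro openin_ball) auto
  ultimately have "openin (lc_top dspan {gauge})
      {x \<in> topspace (lc_top dspan {gauge}). x \<in> {y\<in>V. \<forall>q\<in>{p}. q (y - 0) < 1}}"
    by (rule openin_continuous_map_preimage)
  then have "zero_nbhd dspan {gauge} {x\<in>dspan. p x < 1}"
    unfolding zero_nbhd_def using dspan_sub seminorm_zero[OF sn[OF p]]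
    by (intro conjI exI[of _ "{x \<in> topspace (lc_top dspan {gauge}). x \<in> {y\<in>V. \<forall>q\<in>{p}. q (y - 0) < 1}}"]) auto
  then obtain F e where F: "F \<subseteq> {gauge}" "e > 0" "{y\<in>dspan. \<forall>p\<in>F. p y < e} \<subseteq> {x\<in>dspan. p x < 1}"
    unfolding G.zero_nbhd_iff by (elim exE conjE)
  then have "p x \<le> 1" if "x \<in> dspan" "gauge x < e" for x
    using that by fastforce
  from ball_bound[where h=p, OF _ F(2) this] have "p d \<le> 2 * 1 / e" if "d \<in> D" for d
    using that seminorm_sc[OF sn[OF p]] by auto
  then show ?thesis by blast
qed

text \<open>The functionals bounded on \<open>D\<close> form a weak*-dense subspace that is nearly closed, since the span of
  \<open>D\<close> is barrelled; hence every continuous functional is bounded on \<open>D\<close>.\<close>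

lemma bounded_if_Br_complete:
  assumes Br: "Br_complete K sc V P" and p: "p \<in> P"
  shows "\<exists>c. \<forall>d\<in>D. p d \<le> c"
proof -
  define Q where "Q = {\<phi>\<in>Dual. \<exists>c. \<forall>d\<in>D. cmod (\<phi> d) \<le> c}"
  interpret DV: kvs K fsc Dual by (rule kvs_Dual)
  have ws: "seminorm_on K fsc Dual q" if "q \<in> weak_star_sns V" for q
    using that unfolding weak_star_sns_def seminorm_on_def
    by (auto simp: fsc_def norm_mult intro: norm_triangle_ineq)
  interpret W: lcs K fsc Dual "weak_star_sns V"
    by unfold_locales (rule ws)
  have subQ: "Q \<subseteq> Dual" unfolding Q_def by blast
  have subspQ: "subspace_of K fsc Q"
    unfolding subspace_of_def
  proof (intro conjI ballI)
    show "0 \<in> Q" unfolding Q_def using Dual_zero_mem by auto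
    show "\<phi> + \<psi> \<in> Q" if "\<phi> \<in> Q" "\<psi> \<in> Q" for \<phi> \<psi>
    proof -
      obtain a b where "\<And>d. d \<in> D \<Longrightarrow> cmod (\<phi> d) \<le> a" "\<And>d. d \<in> D \<Longrightarrow> cmod (\<psi> d) \<le> b"
        using \<open>\<phi> \<in> Q\<close> \<open>\<psi> \<in> Q\<close> unfolding Q_def by blast
      then have "\<forall>d\<in>D. cmod ((\<phi> + \<psi>) d) \<le> a + b"
        by (auto intro: norm_triangle_le add_mono)
      then show ?thesis using that Dual_add_mem unfolding Q_def by blast
    qed
    show "fsc a \<phi> \<in> Q" if "a \<in> K" "\<phi> \<in> Q" for a \<phi>
    proof -
      obtain c where "\<And>d. d \<in> D \<Longrightarrow> cmod (\<phi> d) \<le> c"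
        using \<open>\<phi> \<in> Q\<close> unfolding Q_def by blast
      then have "\<forall>d\<in>D. cmod (fsc a \<phi> d) \<le> cmod a * c"
        by (auto simp: fsc_def norm_mult intro: mult_left_mono)
      then show ?thesis using that Dual_fsc_mem unfolding Q_def by blast
    qed
  qed
  have PsiQ: "\<Psi> \<subseteq> Q" using Psi_Dual Psi_bounded unfolding Q_def by blast
  have dense: "lc_top Dual (weak_star_sns V) closure_of Q = Dual"
  proof (intro antisym subsetI)
    fix \<phi> assume \<phi>: "\<phi> \<in> Dual"
    show "\<phi> \<in> lc_top Dual (weak_star_sns V) closure_of Q"
      unfolding W.closure_of_lc_top
    proof (intro conjI allI impI)
      fix F and e :: real assume F: "finite F \<and> F \<subseteq> weak_star_sns V \<and> e > 0"
      then have "F \<subseteq> (\<lambda>x \<phi>. cmod (\<phi> x)) ` V" unfolding weak_star_sns_def by auto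
      then obtain X where X: "finite X" "X \<subseteq> V" "F = (\<lambda>x \<phi>. cmod (\<phi> x)) ` X"
        using F finite_subset_image[of F "\<lambda>x \<phi>. cmod (\<phi> x)" V] by auto
      \<comment> \<open>A weak* neighbourhood tests only finitely many points, and there a member of
        \<open>Q\<close> can agree with \<phi> exactly.\<close>
      have "\<exists>\<psi>\<in>Q. \<forall>x\<in>X. \<psi> x = \<phi> x"
        using Psi_separating PsiQ by (intro Dual_interpolation[OF subQ subspQ _ \<phi> X(1,2)]) blast
      then obtain \<psi> where \<psi>: "\<psi> \<in> Q" "\<And>x. x \<in> X \<Longrightarrow> \<psi> x = \<phi> x" by blast
      have "q (\<psi> - \<phi>) < e" if "q \<in> F" for q
        using that F \<psi>(2) unfolding X(3) by auto
      then show "\<exists>\<psi>\<in>Q. \<psi> \<in> Dual \<and> (\<forall>q\<in>F. q (\<psi> - \<phi>) < e)"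
        using subQ \<psi>(1) by (intro bexI[of _ \<psi>]) auto
    qed (rule \<phi>)
  next
    fix \<phi> assume "\<phi> \<in> lc_top Dual (weak_star_sns V) closure_of Q"
    then show "\<phi> \<in> Dual" unfolding W.closure_of_lc_top by blast
  qed
  have closed: "closedin (subtopology (lc_top Dual (weak_star_sns V)) (polar K sc V P U)) (Q \<inter> polar K sc V P U)"
    if U: "zero_nbhd V P U" for U
  proof -
    define S where "S = Q \<inter> polar K sc V P U"
    \<comment> \<open>Members of \<open>Q\<close> have individual bounds on \<open>D\<close>, which
      a weak* limit could lose; inside the polar the bound becomes uniform and survives.\<close>
    have "\<exists>e>0. \<forall>x\<in>dspan. gauge x < e \<longrightarrow> (\<forall>\<phi>\<in>S. cmod (\<phi> x) \<le> 1)"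
    proof (rule equicontinuous)
      show "\<exists>c. \<forall>\<phi>\<in>S. cmod (\<phi> x) \<le> c" if "x \<in> V" for x
        using polar_pointwise_bounded[OF U that] unfolding S_def by blast
    qed (auto simp: S_def Q_def)
    then obtain e where e: "e > 0" "\<And>x \<phi>. x \<in> dspan \<Longrightarrow> gauge x < e \<Longrightarrow> \<phi> \<in> S \<Longrightarrow> cmod (\<phi> x) \<le> 1" by blast
    have "lc_top Dual (weak_star_sns V) closure_of S \<inter> polar K sc V P U \<subseteq> S"
    proof
      fix \<phi> assume "\<phi> \<in> lc_top Dual (weak_star_sns V) closure_of S \<inter> polar K sc V P U"
      then have pol: "\<phi> \<in> polar K sc V P U" and mem: "\<phi> \<in> lc_top Dual (weak_star_sns V) closure_of S"
        by auto
      have \<phi>: "\<phi> \<in> Dual" "\<phi> \<in> polar K sc V P U" and cl: "\<And>F e. finite F \<Longrightarrow> F \<subseteq> weak_star_sns V \<Longrightarrow> e > 0 \<Longrightarrow> \<exists>\<psi>\<in>S. \<psi> \<in> Dual \<and> (\<forall>q\<in>F. q (\<psi> - \<phi>) < e)"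
        using pol mem[unfolded W.closure_of_lc_top] by simp_all
      \<comment> \<open>One unit bounds the approximating member of \<open>S\<close>, the other the
        weak* error at \<open>x\<close>.\<close>
      have "cmod (\<phi> x) \<le> 2" if x: "x \<in> dspan" "gauge x < e" for x
      proof -
        have "(\<lambda>\<phi>. cmod (\<phi> x)) \<in> weak_star_sns V" using x dspan_sub unfolding weak_star_sns_def by blast
        then obtain \<psi> where "\<psi> \<in> S" "cmod ((\<psi> - \<phi>) x) < 1"
          using cl[of "{\<lambda>\<phi>. cmod (\<phi> x)}" 1] by auto
        moreover have "cmod (\<phi> x) \<le> cmod (\<psi> x) + cmod ((\<psi> - \<phi>) x)"
          using norm_triangle_ineq4[of "\<psi> x" "(\<psi> - \<phi>) x"] by simp
        ultimately show ?thesis using e(2)[OF x, of \<psi>] by simp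
      qed
      from ball_bound[where h="\<lambda>x. cmod (\<phi> x)", OF _ e(1) this] have "cmod (\<phi> d) \<le> 2 * 2 / e" if "d \<in> D" for d
        using that Dual_sc[OF \<phi>(1)] by (auto simp: norm_mult)
      with \<phi> show "\<phi> \<in> S" unfolding S_def Q_def by blast
    qed
    moreover have "S \<subseteq> lc_top Dual (weak_star_sns V) closure_of S"
      using subQ by (intro closure_of_subset) (auto simp: S_def)
    ultimately have "S = lc_top Dual (weak_star_sns V) closure_of S \<inter> polar K sc V P U"
      by (auto simp: S_def)
    then show ?thesis
      unfolding S_def[symmetric] closedin_subtopology by (intro exI[of _ "lc_top Dual (weak_star_sns V) closure_of S"]) auto
  qed
  have "Q = Dual"
    using Br subQ subspQ dense closed unfolding Br_complete_def by blast
  \<comment> \<open>With every functional now bounded on \<open>D\<close>, Banach-Steinhaus applies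
    to all functionals dominated by \<open>p\<close>; norming functionals turn the result into a
    bound for \<open>p\<close> itself.\<close>
  define S where "S = {\<phi>\<in>Dual. \<forall>y\<in>V. cmod (\<phi> y) \<le> p y}"
  have "\<exists>e>0. \<forall>x\<in>dspan. gauge x < e \<longrightarrow> (\<forall>\<phi>\<in>S. cmod (\<phi> x) \<le> 1)"
  proof (rule equicontinuous)
    show "\<exists>c. \<forall>d\<in>D. cmod (\<phi> d) \<le> c" if "\<phi> \<in> S" for \<phi>
      using that \<open>Q = Dual\<close> unfolding S_def Q_def by blast
  qed (auto simp: S_def)
  then obtain e where e: "e > 0" "\<And>x \<phi>. x \<in> dspan \<Longrightarrow> gauge x < e \<Longrightarrow> \<phi> \<in> S \<Longrightarrow> cmod (\<phi> x) \<le> 1" by blast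
  have "p x \<le> 1" if x: "x \<in> dspan" "gauge x < e" for x
  proof -
    obtain \<phi> where "\<phi> \<in> S" "p x \<le> cmod (\<phi> x)"
      using Dual_norming[OF p, of x] x dspan_sub unfolding S_def by blast
    then show ?thesis using e(2)[OF x] by force
  qed
  from ball_bound[where h=p, OF _ e(1) this] have "p d \<le> 2 * 1 / e" if "d \<in> D" for d
    using that seminorm_sc[OF sn[OF p]] by auto
  then show ?thesis by blast
qed

end

section \<open>Bounded Banach discs in webbed spaces\<close>

context lcs
begin

lemma seminorm_sum:
  assumes "p \<in> P" "finite I" "\<And>i. i \<in> I \<Longrightarrow> f i \<in> V"
  shows "p (\<Sum>i\<in>I. f i) \<le> (\<Sum>i\<in>I. p (f i))"
  using assms(2,3)
proof (induction I rule: finite_induct)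
  case (insert i I)
  then show ?case using seminorm_add[OF sn[OF assms(1)], of "f i" "\<Sum>i\<in>I. f i"] by auto
qed (simp add: seminorm_zero[OF sn[OF assms(1)]])

lemma limit_seminorm_le:
  assumes lim: "limitin (lc_top V P) f l sequentially" and p: "p \<in> P"
    and f: "\<And>n. f n \<in> V" "\<And>n. p (f n) \<le> c"
  shows "p l \<le> c"
proof (rule field_le_epsilon)
  fix e :: real assume e: "e > 0"
  have l: "l \<in> V" using lim unfolding limitin_lc_top by blast
  have "\<forall>\<^sub>F n in sequentially. p (f n - l) < e" using lim p e unfolding limitin_lc_top by blast
  then obtain n where n: "p (f n - l) < e" by (auto simp: eventually_sequentially)
  have "p (f n - (f n - l)) \<le> p (f n) + p (f n - l)"
    by (rule seminorm_diff[OF sn[OF p]]) (use f l in auto)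
  then show "p l \<le> c + e" using n f(2)[of n] by simp
qed

end

lemma sum_half_powers_le: "(\<Sum>k<n. (1/2::real) ^ k) \<le> 2"
proof -
  have "(\<Sum>k<n. (1/2::real) ^ k) = 2 - 2 * (1/2) ^ n" by (induction n) auto
  then show ?thesis by simp
qed

text \<open>De Wilde's argument: by Baire's theorem there is a branch of the web all of whose members are
  non-meagre in the Banach space spanned by \<open>D\<close>. Every small \<open>z\<close> is then a telescoping sum of scaled
  differences from the members of this branch, which the web property makes converge in \<open>V\<close>.\<close>

lemma (in separated_disc) bounded_if_webbed:
  assumes web: "webbed K sc V P" and p: "p \<in> P"
  shows "\<exists>c. \<forall>d\<in>D. p d \<le> c"
proof -
  define X where "X = lc_top dspan {gauge}"
  obtain C :: "nat list \<Rightarrow> 'v set" where C0: "C [] = V" and CS: "\<And>ns. C ns = (\<Union>n. C (ns @ [n]))"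
    and conv_web: "\<And>s :: nat \<Rightarrow> nat. \<exists>\<rho> :: nat \<Rightarrow> real. (\<forall>k. \<rho> k > 0) \<and>
         (\<forall>(lam::nat \<Rightarrow> real) (x::nat \<Rightarrow> 'v). (\<forall>k. 0 \<le> lam k \<and> lam k \<le> \<rho> k \<and> x k \<in> C (map s [0..<Suc k])) \<longrightarrow>
            (\<exists>y\<in>V. limitin (lc_top V P) (\<lambda>n. \<Sum>k<n. sc (complex_of_real (lam k)) (x k)) y sequentially))"
    using web unfolding webbed_def by (elim exE conjE) blast
  have step: "\<exists>n. \<not> meagre X (C (ns @ [n]) \<inter> dspan)" if ns: "\<not> meagre X (C ns \<inter> dspan)" for ns
  proof (rule ccontr)
    assume "\<nexists>n. \<not> meagre X (C (ns @ [n]) \<inter> dspan)"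
    then have "meagre X (\<Union>n. C (ns @ [n]) \<inter> dspan)" by (intro meagre_UN) auto
    moreover have "(\<Union>n. C (ns @ [n]) \<inter> dspan) = C ns \<inter> dspan" using CS[of ns] by blast
    ultimately show False using ns by simp
  qed
  define f where "f ns = (SOME n. \<not> meagre X (C (ns @ [n]) \<inter> dspan))" for ns
  define l where "l = rec_nat [] (\<lambda>_ ns. ns @ [f ns])"
  define s where "s k = f (l k)" for k
  have l_simps: "l 0 = []" "l (Suc k) = l k @ [s k]" for k by (simp_all add: l_def s_def)
  have l_eq: "l k = map s [0..<k]" for k by (induction k) (simp_all add: l_simps)
  have l_nonmeagre: "\<not> meagre X (C (l k) \<inter> dspan)" for k
  proof (induction k)
    case 0
    have "C [] \<inter> dspan = dspan" using C0 dspan_sub by auto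
    then show ?case using dspan_not_meagre by (simp add: l_simps X_def)
  next
    case (Suc k)
    show ?case using someI_ex[OF step[OF Suc]] by (simp add: l_simps s_def f_def)
  qed
  \<comment> \<open>Depth \<open>Suc k\<close> matches the index of the \<open>k\<close>-th summand
    in \<open>webbed\<close>.\<close>
  define M where "M k = C (map s [0..<Suc k]) \<inter> dspan" for k
  have nonmeagre: "\<not> meagre X (M k)" for k
    unfolding M_def l_eq[symmetric] by (rule l_nonmeagre)
  \<comment> \<open>The ball provided by the interior is recentred at a point \<open>y\<close> of
    \<open>M k\<close> itself, at the price of shrinking its radius by
    \<open>gauge (y - x0)\<close>; members of the branch are needed as centres for the web
    property.\<close>
  have "\<exists>y e. y \<in> M k \<and> e > 0 \<and> (\<forall>z\<in>dspan. gauge z < e \<longrightarrow> (\<forall>\<eta>>0. \<exists>x\<in>M k. gauge (x - (y + z)) < \<eta>))" for k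
  proof -
    have "X interior_of (X closure_of M k) \<noteq> {}"
      using not_meagreD[OF nonmeagre[of k]] by (auto simp: X_def M_def)
    then obtain x0 r where x0: "x0 \<in> X closure_of M k" "x0 \<in> dspan" and r: "r > 0"
      and ball: "\<And>z. z \<in> dspan \<Longrightarrow> gauge (z - x0) < r \<Longrightarrow> z \<in> X closure_of M k"
      unfolding X_def by (rule interior_ball) blast
    have cl: "\<exists>x\<in>M k. gauge (x - w) < \<eta>" if w: "w \<in> X closure_of M k" and "\<eta> > 0" for w \<eta>
      using w[unfolded X_def G.closure_of_lc_top, THEN conjunct2, THEN spec, of "{gauge}", THEN spec, of \<eta>] \<open>\<eta> > 0\<close>
      by auto
    obtain y where y: "y \<in> M k" "gauge (y - x0) < r" using cl[OF x0(1) r] by blast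
    have yG: "y \<in> dspan" using y unfolding M_def by blast
    have "\<exists>x\<in>M k. gauge (x - (y + z)) < \<eta>"
      if z: "z \<in> dspan" "gauge z < r - gauge (y - x0)" and "\<eta> > 0" for z \<eta>
    proof (rule cl[OF ball \<open>\<eta> > 0\<close>])
      have "gauge ((y - x0) + z) \<le> gauge (y - x0) + gauge z"
        using yG x0 z by (intro G.seminorm_add[OF gauge_seminorm]) auto
      moreover have "(y - x0) + z = y + z - x0" by simp
      ultimately show "gauge (y + z - x0) < r" using z(2) by simp
    qed (use yG z in auto)
    with y show ?thesis by (intro exI[of _ y] exI[of _ "r - gauge (y - x0)"]) auto
  qed
  then obtain y \<epsilon> where y: "\<And>k. y k \<in> M k" and \<epsilon>: "\<And>k. \<epsilon> k > 0"
    and dense: "\<And>k z \<eta>. z \<in> dspan \<Longrightarrow> gauge z < \<epsilon> k \<Longrightarrow> \<eta> > 0 \<Longrightarrow> \<exists>x\<in>M k. gauge (x - (y k + z)) < \<eta>"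
    by metis
  have MG: "x \<in> dspan" "x \<in> V" if "x \<in> M k" for x k using that dspan_sub unfolding M_def by auto
  obtain \<rho> :: "nat \<Rightarrow> real" where \<rho>: "\<And>k. \<rho> k > 0"
    and conv': "\<forall>(lam::nat \<Rightarrow> real) (x::nat \<Rightarrow> 'v). (\<forall>k. 0 \<le> lam k \<and> lam k \<le> \<rho> k \<and> x k \<in> C (map s [0..<Suc k])) \<longrightarrow>
            (\<exists>y\<in>V. limitin (lc_top V P) (\<lambda>n. \<Sum>k<n. sc (complex_of_real (lam k)) (x k)) y sequentially)"
    using conv_web[of s] by (elim exE conjE) blast
  have conv: "\<exists>a. limitin (lc_top V P) (\<lambda>n. \<Sum>k<n. sc (complex_of_real (lam k)) (x k)) a sequentially"
    if "\<And>k. 0 \<le> lam k" "\<And>k. lam k \<le> \<rho> k" "\<And>k. x k \<in> M k" for lam x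
    using conv'[THEN spec, of lam, THEN spec, of x] that unfolding M_def by auto
  \<comment> \<open>Terms of a convergent series tend to \<open>0\<close> for every selection along
    the branch; selecting offenders wherever they exist shows that the bound is uniform over
    \<open>M k\<close> from some index on.\<close>
  have "\<exists>k0. \<forall>k\<ge>k0. \<forall>x\<in>M k. \<rho> k * p x \<le> 1"
  proof (rule ccontr)
    assume "\<nexists>k0. \<forall>k\<ge>k0. \<forall>x\<in>M k. \<rho> k * p x \<le> 1"
    then have bad: "\<exists>k\<ge>k0. \<exists>x\<in>M k. \<rho> k * p x > 1" for k0 by (meson not_le)
    \<comment> \<open>The default \<open>y k\<close> makes \<open>w\<close> a legal selection at
      indices without an offender.\<close>
    define w where "w k = (if \<exists>x\<in>M k. \<rho> k * p x > 1 then SOME x. x \<in> M k \<and> \<rho> k * p x > 1 else y k)" for k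
    have w: "w k \<in> M k" "(\<exists>x\<in>M k. \<rho> k * p x > 1) \<Longrightarrow> \<rho> k * p (w k) > 1" for k
      unfolding w_def using y someI_ex[of "\<lambda>x. x \<in> M k \<and> \<rho> k * p x > 1"] by auto
    define S where "S n = (\<Sum>k<n. sc (complex_of_real (\<rho> k)) (w k))" for n
    have SV: "S n \<in> V" for n unfolding S_def using MG(2)[OF w(1)] by (intro sum_mem sc_mem) auto
    obtain a where a: "limitin (lc_top V P) S a sequentially"
      unfolding S_def using conv[of \<rho> w] w(1) \<rho> by (auto simp: less_imp_le)
    then have aV: "a \<in> V" and lim: "\<forall>q\<in>P. \<forall>e>0. \<forall>\<^sub>F n in sequentially. q (S n - a) < e"
      unfolding limitin_lc_top by auto
    have "\<forall>\<^sub>F n in sequentially. p (S n - a) < 1/2"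
      by (rule lim[THEN bspec[OF _ p], THEN spec, THEN mp]) simp
    then obtain N where N: "\<And>n. n \<ge> N \<Longrightarrow> p (S n - a) < 1/2" by (auto simp: eventually_sequentially)
    obtain k where k: "k \<ge> N" "\<exists>x\<in>M k. \<rho> k * p x > 1" using bad by blast
    have "p (S (Suc k) - S k) \<le> p (S (Suc k) - a) + p (a - S k)"
      by (rule seminorm_triangle[OF sn[OF p]]) (use SV aV in auto)
    also have "p (a - S k) = p (S k - a)" by (rule seminorm_commute[OF sn[OF p] aV SV])
    finally have "p (S (Suc k) - S k) < 1" using N[of k] N[of "Suc k"] k(1) by simp
    moreover have "S (Suc k) - S k = sc (complex_of_real (\<rho> k)) (w k)" by (simp add: S_def)
    ultimately have "\<rho> k * p (w k) < 1"
      using seminorm_sc[OF sn[OF p] K_of_real MG(2)[OF w(1)], of "\<rho> k"] \<rho>[of k] by simp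
    with w(2)[OF k(2)] show False by simp
  qed
  then obtain k0 where k0: "\<And>k x. k \<ge> k0 \<Longrightarrow> x \<in> M k \<Longrightarrow> \<rho> k * p x \<le> 1" by blast
  \<comment> \<open>The extra \<open>(1/2) ^ k\<close> makes the \<open>p\<close>-values of the
    terms geometrically summable. Below \<open>k0\<close> no bound for \<open>p\<close> is
    available, so \<open>lam\<close> is \<open>0\<close> there.\<close>
  define \<mu> where "\<mu> k = \<rho> k * (1/2) ^ k" for k
  define lam where "lam k = (if k < k0 then 0 else \<mu> k)" for k
  \<comment> \<open>The first entry puts a residual divided by \<open>\<mu> k\<close> into the ball
    about \<open>y k\<close> that \<open>M k\<close> approximates; the second drives the residuals
    to \<open>0\<close> in the gauge.\<close>
  define \<delta> where "\<delta> k = min (\<mu> k * \<epsilon> k) ((1/2) ^ k)" for k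
  have \<mu>: "\<mu> k > 0" for k using \<rho> by (simp add: \<mu>_def)
  have \<delta>: "\<delta> k > 0" for k using \<mu> \<epsilon> by (simp add: \<delta>_def)
  have lam: "0 \<le> lam k" "lam k \<le> \<rho> k" for k
  proof -
    show "0 \<le> lam k" using \<mu>[of k] by (simp add: lam_def)
    have "\<mu> k \<le> \<rho> k * 1" unfolding \<mu>_def using \<rho>[of k] by (intro mult_left_mono power_le_one) auto
    then show "lam k \<le> \<rho> k" using \<rho>[of k] by (simp add: lam_def)
  qed
  have lam_p: "p (sc (complex_of_real (lam k)) x) \<le> (1/2) ^ k" if x: "x \<in> M k" for k x
  proof -
    have "p (sc (complex_of_real (lam k)) x) = lam k * p x"
      using seminorm_sc[OF sn[OF p] K_of_real MG(2)[OF x], of "lam k"] lam by simp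
    also have "\<dots> \<le> (1/2) ^ k"
    proof (cases "k < k0")
      case False
      then have "(1/2) ^ k * (\<rho> k * p x) \<le> (1/2) ^ k * 1" using k0[of k x] x by (intro mult_left_mono) auto
      with False show ?thesis by (simp add: lam_def \<mu>_def algebra_simps)
    qed (simp add: lam_def)
    finally show ?thesis .
  qed
  have sum_p: "p a \<le> 2"
    if a: "limitin (lc_top V P) (\<lambda>n. \<Sum>k<n. sc (complex_of_real (lam k)) (x k)) a sequentially"
      and x: "\<And>k. x k \<in> M k" for a x
  proof (rule limit_seminorm_le[OF a p])
    fix n
    show "(\<Sum>k<n. sc (complex_of_real (lam k)) (x k)) \<in> V" using MG(2)[OF x] by (intro sum_mem sc_mem) auto
    have "p (\<Sum>k<n. sc (complex_of_real (lam k)) (x k)) \<le> (\<Sum>k<n. p (sc (complex_of_real (lam k)) (x k)))"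
      using MG(2)[OF x] by (intro seminorm_sum[OF p] sc_mem) auto
    also have "\<dots> \<le> (\<Sum>k<n. (1/2) ^ k)" using x by (intro sum_mono lam_p)
    also have "\<dots> \<le> 2" by (rule sum_half_powers_le)
    finally show "p (\<Sum>k<n. sc (complex_of_real (lam k)) (x k)) \<le> 2" .
  qed
  have "p z \<le> 4" if z: "z \<in> dspan" "gauge z < \<delta> k0" for z
  proof -
    \<comment> \<open>\<open>v\<close> is the residual before step \<open>k\<close>. The steps below
      \<open>k0\<close> have coefficient \<open>0\<close>, so \<open>max k k0\<close> keeps the
      threshold at \<open>\<delta> k0\<close> meanwhile; the last clause starts the recursion at
      \<open>z\<close>.\<close>
    define Inv where "Inv k v \<longleftrightarrow> v \<in> dspan \<and> gauge v < \<delta> (max k k0) \<and> (k = 0 \<longrightarrow> v = z)" for k v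
    define Next where "Next k v v' \<longleftrightarrow> (\<exists>x\<in>M k. v' = v - sc (complex_of_real (lam k)) (x - y k))" for k v v'
    have next_step: "\<exists>v'. Inv (Suc k) v' \<and> Next k v v'" if v: "Inv k v" for k v
    proof (cases "k < k0")
      case True
      then have "max (Suc k) k0 = k0" "max k k0 = k0" by auto
      then have "Inv (Suc k) v" using v by (simp add: Inv_def)
      moreover have "Next k v v"
        unfolding Next_def using True y by (intro bexI[of _ "y k"]) (auto simp: lam_def)
      ultimately show ?thesis by blast
    next
      case False
      then have max: "max k k0 = k" "max (Suc k) k0 = Suc k" and lam_eq: "lam k = \<mu> k"
        by (auto simp: lam_def)
      have vG: "v \<in> dspan" "gauge v < \<mu> k * \<epsilon> k" using v by (auto simp: Inv_def max \<delta>_def)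
      define u where "u = sc (complex_of_real (1 / \<mu> k)) v"
      have uG: "u \<in> dspan" unfolding u_def using vG(1) by (intro G.sc_mem K_of_real)
      have "gauge u = 1 / \<mu> k * gauge v"
        unfolding u_def using G.seminorm_sc[OF gauge_seminorm K_of_real vG(1), of "1 / \<mu> k"] \<mu>[of k]
        by (simp add: norm_divide)
      also have "\<dots> < \<epsilon> k" using vG(2) \<mu>[of k] by (simp add: field_simps)
      \<comment> \<open>The tolerance is divided by \<open>\<mu> k\<close> because the new residual
        is \<open>- \<mu> k\<close> times the error made here.\<close>
      finally obtain x where x: "x \<in> M k" "gauge (x - (y k + u)) < \<delta> (Suc k) / \<mu> k"
        using dense[OF uG _, of k "\<delta> (Suc k) / \<mu> k"] \<delta>[of "Suc k"] \<mu>[of k] by auto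
      have xyu: "x \<in> dspan" "y k \<in> dspan" "x - (y k + u) \<in> dspan"
        using x(1) y[of k] MG(1) uG by auto
      define v' where "v' = v - sc (complex_of_real (\<mu> k)) (x - y k)"
      have "sc (complex_of_real (\<mu> k)) u = v"
        unfolding u_def using vG(1) G.sc_sc[OF K_of_real K_of_real vG(1), of "\<mu> k" "1 / \<mu> k"] \<mu>[of k]
        by simp
      then have v'_eq: "v' = - sc (complex_of_real (\<mu> k)) (x - (y k + u))"
        unfolding v'_def using xyu uG by (simp add: G.sc_diff G.sc_add)
      have "gauge v' = \<mu> k * gauge (x - (y k + u))"
        unfolding v'_eq using G.seminorm_sc[OF gauge_seminorm K_of_real xyu(3), of "\<mu> k"] \<mu>[of k]
          G.seminorm_minus[OF gauge_seminorm G.sc_mem[OF K_of_real xyu(3)], of "\<mu> k"] by simp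
      also have "\<dots> < \<delta> (Suc k)" using x(2) \<mu>[of k] by (simp add: field_simps)
      finally have "Inv (Suc k) v'"
        using xyu vG(1) by (simp add: Inv_def max v'_def)
      moreover have "Next k v v'" unfolding Next_def v'_def lam_eq using x(1) by blast
      ultimately show ?thesis by blast
    qed
    have "Inv 0 z" using z by (simp add: Inv_def)
    then obtain v where v: "\<And>k. Inv k (v k)" "\<And>k. Next k (v k) (v (Suc k))"
      using dependent_nat_choice[of Inv Next, OF _ next_step] by blast
    have "\<exists>x. \<forall>k. x k \<in> M k \<and> v (Suc k) = v k - sc (complex_of_real (lam k)) (x k - y k)"
      using v(2) unfolding Next_def by (intro choice) blast
    then obtain x where x: "\<And>k. x k \<in> M k" "\<And>k. v (Suc k) = v k - sc (complex_of_real (lam k)) (x k - y k)"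
      by blast
    \<comment> \<open>The web speaks about members of the branch, not about their differences, so
      the sums of the \<open>x k\<close> and of the \<open>y k\<close> are made to converge
      separately.\<close>
    define A where "A n = (\<Sum>k<n. sc (complex_of_real (lam k)) (x k))" for n
    define B where "B n = (\<Sum>k<n. sc (complex_of_real (lam k)) (y k))" for n
    have ABV: "A n \<in> V" "B n \<in> V" for n
      unfolding A_def B_def using MG(2)[OF x(1)] MG(2)[OF y] by (auto intro!: sum_mem sc_mem)
    have v_eq: "v n = z - (A n - B n)" for n
    proof (induction n)
      case 0
      show ?case using v(1)[of 0] by (simp add: Inv_def A_def B_def)
    next
      case (Suc n)
      have "sc (complex_of_real (lam n)) (x n - y n) = sc (complex_of_real (lam n)) (x n) - sc (complex_of_real (lam n)) (y n)"
        using MG(2)[OF x(1)] MG(2)[OF y] by (intro sc_diff) auto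
      then show ?case by (simp add: x(2) Suc A_def B_def)
    qed
    obtain a where a: "limitin (lc_top V P) A a sequentially"
      unfolding A_def using conv[of lam x] lam x(1) by blast
    obtain b where b: "limitin (lc_top V P) B b sequentially"
      unfolding B_def using conv[of lam y] lam y by blast
    have abV: "a \<in> V" "b \<in> V" using a b unfolding limitin_lc_top by auto
    have zV: "z \<in> V" using z dspan_sub by auto
    \<comment> \<open>Residuals vanish in the gauge while the partial sums converge in
      \<open>V\<close>; functionals in \<Psi> are continuous for both and reconcile the limits. The
      bound \<open>4\<close> is then \<open>p a + p b\<close>.\<close>
    have "z - (a - b) = 0"
    proof (rule Psi_separating)
      fix \<psi> assume \<psi>: "\<psi> \<in> \<Psi>"
      then have \<psi>D: "\<psi> \<in> Dual" using Psi_Dual by blast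
      obtain c where c: "\<And>d. d \<in> D \<Longrightarrow> cmod (\<psi> d) \<le> c" using Psi_bounded[OF \<psi>] by blast
      have c0: "c \<ge> 0" using c[OF D_zero] norm_ge_zero order_trans by blast
      have "\<psi> z - (\<psi> (A n) - \<psi> (B n)) = \<psi> (v n)" for n
        unfolding v_eq using zV ABV by (simp add: Dual_diff[OF \<psi>D])
      moreover have "(\<lambda>n. \<psi> z - (\<psi> (A n) - \<psi> (B n))) \<longlonglongrightarrow> \<psi> z - (\<psi> a - \<psi> b)"
        by (intro tendsto_intros Dual_limit[OF \<psi>D] a b)
      ultimately have "(\<lambda>n. \<psi> (v n)) \<longlonglongrightarrow> \<psi> z - (\<psi> a - \<psi> b)" by simp
      moreover have "(\<lambda>n. \<psi> (v n)) \<longlonglongrightarrow> 0"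
      proof (rule Lim_null_comparison)
        have "cmod (\<psi> (v n)) \<le> c * (1/2) ^ n" for n
        proof -
          have vn: "v n \<in> dspan" "gauge (v n) < \<delta> (max n k0)" using v(1)[of n] by (auto simp: Inv_def)
          have "cmod (\<psi> (v n)) \<le> c * gauge (v n)"
            using c by (intro gauge_bound[OF vn(1)]) (auto simp: Dual_sc[OF \<psi>D] norm_mult)
          also have "\<dots> \<le> c * (1/2) ^ n"
          proof (rule mult_left_mono[OF _ c0])
            have "gauge (v n) \<le> (1/2) ^ max n k0" using vn(2) by (simp add: \<delta>_def)
            also have "\<dots> \<le> (1/2 :: real) ^ n" by (intro power_decreasing) auto
            finally show "gauge (v n) \<le> (1/2) ^ n" .
          qed
          finally show ?thesis .
        qed
        then show "\<forall>\<^sub>F n in sequentially. norm (\<psi> (v n)) \<le> c * (1/2) ^ n" by simp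
        show "(\<lambda>n. c * (1/2) ^ n) \<longlonglongrightarrow> 0"
          by (intro tendsto_mult_right_zero LIMSEQ_realpow_zero) auto
      qed
      ultimately have "\<psi> z - (\<psi> a - \<psi> b) = 0" by (rule LIMSEQ_unique)
      then show "\<psi> (z - (a - b)) = 0" using zV abV by (simp add: Dual_diff[OF \<psi>D])
    qed (use zV abV in auto)
    then have "z = a - b" by simp
    moreover have "p (a - b) \<le> p a + p b" by (rule seminorm_diff[OF sn[OF p] abV])
    ultimately show ?thesis
      using sum_p[OF a[unfolded A_def] x(1)] sum_p[OF b[unfolded B_def] y] by simp
  qed
  from ball_bound[where h=p, OF _ \<delta> this] have "p d \<le> 2 * 4 / \<delta> k0" if "d \<in> D" for d
    using that seminorm_sc[OF sn[OF p]] by auto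
  then show ?thesis by blast
qed

section \<open>Weakly represented families\<close>

context lcs
begin

text \<open>Needed for \<open>C p\<close>, because the \<kappa> seminorms range over absolutely
  convex compact sets only.\<close>

lemma abs_convex_closure:
  assumes S: "abs_convex K sc S" "S \<subseteq> V"
  shows "abs_convex K sc (lc_top V P closure_of S)"
  unfolding abs_convex_def
proof (intro ballI impI)
  fix x y a b
  assume x: "x \<in> lc_top V P closure_of S" and y: "y \<in> lc_top V P closure_of S"
    and ab: "a \<in> K" "b \<in> K" "cmod a + cmod b \<le> 1"
  have xyV: "x \<in> V" "y \<in> V" using x y by (simp_all add: closure_of_lc_top)
  show "sc a x + sc b y \<in> lc_top V P closure_of S"
    unfolding closure_of_lc_top
  proof (intro conjI allI impI)
    show "sc a x + sc b y \<in> V" using xyV ab by simp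
    fix F and e :: real assume F: "finite F \<and> F \<subseteq> P \<and> e > 0"
    obtain x' where x': "x' \<in> S" "\<And>p. p \<in> F \<Longrightarrow> p (x' - x) < e"
      using x F unfolding closure_of_lc_top by meson
    obtain y' where y': "y' \<in> S" "\<And>p. p \<in> F \<Longrightarrow> p (y' - y) < e"
      using y F unfolding closure_of_lc_top by meson
    have V': "x' \<in> V" "y' \<in> V" using x' y' S by auto
    have "p ((sc a x' + sc b y') - (sc a x + sc b y)) < e" if p: "p \<in> F" for p
    proof -
      have sp: "seminorm_on K sc V p" using sn p F by blast
      have "(sc a x' + sc b y') - (sc a x + sc b y) = sc a (x' - x) + sc b (y' - y)"
        using V' xyV ab by (simp add: sc_diff)
      also have "p \<dots> \<le> p (sc a (x' - x)) + p (sc b (y' - y))"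
        using V' xyV ab by (intro seminorm_add[OF sp]) auto
      also have "\<dots> = cmod a * p (x' - x) + cmod b * p (y' - y)"
        using V' xyV ab by (simp add: seminorm_sc[OF sp])
      also have "\<dots> \<le> cmod a * max (p (x' - x)) (p (y' - y)) + cmod b * max (p (x' - x)) (p (y' - y))"
        by (intro add_mono mult_left_mono) auto
      also have "\<dots> = (cmod a + cmod b) * max (p (x' - x)) (p (y' - y))" by (simp add: algebra_simps)
      also have "\<dots> \<le> 1 * max (p (x' - x)) (p (y' - y))"
        using ab seminorm_nonneg[OF sp, of "x' - x"] V' xyV by (intro mult_right_mono) auto
      also have "\<dots> < e" using x'(2)[OF p] y'(2)[OF p] by simp
      finally show ?thesis .
    qed
    moreover have "sc a x' + sc b y' \<in> S" using x' y' ab by (intro abs_convex_comb[OF S(1)])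
    ultimately show "\<exists>z\<in>S. z \<in> V \<and> (\<forall>p\<in>F. p (z - (sc a x + sc b y)) < e)"
      using S(2) by blast
  qed
qed

text \<open>\<open>\<sigma> n\<close> is the pointwise sum of
  \<open>\<beta> (n + k) / 2 ^ (k + 1)\<close>. The weights sum to \<open>1\<close>, so domination
  by \<open>p\<close>, and with it continuity, survives; applying \<open>R\<close> gives the clause
  \<open>series\<close> of \<open>banach_disc\<close>.\<close>

lemma Dual_half_series:
  assumes p: "p \<in> P" and \<beta>: "\<And>n::nat. \<beta> n \<in> Dual" "\<And>n x. x \<in> V \<Longrightarrow> cmod (\<beta> n x) \<le> p x"
  shows "\<exists>\<sigma>. (\<forall>n. \<sigma> n \<in> Dual \<and> (\<forall>x\<in>V. cmod (\<sigma> n x) \<le> p x))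
    \<and> (\<forall>n. \<sigma> n = fsc (1 / 2) (\<beta> n) + fsc (1 / 2) (\<sigma> (Suc n)))"
proof -
  define h where "h n x k = (1 / 2) ^ Suc k * \<beta> (n + k) x" for n x k
  define \<sigma> where "\<sigma> n x = (\<Sum>k. h n x k)" for n x
  have h_le: "norm (h n x k) \<le> (1 / 2) ^ Suc k * p x" if "x \<in> V" for n x k
    using mult_left_mono[OF \<beta>(2)[OF that, of "n + k"], of "(1 / 2) ^ Suc k"]
    by (simp add: h_def norm_mult norm_power norm_divide)
  have geo: "(\<lambda>k. (1 / 2) ^ Suc k * p x) sums p x" for x
    using sums_mult2[OF power_half_series, of "p x"] by simp
  have sm: "summable (h n x)" if "x \<in> V" for n x
    by (rule summable_comparison_test'[where N=0, OF sums_summable[OF geo]], rule h_le[OF that])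
  have le: "cmod (\<sigma> n x) \<le> p x" if "x \<in> V" for n x
    unfolding \<sigma>_def using norm_suminf_le[of "h n x" "\<lambda>k. (1 / 2) ^ Suc k * p x", OF h_le[OF that]] geo[of x]
    by (simp add: sums_iff)
  have out: "\<sigma> n x = 0" if "x \<notin> V" for n x
    using Dual_outside[OF \<beta>(1) that] by (simp add: \<sigma>_def h_def)
  have half: "(1 / 2) ^ k \<in> K" for k
  proof -
    have "complex_of_real ((1 / 2) ^ k) \<in> K" by (rule K_of_real)
    then show ?thesis by simp
  qed
  have mem: "\<sigma> n x \<in> K" if x: "x \<in> V" for n x
  proof -
    \<comment> \<open>For real scalars it has to be checked that the limit of the partial sums,
      taken in the complex numbers, stays in \<open>K\<close>.\<close>
    have "closed K" using K closed_complex_Reals by auto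
    moreover have "h n x k \<in> K" for k
      unfolding h_def using half Dual_mem_K[OF \<beta>(1) x] by (intro K_closed) auto
    then have "(\<Sum>k<m. h n x k) \<in> K" for m by (induction m) auto
    moreover have "(\<lambda>m. \<Sum>k<m. h n x k) \<longlonglongrightarrow> \<sigma> n x"
      unfolding \<sigma>_def by (rule summable_LIMSEQ[OF sm[OF x]])
    ultimately show ?thesis by (rule closed_sequentially)
  qed
  have add: "\<sigma> n (x + y) = \<sigma> n x + \<sigma> n y" if "x \<in> V" "y \<in> V" for n x y
  proof -
    have "h n (x + y) = (\<lambda>k. h n x k + h n y k)"
      using that \<beta>(1) by (simp add: h_def Dual_add fun_eq_iff algebra_simps)
    then show ?thesis unfolding \<sigma>_def using suminf_add[OF sm[OF that(1)] sm[OF that(2)], of n n] by simp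
  qed
  have scal: "\<sigma> n (sc a x) = a * \<sigma> n x" if "a \<in> K" "x \<in> V" for n a x
  proof -
    have "h n (sc a x) = (\<lambda>k. a * h n x k)"
      using that \<beta>(1) by (simp add: h_def Dual_sc fun_eq_iff algebra_simps)
    then show ?thesis unfolding \<sigma>_def using suminf_mult[OF sm[OF that(2)], of a n] by simp
  qed
  have Dual: "\<sigma> n \<in> Dual" for n
    using mem add scal out le p by (intro mem_DualI[of "\<sigma> n" "{p}" 1]) (auto simp: lin_map_def)
  have rec: "\<sigma> n x = (1 / 2) * \<beta> n x + (1 / 2) * \<sigma> (Suc n) x" for n x
  proof (cases "x \<in> V")
    case True
    have "(\<lambda>k. h n x (Suc k)) = (\<lambda>k. (1 / 2) * h (Suc n) x k)" by (simp add: h_def fun_eq_iff)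
    then have "(1 / 2) * \<sigma> (Suc n) x = \<sigma> n x - h n x 0"
      using suminf_split_head[OF sm[OF True], of n] suminf_mult[OF sm[OF True], of "1 / 2" "Suc n"]
      by (simp only: \<sigma>_def)
    then show ?thesis by (simp add: h_def[of n x 0] diff_divide_distrib)
  next
    case False
    then show ?thesis using out Dual_outside[OF \<beta>(1)] by simp
  qed
  have "\<sigma> n = fsc (1 / 2) (\<beta> n) + fsc (1 / 2) (\<sigma> (Suc n))" for n
    by (rule ext, unfold plus_fun_apply fsc_def, rule rec)
  with Dual le show ?thesis by blast
qed

end

locale weak_family = V: lcs K sc V P + E: lcs K scE VE PE
  for K :: "complex set" and sc :: "complex \<Rightarrow> 'v::ab_group_add \<Rightarrow> 'v" and V P
    and scE :: "complex \<Rightarrow> 'e::ab_group_add \<Rightarrow> 'e" and VE PE +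
  fixes I :: "'i set" and t :: "'i \<Rightarrow> 'v \<Rightarrow> complex" and F :: "'i \<Rightarrow> 'e"
  assumes t_Dual: "i \<in> I \<Longrightarrow> t i \<in> V.Dual"
    and t_separating: "x \<in> V \<Longrightarrow> (\<And>i. i \<in> I \<Longrightarrow> t i x = 0) \<Longrightarrow> x = 0"
    and F_mem: "i \<in> I \<Longrightarrow> F i \<in> VE"
    and weak: "e' \<in> E.Dual \<Longrightarrow> \<exists>g\<in>V. \<forall>i\<in>I. t i g = e' (F i)"
begin

text \<open>The chosen \<open>g\<close> is unique because the \<open>t i\<close> separate points,
  and this uniqueness makes \<open>R\<close> linear.\<close>

definition R :: "('e \<Rightarrow> complex) \<Rightarrow> 'v" where
  "R e' = (SOME g. g \<in> V \<and> (\<forall>i\<in>I. t i g = e' (F i)))"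

lemma R_mem: "e' \<in> E.Dual \<Longrightarrow> R e' \<in> V" and t_R: "e' \<in> E.Dual \<Longrightarrow> i \<in> I \<Longrightarrow> t i (R e') = e' (F i)"
  using someI_ex[of "\<lambda>g. g \<in> V \<and> (\<forall>i\<in>I. t i g = e' (F i))"] weak[of e'] unfolding R_def by blast+

lemma R_unique: "e' \<in> E.Dual \<Longrightarrow> g \<in> V \<Longrightarrow> (\<And>i. i \<in> I \<Longrightarrow> t i g = e' (F i)) \<Longrightarrow> R e' = g"
  using t_separating[of "R e' - g"] V.Dual_diff[OF t_Dual] R_mem[of e'] t_R[of e'] by simp

lemma R_comb:
  assumes e: "e' \<in> E.Dual" "f' \<in> E.Dual" and ab: "a \<in> K" "b \<in> K"
  shows "R (fsc a e' + fsc b f') = sc a (R e') + sc b (R f')"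
proof (rule R_unique)
  show "fsc a e' + fsc b f' \<in> E.Dual"
    using e ab by (intro E.Dual_add_mem E.Dual_fsc_mem)
  show "sc a (R e') + sc b (R f') \<in> V" using e ab R_mem by simp
  fix i assume "i \<in> I"
  then show "t i (sc a (R e') + sc b (R f')) = (fsc a e' + fsc b f') (F i)"
    using e ab R_mem t_R V.Dual_add[OF t_Dual] V.Dual_sc[OF t_Dual] by (simp add: fsc_def)
qed

lemma R_sc: "e' \<in> E.Dual \<Longrightarrow> a \<in> K \<Longrightarrow> R (fsc a e') = sc a (R e')"
  using R_comb[of e' e' a 0] R_mem[of e'] by (simp add: fsc_def zero_fun_def[symmetric])

text \<open>The polar of the closed unit ball of \<open>p\<close>.\<close>

definition B :: "('e \<Rightarrow> real) \<Rightarrow> ('e \<Rightarrow> complex) set" where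
  "B p = {e'\<in>E.Dual. \<forall>x\<in>VE. cmod (e' x) \<le> p x}"

lemma B_Dual: "e' \<in> B p \<Longrightarrow> e' \<in> E.Dual"
  unfolding B_def by blast

lemma B_le: "e' \<in> B p \<Longrightarrow> x \<in> VE \<Longrightarrow> cmod (e' x) \<le> p x"
  unfolding B_def by blast

lemma disc_R:
  assumes p: "p \<in> PE"
  shows "disc K sc V (R ` B p)"
proof
  show "R ` B p \<subseteq> V" using R_mem B_Dual by blast
  have "0 \<in> B p"
    using E.seminorm_nonneg[OF E.sn[OF p]] E.Dual_zero_mem by (auto simp: B_def)
  then show "R ` B p \<noteq> {}" by blast
  show "abs_convex K sc (R ` B p)"
    unfolding abs_convex_def
  proof (intro ballI impI)
    fix x y a b assume "x \<in> R ` B p" "y \<in> R ` B p" and ab: "a \<in> K" "b \<in> K" "cmod a + cmod b \<le> 1"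
    then obtain e' f' where ef: "e' \<in> B p" "f' \<in> B p" "x = R e'" "y = R f'" by blast
    have "fsc a e' + fsc b f' \<in> E.Dual"
      using B_Dual ef ab by (intro E.Dual_add_mem E.Dual_fsc_mem) auto
    moreover have "cmod ((fsc a e' + fsc b f') z) \<le> p z" if z: "z \<in> VE" for z
    proof -
      have "cmod ((fsc a e' + fsc b f') z) \<le> cmod a * cmod (e' z) + cmod b * cmod (f' z)"
        using norm_triangle_ineq[of "a * e' z" "b * f' z"] by (simp add: fsc_def norm_mult)
      also have "\<dots> \<le> cmod a * p z + cmod b * p z"
        using B_le ef z by (intro add_mono mult_left_mono) auto
      also have "\<dots> = (cmod a + cmod b) * p z" by (simp add: algebra_simps)
      also have "\<dots> \<le> 1 * p z"
        using ab E.seminorm_nonneg[OF E.sn[OF p] z] by (intro mult_right_mono) auto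
      finally show ?thesis by simp
    qed
    ultimately have "fsc a e' + fsc b f' \<in> B p" unfolding B_def by blast
    moreover have "sc a x + sc b y = R (fsc a e' + fsc b f')"
      using ef ab B_Dual by (simp add: R_comb)
    ultimately show "sc a x + sc b y \<in> R ` B p" by blast
  qed
qed

text \<open>On the disc each \<open>t i\<close> is bounded by \<open>p (F i)\<close>, because
  \<open>t i (R e') = e' (F i)\<close>. This bounds the separating functionals and also shows that a
  vector of gauge \<open>0\<close> is annihilated by all of them.\<close>

lemma separated_disc_R:
  assumes p: "p \<in> PE"
  shows "separated_disc K sc V P (R ` B p) (t ` I)"
proof -
  interpret D: disc K sc V "R ` B p" by (rule disc_R[OF p])
  have t_bound: "cmod (t i d) \<le> p (F i)" if "i \<in> I" "d \<in> R ` B p" for i d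
    using that t_R[OF B_Dual] B_le F_mem by auto
  show ?thesis
  proof
    fix b :: "nat \<Rightarrow> 'v" assume "\<And>n. b n \<in> R ` B p"
    then have "\<exists>\<beta>. \<forall>n. \<beta> n \<in> B p \<and> b n = R (\<beta> n)" by (intro choice) blast
    then obtain \<beta> where \<beta>: "\<And>n. \<beta> n \<in> B p" "\<And>n. b n = R (\<beta> n)" by blast
    have "\<exists>\<sigma>. (\<forall>n. \<sigma> n \<in> E.Dual \<and> (\<forall>x\<in>VE. cmod (\<sigma> n x) \<le> p x))
        \<and> (\<forall>n. \<sigma> n = fsc (1 / 2) (\<beta> n) + fsc (1 / 2) (\<sigma> (Suc n)))"
      by (intro E.Dual_half_series p B_Dual[of _ p] B_le[of _ p] \<beta>(1))
    then obtain \<sigma> where \<sigma>: "\<And>n. \<sigma> n \<in> B p" "\<And>n. \<sigma> n = fsc (1 / 2) (\<beta> n) + fsc (1 / 2) (\<sigma> (Suc n))"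
      unfolding B_def by blast
    have h: "1 / 2 \<in> K" using V.K_of_real[of "1 / 2"] by simp
    have rec: "R (\<sigma> n) = sc (1 / 2) (b n) + sc (1 / 2) (R (\<sigma> (Suc n)))" for n
      unfolding \<beta>(2) by (subst \<sigma>(2)) (rule R_comb[OF B_Dual[OF \<beta>(1)] B_Dual[OF \<sigma>(1)] h h])
    show "\<exists>s. (\<forall>n. s n \<in> R ` B p) \<and> (\<forall>n. s n = sc (1 / 2) (b n) + sc (1 / 2) (s (Suc n)))"
      by (intro exI[of _ "\<lambda>n. R (\<sigma> n)"] conjI allI imageI \<sigma>(1) rec)
  next
    fix x assume x: "x \<in> D.dspan" "D.gauge x = 0"
    show "x = 0"
    proof (rule t_separating)
      show "x \<in> V" using x D.dspan_sub by blast
      fix i assume i: "i \<in> I"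
      have "cmod (t i x) \<le> p (F i) * D.gauge x"
        using t_bound[OF i] by (intro D.gauge_bound[OF x(1)]) (auto simp: V.Dual_sc[OF t_Dual[OF i]] norm_mult R_mem B_Dual)
      then show "t i x = 0" using x(2) by simp
    qed
  next
    show "t ` I \<subseteq> V.Dual" using t_Dual by blast
    show "x = 0" if "x \<in> V" "\<And>\<psi>. \<psi> \<in> t ` I \<Longrightarrow> \<psi> x = 0" for x
      using that t_separating by blast
    show "\<exists>c. \<forall>d\<in>R ` B p. cmod (\<psi> d) \<le> c" if "\<psi> \<in> t ` I" for \<psi>
      using that t_bound by blast
  qed
qed

end

section \<open>Extension to the dual\<close>

locale bounded_weak_family = weak_family K sc V P scE VE PE I t F
  for K :: "complex set" and sc :: "complex \<Rightarrow> 'v::ab_group_add \<Rightarrow> 'v" and V P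
    and scE :: "complex \<Rightarrow> 'e::ab_group_add \<Rightarrow> 'e" and VE PE
    and I :: "'i set" and t :: "'i \<Rightarrow> 'v \<Rightarrow> complex" and F :: "'i \<Rightarrow> 'e" +
  assumes montel: "semi_montel V P"
    and bounded: "p \<in> PE \<Longrightarrow> q \<in> P \<Longrightarrow> \<exists>c. \<forall>d\<in>R ` B p. q d \<le> c"
    and E_separated: "x \<in> VE \<Longrightarrow> (\<And>p. p \<in> PE \<Longrightarrow> p x = 0) \<Longrightarrow> x = 0"
    and E_directed: "directed_sns VE PE" and E_ne: "PE \<noteq> {}"
    and E_complete: "lc_complete VE PE"
begin

definition C :: "('e \<Rightarrow> real) \<Rightarrow> 'v set" where
  "C p = lc_top V P closure_of (R ` B p)"

lemma RB_sub: "R ` B p \<subseteq> V"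
  using R_mem B_Dual by blast

lemma RB_C: "R ` B p \<subseteq> C p"
  unfolding C_def using RB_sub by (intro closure_of_subset) simp

lemma C_sub: "C p \<subseteq> V"
  unfolding C_def using closure_of_subset_topspace[of "lc_top V P"] by simp

lemma C_compact: "p \<in> PE \<Longrightarrow> compactin (lc_top V P) (C p)"
proof -
  assume p: "p \<in> PE"
  have bdd: "bdd_above (q ` (R ` B p))" if "q \<in> P" for q
    using bounded[OF p that] unfolding bdd_above_def by auto
  have "bounded_set V P (R ` B p)"
    unfolding bounded_set_def by (intro conjI ballI RB_sub bdd)
  then show ?thesis using montel unfolding semi_montel_def C_def by blast
qed

text \<open>As \<open>C p\<close> will be absolutely convex and compact, this is one of the
  seminorms defining \<kappa>; it dominates \<open>p\<close> composed with the operator to be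
  built.\<close>

definition kap :: "('e \<Rightarrow> real) \<Rightarrow> ('v \<Rightarrow> complex) \<Rightarrow> real" where
  "kap p = (\<lambda>\<phi>. SUP x\<in>C p. cmod (\<phi> x))"

lemma kap_kappa_sns: "p \<in> PE \<Longrightarrow> kap p \<in> kappa_sns K sc V P"
proof -
  assume p: "p \<in> PE"
  interpret D: disc K sc V "R ` B p" by (rule disc_R[OF p])
  have "abs_convex K sc (C p)" unfolding C_def by (rule V.abs_convex_closure[OF D.D_acx D.D_sub])
  moreover have "C p \<noteq> {}" using RB_C D.D_ne by blast
  ultimately show ?thesis
    unfolding kappa_sns_def kap_def using C_sub C_compact[OF p] by blast
qed

lemma kap_ge:
  assumes p: "p \<in> PE" and \<phi>: "\<phi> \<in> V.Dual" and e: "e' \<in> B p"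
  shows "cmod (\<phi> (R e')) \<le> kap p \<phi>"
proof -
  have "compactin euclidean (\<phi> ` C p)"
    by (rule image_compactin[OF C_compact[OF p] V.Dual_cont[OF \<phi>]])
  then have "bounded (\<phi> ` C p)" by (simp add: compact_imp_bounded)
  then obtain c where "\<And>x. x \<in> C p \<Longrightarrow> cmod (\<phi> x) \<le> c" unfolding bounded_iff by auto
  then have "bdd_above ((\<lambda>x. cmod (\<phi> x)) ` C p)" by (intro bdd_aboveI2) auto
  then show ?thesis unfolding kap_def using RB_C e by (intro cSUP_upper) auto
qed

lemma B_norming: "p \<in> PE \<Longrightarrow> x \<in> VE \<Longrightarrow> \<exists>e'\<in>B p. p x \<le> cmod (e' x)"
  using E.Dual_norming[of p x] unfolding B_def by blast

text \<open>Norming functionals in \<open>B p\<close> force \<open>p (x - y) = 0\<close> for every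
  \<open>p\<close>. This uniqueness later turns values chosen one by one into a linear map.\<close>

lemma eq_if_B_eq:
  assumes x: "x \<in> VE" "y \<in> VE" and eq: "\<And>p e'. p \<in> PE \<Longrightarrow> e' \<in> B p \<Longrightarrow> e' x = e' y"
  shows "x = y"
proof -
  have "x - y = 0"
  proof (rule E_separated)
    fix p assume p: "p \<in> PE"
    obtain e' where e: "e' \<in> B p" "p (x - y) \<le> cmod (e' (x - y))"
      using B_norming[OF p, of "x - y"] x by auto
    have "e' (x - y) = 0" using eq[OF p e(1)] x E.Dual_diff[OF B_Dual[OF e(1)]] by simp
    then show "p (x - y) = 0" using e(2) E.seminorm_nonneg[OF E.sn[OF p], of "x - y"] x by simp
  qed (use x in simp)
  then show ?thesis by simp
qed

text \<open>Vectors of \<open>E\<close> solving \<open>e' x = \<phi> (R e')\<close> up to the error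
  \<open>e\<close>, uniformly over \<open>B p\<close>.\<close>

definition A :: "('v \<Rightarrow> complex) \<Rightarrow> ('e \<Rightarrow> real) \<Rightarrow> real \<Rightarrow> 'e set" where
  "A \<phi> p e = {x\<in>VE. \<forall>e'\<in>B p. cmod (e' x - \<phi> (R e')) \<le> e}"

text \<open>By compactness of \<^term>\<open>C p\<close> the functional \<^term>\<open>\<phi>\<close> is small on the part of \<^term>\<open>C p\<close>
  annihilated by suitable finitely many \<^term>\<open>t i\<close>, so a linear combination of these approximates it on \<^term>\<open>R ` B p\<close>.\<close>
lemma A_nonempty:
  assumes p: "p \<in> PE" and \<phi>: "\<phi> \<in> V.Dual" and e: "e > 0"
  shows "A \<phi> p e \<noteq> {}"
proof -
  interpret D: disc K sc V "R ` B p" by (rule disc_R[OF p])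
  define N where "N i = {x\<in>V. t i x \<in> - {0}}" for i
  define Sm where "Sm = {x\<in>V. \<phi> x \<in> ball 0 e}"
  have "openin (lc_top V P) (N i)" if "i \<in> I" for i
    unfolding N_def using openin_continuous_map_preimage[OF V.Dual_cont[OF t_Dual[OF that]], of "- {0}"] by (simp add: open_Compl)
  then have "openin (lc_top V P) S" if "S \<in> N ` I" for S
    using that by blast
  moreover have "openin (lc_top V P) Sm"
    unfolding Sm_def using openin_continuous_map_preimage[OF V.Dual_cont[OF \<phi>], of "ball 0 e"] by simp
  \<comment> \<open>Only the point \<open>0\<close> is annihilated by every \<open>t i\<close>, and
    \<phi> vanishes there, so \<open>Sm\<close> catches what the sets \<open>N i\<close>
    miss.\<close>
  moreover have "C p \<subseteq> \<Union>(insert Sm (N ` I))"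
  proof
    fix x assume "x \<in> C p"
    then have x: "x \<in> V" using C_sub by blast
    show "x \<in> \<Union>(insert Sm (N ` I))"
    proof (cases "\<exists>i\<in>I. t i x \<noteq> 0")
      case False
      then have "x = 0" using t_separating[OF x] by blast
      then show ?thesis using e V.Dual_zero[OF \<phi>] by (simp add: Sm_def)
    qed (use x in \<open>auto simp: N_def\<close>)
  qed
  ultimately have "\<exists>\<F>. finite \<F> \<and> \<F> \<subseteq> insert Sm (N ` I) \<and> C p \<subseteq> \<Union>\<F>"
    by (intro compactinD[OF C_compact[OF p]]) (elim insertE, simp_all only:)
  then obtain \<F> where \<F>: "finite \<F>" "\<F> \<subseteq> insert Sm (N ` I)" "C p \<subseteq> \<Union>\<F>" by blast
  have "finite (\<F> - {Sm})" using \<F>(1) by (rule finite_Diff)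
  moreover have "\<F> - {Sm} \<subseteq> N ` I" using \<F>(2) by blast
  ultimately have "\<exists>Js\<subseteq>I. finite Js \<and> \<F> - {Sm} = N ` Js" by (rule finite_subset_image)
  then obtain Js where Js: "Js \<subseteq> I" "finite Js" "\<F> - {Sm} = N ` Js"
    by blast
  have "\<exists>c. (\<forall>i. c i \<in> K) \<and> (\<forall>x\<in>R ` B p. cmod (\<phi> x - (\<Sum>i\<in>Js. c i * t i x)) \<le> e)"
  proof (rule V.functional_approximation[OF Js(2) D.D_sub D.D_acx V.Dual_lin[OF \<phi>] V.Dual_lin])
    show "t i \<in> V.Dual" if "i \<in> Js" for i using t_Dual Js(1) that by blast
    fix x assume x: "x \<in> R ` B p" "\<forall>i\<in>Js. t i x = 0"
    then obtain S where S: "S \<in> \<F>" "x \<in> S" using RB_C \<F>(3) by blast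
    have "S \<notin> N ` Js" using S(2) x(2) by (auto simp: N_def)
    then have "S = Sm" using S(1) Js(3) by blast
    then show "cmod (\<phi> x) \<le> e" using S(2) by (simp add: Sm_def)
  qed
  then obtain c where c: "\<And>i. c i \<in> K" "\<And>x. x \<in> R ` B p \<Longrightarrow> cmod (\<phi> x - (\<Sum>i\<in>Js. c i * t i x)) \<le> e" by blast
  \<comment> \<open>Replacing \<open>t i\<close> by \<open>F i\<close> transports the approximating
    combination to \<open>E\<close>, since \<open>e' (F i) = t i (R e')\<close>.\<close>
  define x where "x = (\<Sum>i\<in>Js. scE (c i) (F i))"
  have FV: "F i \<in> VE" if "i \<in> Js" for i using that Js(1) F_mem by blast
  have "x \<in> VE" unfolding x_def using FV c(1) by (intro E.sum_mem E.sc_mem)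
  moreover have "cmod (e' x - \<phi> (R e')) \<le> e" if e': "e' \<in> B p" for e'
  proof -
    have "e' x = (\<Sum>i\<in>Js. c i * t i (R e'))"
      unfolding x_def using B_Dual[OF e'] FV c(1) Js
      by (subst E.Dual_sum) (auto simp: E.Dual_sc t_R subset_iff intro!: sum.cong)
    then show ?thesis using c(2)[of "R e'"] e' by (simp add: norm_minus_commute)
  qed
  ultimately show ?thesis unfolding A_def by blast
qed

text \<open>If \<open>p \<le> c * r\<close> on \<open>VE\<close>, then \<open>1 / c\<close> times a
  functional in \<open>B p\<close> lies in \<open>B r\<close>; the error allowed for
  \<open>r\<close> is therefore divided by the same \<open>c\<close>.\<close>

lemma A_directed:
  assumes p: "p \<in> PE" "e > 0" and q: "q \<in> PE" "d > 0" and \<phi>: "\<phi> \<in> V.Dual"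
  shows "\<exists>r\<in>PE. \<exists>s>0. A \<phi> r s \<subseteq> A \<phi> p e \<inter> A \<phi> q d"
proof -
  from E_directed[unfolded directed_sns_def, THEN bspec, OF p(1), THEN bspec, OF q(1)]
  obtain r c where r: "r \<in> PE" "c > 0" and le: "\<And>x. x \<in> VE \<Longrightarrow> max (p x) (q x) \<le> c * r x"
    by blast
  define s where "s = min e d / c"
  have *: "A \<phi> r s \<subseteq> A \<phi> p' e0" if p': "\<And>x. x \<in> VE \<Longrightarrow> p' x \<le> c * r x" and "min e d \<le> e0" for p' e0
  proof
    fix x assume x: "x \<in> A \<phi> r s"
    have "cmod (e' x - \<phi> (R e')) \<le> e0" if e': "e' \<in> B p'" for e'
    proof -
      define a where "a = complex_of_real (1 / c)"
      have a: "a \<in> K" "cmod a = 1 / c" unfolding a_def using r(2) by (simp_all only: V.K_of_real norm_of_real, simp)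
      have "cmod (fsc a e' y) \<le> r y" if y: "y \<in> VE" for y
      proof -
        have "cmod (fsc a e' y) = 1 / c * cmod (e' y)" by (simp add: fsc_def norm_mult a(2))
        also have "\<dots> \<le> 1 / c * (c * r y)"
          using order_trans[OF B_le[OF e' y] p'[OF y]] r(2) by (intro mult_left_mono) auto
        finally show ?thesis using r(2) by simp
      qed
      then have "fsc a e' \<in> B r"
        using E.Dual_fsc_mem[OF B_Dual[OF e'] a(1)] unfolding B_def by blast
      then have "cmod (fsc a e' x - \<phi> (R (fsc a e'))) \<le> s" using x unfolding A_def by blast
      also have "\<phi> (R (fsc a e')) = a * \<phi> (R e')"
        using R_sc[OF B_Dual[OF e'] a(1)] V.Dual_sc[OF \<phi> a(1) R_mem[OF B_Dual[OF e']]] by simp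
      also have "fsc a e' x - a * \<phi> (R e') = a * (e' x - \<phi> (R e'))"
        by (simp add: fsc_def algebra_simps)
      finally have "1 / c * cmod (e' x - \<phi> (R e')) \<le> min e d / c"
        by (simp only: norm_mult a(2) s_def)
      then have "cmod (e' x - \<phi> (R e')) \<le> min e d"
        using r(2) by (simp add: divide_le_cancel)
      with \<open>min e d \<le> e0\<close> show ?thesis by linarith
    qed
    with x show "x \<in> A \<phi> p' e0" unfolding A_def by blast
  qed
  have "A \<phi> r s \<subseteq> A \<phi> p e"
  proof (rule *)
    show "p x \<le> c * r x" if "x \<in> VE" for x using le[OF that] by simp
  qed simp
  moreover have "A \<phi> r s \<subseteq> A \<phi> q d"
  proof (rule *)
    show "q x \<le> c * r x" if "x \<in> VE" for x using le[OF that] by simp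
  qed simp
  moreover have "s > 0" using p q r by (simp add: s_def)
  ultimately show ?thesis using r(1) by blast
qed

text \<open>The sets \<^term>\<open>A \<phi> p e\<close> form a Cauchy filter base in \<open>E\<close>; its limit is the value at \<open>\<phi>\<close> of the
  operator to be constructed.\<close>

lemma extension_point:
  assumes \<phi>: "\<phi> \<in> V.Dual"
  shows "\<exists>x\<in>VE. \<forall>p\<in>PE. \<forall>e'\<in>B p. e' x = \<phi> (R e')"
proof -
  define J where "J = PE \<times> {0 :: real<..}"
  define G where "G = (\<lambda>(p, e). principal (A \<phi> p e))"
  define Fl where "Fl = (INF j\<in>J. G j)"
  have J: "J \<noteq> {}" using E_ne unfolding J_def by auto
  \<comment> \<open>For a downward directed family the infimum is a proper filter as soon as each
    member is, which reduces properness to \<open>A_nonempty\<close>.\<close>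
  have "Fl = bot \<longleftrightarrow> (\<exists>j\<in>J. G j = bot)"
    unfolding Fl_def
  proof (rule INF_filter_bot_base)
    fix i j assume "i \<in> J" "j \<in> J"
    then obtain p e q d where ij: "i = (p, e)" "j = (q, d)" "p \<in> PE" "e > 0" "q \<in> PE" "d > 0"
      unfolding J_def by auto
    then obtain r s where "r \<in> PE" "s > 0" "A \<phi> r s \<subseteq> A \<phi> p e \<inter> A \<phi> q d"
      using A_directed[OF _ _ _ _ \<phi>] by meson
    then show "\<exists>k\<in>J. G k \<le> inf (G i) (G j)"
      using ij by (intro bexI[of _ "(r, s)"]) (auto simp: J_def G_def)
  qed
  moreover have "G j \<noteq> bot" if "j \<in> J" for j
    using A_nonempty[OF _ \<phi>] that by (auto simp: J_def G_def principal_eq_bot_iff)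
  ultimately have Fl_bot: "Fl \<noteq> bot" by blast
  have Fl_A: "eventually (\<lambda>x. x \<in> A \<phi> p e) Fl" if "p \<in> PE" "e > 0" for p e
    unfolding Fl_def using that
    by (intro eventually_INF1[of "(p, e)"]) (auto simp: J_def G_def eventually_principal)
  obtain p0 where p0: "p0 \<in> PE" using E_ne by blast
  have Fl_V: "eventually (\<lambda>x. x \<in> VE) Fl"
    using Fl_A[OF p0, of 1] by (auto simp: A_def elim: eventually_mono)
  have Fl_cauchy: "\<exists>S. eventually (\<lambda>x. x \<in> S) Fl \<and> (\<forall>x\<in>S. \<forall>y\<in>S. p (x - y) < e)"
    if p: "p \<in> PE" and e: "e > 0" for p e
  \<comment> \<open>Two members differ by at most \<open>2 * e / 3\<close> on \<open>B p\<close>;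
    the remaining third makes the estimate strict.\<close>
  proof (intro exI[of _ "A \<phi> p (e / 3)"] conjI ballI)
    show "eventually (\<lambda>x. x \<in> A \<phi> p (e / 3)) Fl" using Fl_A[OF p] e by simp
    fix x y assume xy: "x \<in> A \<phi> p (e / 3)" "y \<in> A \<phi> p (e / 3)"
    then have V: "x \<in> VE" "y \<in> VE" unfolding A_def by auto
    obtain e' where e': "e' \<in> B p" "p (x - y) \<le> cmod (e' (x - y))"
      using B_norming[OF p, of "x - y"] V by auto
    have "e' (x - y) = (e' x - \<phi> (R e')) - (e' y - \<phi> (R e'))"
      using V E.Dual_diff[OF B_Dual[OF e'(1)]] by simp
    then have "cmod (e' (x - y)) \<le> cmod (e' x - \<phi> (R e')) + cmod (e' y - \<phi> (R e'))"
      by (metis norm_triangle_ineq4)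
    also have "\<dots> \<le> e / 3 + e / 3" using xy e'(1) unfolding A_def by (intro add_mono) auto
    finally show "p (x - y) < e" using e'(2) e by simp
  qed
  have "\<exists>x\<in>VE. limitin (lc_top VE PE) id x Fl"
    using E_complete[unfolded lc_complete_def, THEN spec, of Fl] Fl_bot Fl_V Fl_cauchy by blast
  then obtain x where x: "x \<in> VE" "limitin (lc_top VE PE) id x Fl" by blast
  have "e' x = \<phi> (R e')" if p: "p \<in> PE" and e': "e' \<in> B p" for p e'
  proof -
    have "cmod (e' x - \<phi> (R e')) \<le> 0 + e" if e: "e > 0" for e
    proof -
      have "\<forall>q\<in>PE. \<forall>e>0. eventually (\<lambda>y. q (y - x) < e) Fl"
        using x(2) unfolding E.limitin_lc_top by simp
      from this[THEN bspec[OF _ p], THEN spec, of "e / 2"] e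
      have "eventually (\<lambda>y. p (y - x) < e / 2) Fl" by (simp only: half_gt_zero simp_thms)
      moreover have "eventually (\<lambda>y. y \<in> A \<phi> p (e / 2)) Fl" using Fl_A[OF p] e by simp
      ultimately have "eventually (\<lambda>y. p (y - x) < e / 2 \<and> y \<in> A \<phi> p (e / 2)) Fl"
        by eventually_elim simp
      then obtain y where y: "p (y - x) < e / 2" "y \<in> A \<phi> p (e / 2)"
        using eventually_happens'[OF Fl_bot] by blast
      have yV: "y \<in> VE" using y(2) unfolding A_def by blast
      have "e' x - \<phi> (R e') = (e' y - \<phi> (R e')) - e' (y - x)"
        using x(1) yV E.Dual_diff[OF B_Dual[OF e']] by simp
      then have "cmod (e' x - \<phi> (R e')) \<le> cmod (e' y - \<phi> (R e')) + cmod (e' (y - x))"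
        by (metis norm_triangle_ineq4)
      also have "cmod (e' (y - x)) \<le> p (y - x)" using B_le[OF e'] x(1) yV by simp
      also have "cmod (e' y - \<phi> (R e')) \<le> e / 2" using y(2) e' unfolding A_def by blast
      finally show ?thesis using y(1) by simp
    qed
    then have "cmod (e' x - \<phi> (R e')) \<le> 0" by (rule field_le_epsilon)
    then show ?thesis by simp
  qed
  with x(1) show ?thesis by blast
qed

text \<open>Each value \<open>u \<phi>\<close> is chosen separately, but
  \<open>e' (u \<phi>) = \<phi> (R e')\<close> determines it, which yields linearity and
  \<open>u (t i) = F i\<close>. The same identity with a norming \<open>e'\<close> gives
  \<open>p (u \<phi>) \<le> kap p \<phi>\<close>, hence continuity for \<kappa>.\<close>

lemma exists_extension:
  "\<exists>u. lin_map K fsc V.Dual scE VE u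
     \<and> continuous_map (lc_top V.Dual (kappa_sns K sc V P)) (lc_top VE PE) u
     \<and> (\<forall>\<phi>. \<phi> \<notin> V.Dual \<longrightarrow> u \<phi> = 0) \<and> (\<forall>i\<in>I. u (t i) = F i)"
proof -
  interpret DV: kvs K fsc V.Dual by (rule V.kvs_Dual)
  have "\<exists>u. \<forall>\<phi>\<in>V.Dual. u \<phi> \<in> VE \<and> (\<forall>p\<in>PE. \<forall>e'\<in>B p. e' (u \<phi>) = \<phi> (R e'))"
    using extension_point by (intro bchoice) blast
  then obtain u0 where u0: "\<And>\<phi>. \<phi> \<in> V.Dual \<Longrightarrow> u0 \<phi> \<in> VE"
    "\<And>\<phi> p e'. \<phi> \<in> V.Dual \<Longrightarrow> p \<in> PE \<Longrightarrow> e' \<in> B p \<Longrightarrow> e' (u0 \<phi>) = \<phi> (R e')" by blast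
  define u where "u \<phi> = (if \<phi> \<in> V.Dual then u0 \<phi> else 0)" for \<phi>
  have u: "u \<phi> \<in> VE" "p \<in> PE \<Longrightarrow> e' \<in> B p \<Longrightarrow> e' (u \<phi>) = \<phi> (R e')" if "\<phi> \<in> V.Dual" for \<phi> p e'
    using that u0 by (auto simp: u_def)
  have u_eq: "u \<phi> = x" if \<phi>: "\<phi> \<in> V.Dual" and x: "x \<in> VE"
    and eq: "\<And>p e'. p \<in> PE \<Longrightarrow> e' \<in> B p \<Longrightarrow> e' x = \<phi> (R e')" for \<phi> x
    by (rule eq_if_B_eq[OF u(1)[OF \<phi>] x]) (simp only: u(2)[OF \<phi>] eq)
  have add: "u (\<phi> + \<psi>) = u \<phi> + u \<psi>" if \<phi>: "\<phi> \<in> V.Dual" and \<psi>: "\<psi> \<in> V.Dual" for \<phi> \<psi>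
  proof (rule u_eq)
    show "e' (u \<phi> + u \<psi>) = (\<phi> + \<psi>) (R e')" if "p \<in> PE" "e' \<in> B p" for p e'
      using E.Dual_add[OF B_Dual[OF that(2)] u(1)[OF \<phi>] u(1)[OF \<psi>]] u(2)[OF \<phi> that] u(2)[OF \<psi> that] by simp
  qed (use \<phi> \<psi> u(1) in auto)
  have scal: "u (fsc a \<phi>) = scE a (u \<phi>)" if a: "a \<in> K" and \<phi>: "\<phi> \<in> V.Dual" for a \<phi>
  proof (rule u_eq)
    show "e' (scE a (u \<phi>)) = fsc a \<phi> (R e')" if "p \<in> PE" "e' \<in> B p" for p e'
      using E.Dual_sc[OF B_Dual[OF that(2)] a u(1)[OF \<phi>]] u(2)[OF \<phi> that] by (simp add: fsc_def)
  qed (use a \<phi> u(1) in auto)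
  have lin: "lin_map K fsc V.Dual scE VE u"
    unfolding lin_map_def using u add scal by auto
  have diff: "u (\<psi> - \<phi>) = u \<psi> - u \<phi>" if "\<phi> \<in> V.Dual" "\<psi> \<in> V.Dual" for \<phi> \<psi>
    using add[of "\<psi> - \<phi>" \<phi>] that by simp
  have bound: "p (u \<phi>) \<le> kap p \<phi>" if p: "p \<in> PE" and \<phi>: "\<phi> \<in> V.Dual" for p \<phi>
  proof -
    obtain e' where "e' \<in> B p" "p (u \<phi>) \<le> cmod (e' (u \<phi>))" using B_norming[OF p u(1)[OF \<phi>]] by blast
    then show ?thesis using kap_ge[OF p \<phi>, of e'] u(2)[OF \<phi> p, of e'] by simp
  qed
  have "openin (lc_top V.Dual (kappa_sns K sc V P)) {\<phi>\<in>V.Dual. u \<phi> \<in> W}"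
    if W: "openin (lc_top VE PE) W" for W
    unfolding openin_lc_top
  proof (intro conjI ballI)
    fix \<phi> assume "\<phi> \<in> {\<phi>\<in>V.Dual. u \<phi> \<in> W}"
    then have \<phi>: "\<phi> \<in> V.Dual" "u \<phi> \<in> W" by auto
    obtain S e where S: "finite S" "S \<subseteq> PE" "e > 0" "{y\<in>VE. \<forall>p\<in>S. p (y - u \<phi>) < e} \<subseteq> W"
      using W[unfolded openin_lc_top, THEN conjunct2, THEN bspec, OF \<phi>(2)] by (elim exE conjE)
    have "u \<psi> \<in> W" if \<psi>: "\<psi> \<in> V.Dual" "\<forall>q\<in>kap ` S. q (\<psi> - \<phi>) < e" for \<psi>
    proof -
      have "p (u \<psi> - u \<phi>) < e" if "p \<in> S" for p
        using bound[of p "\<psi> - \<phi>"] that S(2) \<psi> \<phi> diff[OF \<phi>(1) \<psi>(1)] by fastforce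
      then show ?thesis using S(4) u(1)[OF \<psi>(1)] by blast
    qed
    then show "\<exists>G e. finite G \<and> G \<subseteq> kappa_sns K sc V P \<and> e > 0 \<and>
        {\<psi>\<in>V.Dual. \<forall>q\<in>G. q (\<psi> - \<phi>) < e} \<subseteq> {\<phi>\<in>V.Dual. u \<phi> \<in> W}"
      using S kap_kappa_sns by (intro exI[of _ "kap ` S"] exI[of _ e]) auto
  qed auto
  then have "continuous_map (lc_top V.Dual (kappa_sns K sc V P)) (lc_top VE PE) u"
    using u(1) unfolding continuous_map_def by auto
  moreover have "u (t i) = F i" if "i \<in> I" for i
    using that by (intro u_eq t_Dual F_mem) (auto simp: t_R B_Dual)
  ultimately show ?thesis using lin by (intro exI[of _ u]) (auto simp: u_def)
qed

end

section \<open>Weighted function spaces\<close>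

text \<open>The order rules for \<open>Sup\<close> require the value sets to be nonempty and bounded
  above: the first comes from \<open>Omega\<close> and \<open>Ml l\<close> being nonempty, the
  second is part of membership in the space.\<close>

lemma lcs_FV_space:
  fixes K :: "complex set" and T :: "'m \<Rightarrow> ('y \<Rightarrow> complex) \<Rightarrow> 'y \<Rightarrow> complex"
  assumes K: "K = \<real> \<or> K = UNIV" and Omega_ne: "Omega \<noteq> {}" and Ml_ne: "\<forall>l\<in>L. Ml l \<noteq> {}"
    and nu_nonneg: "\<forall>j\<in>J. \<forall>l\<in>L. \<forall>m\<in>Ml l. \<forall>x\<in>Omega. 0 \<le> nu j l m x"
    and om_top: "\<forall>m\<in>(\<Union>l\<in>L. Ml l). Omega \<subseteq> om m"
    and T_lin: "\<forall>m\<in>Mall L Ml M0 Mr. lin_op K (*) K Omega (om m) (domT m) (T m)"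
  shows "lcs K fsc (FV_space K {cmod} Omega J L Ml nu M0 Mr om domT T) (FV_sns {cmod} Omega J L Ml nu T)"
proof -
  define V where "V = FV_space K {cmod} Omega J L Ml nu M0 Mr om domT T"
  define vals where "vals j l f = FV_vals Omega Ml nu T j l cmod f" for j l f
  define ok where "ok f \<longleftrightarrow> (\<forall>x. f x \<in> K) \<and> (\<forall>x. x \<notin> Omega \<longrightarrow> f x = 0) \<and> (\<forall>m\<in>Mall L Ml M0 Mr. f \<in> domT m)
    \<and> (\<forall>m\<in>M0. \<forall>x\<in>om m. T m f x = 0)" for f
  have V_iff: "f \<in> V \<longleftrightarrow> ok f \<and> (\<forall>j\<in>J. \<forall>l\<in>L. bdd_above (vals j l f))" for f
    unfolding V_def FV_space_def ok_def vals_def by simp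
  have topm: "m \<in> Mall L Ml M0 Mr" "x \<in> om m" if "l \<in> L" "m \<in> Ml l" "x \<in> Omega" for l m x
    using that om_top unfolding Mall_def by auto
  have M0: "m \<in> Mall L Ml M0 Mr" if "m \<in> M0" for m using that unfolding Mall_def by auto
  have T_add: "T m (f + g) x = T m f x + T m g x"
    if "m \<in> Mall L Ml M0 Mr" "x \<in> om m" "ok f" "ok g" for m x f g
    using that T_lin unfolding lin_op_def ok_def by blast
  have T_sc: "T m (fsc a f) x = a * T m f x"
    if "m \<in> Mall L Ml M0 Mr" "x \<in> om m" "ok f" "a \<in> K" for m x f a
    using that T_lin unfolding lin_op_def ok_def fsc_def by blast
  have dom: "subspace_of K fsc (domT m)" if "m \<in> Mall L Ml M0 Mr" for m
    using T_lin that unfolding lin_op_def fsc_def by blast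
  have K_add: "a + b \<in> K" and K_mult: "a * b \<in> K" if "a \<in> K" "b \<in> K" for a b
    using that K by auto
  have K01: "0 \<in> K" "1 \<in> K" using K by auto
  have ok_add: "ok (f + g)" if "ok f" "ok g" for f g
    unfolding ok_def
  proof (intro conjI ballI allI impI)
    show "(f + g) x \<in> K" for x using that K_add by (simp add: ok_def)
    show "(f + g) x = 0" if "x \<notin> Omega" for x using \<open>ok f\<close> \<open>ok g\<close> that by (simp add: ok_def)
    show "f + g \<in> domT m" if "m \<in> Mall L Ml M0 Mr" for m
      using dom[OF that] \<open>ok f\<close> \<open>ok g\<close> that unfolding subspace_of_def ok_def by blast
    show "T m (f + g) x = 0" if "m \<in> M0" "x \<in> om m" for m x
      using T_add[OF M0[OF that(1)] that(2) \<open>ok f\<close> \<open>ok g\<close>] \<open>ok f\<close> \<open>ok g\<close> that by (simp add: ok_def)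
  qed
  have ok_sc: "ok (fsc a f)" if "ok f" "a \<in> K" for a f
    unfolding ok_def
  proof (intro conjI ballI allI impI)
    show "fsc a f x \<in> K" for x using that K_mult by (simp add: ok_def fsc_def)
    show "fsc a f x = 0" if "x \<notin> Omega" for x using \<open>ok f\<close> that by (simp add: ok_def fsc_def)
    show "fsc a f \<in> domT m" if "m \<in> Mall L Ml M0 Mr" for m
      using dom[OF that] \<open>ok f\<close> \<open>a \<in> K\<close> that unfolding subspace_of_def ok_def by blast
    show "T m (fsc a f) x = 0" if "m \<in> M0" "x \<in> om m" for m x
      using T_sc[OF M0[OF that(1)] that(2) \<open>ok f\<close> \<open>a \<in> K\<close>] \<open>ok f\<close> that by (simp add: ok_def)
  qed
  have dom0: "0 \<in> domT m" if "m \<in> Mall L Ml M0 Mr" for m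
    using dom[OF that] unfolding subspace_of_def by blast
  have T0: "T m 0 x = 0" if m: "m \<in> Mall L Ml M0 Mr" "x \<in> om m" for m x
  proof -
    have "lin_op K (*) K Omega (om m) (domT m) (T m)" using T_lin m(1) by blast
    then have "T m (\<lambda>y. 0 * (0 :: 'y \<Rightarrow> complex) y) x = 0 * T m 0 x"
      using dom0[OF m(1)] m(2) K01(1) unfolding lin_op_def by blast
    moreover have "(\<lambda>y. 0 * (0 :: 'y \<Rightarrow> complex) y) = 0" by (simp add: fun_eq_iff)
    ultimately show ?thesis by simp
  qed
  have ok_0: "ok 0"
    unfolding ok_def using dom0 K01 T0 M0 by auto
  have vals_ne: "vals j l f \<noteq> {}" if "l \<in> L" for j l f
    using that Omega_ne Ml_ne unfolding vals_def FV_vals_def by blast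
  have vals_le: "cmod (T m f x) * nu j l m x \<le> Sup (vals j l f)"
    if "bdd_above (vals j l f)" "m \<in> Ml l" "x \<in> Omega" for j l f m x
    using that unfolding vals_def FV_vals_def by (intro cSup_upper) auto
  have bddI: "bdd_above (vals j l f)"
    if "\<And>m x. m \<in> Ml l \<Longrightarrow> x \<in> Omega \<Longrightarrow> cmod (T m f x) * nu j l m x \<le> c" for j l f c
    using that unfolding vals_def FV_vals_def by (intro bdd_aboveI[of _ c]) auto
  have Sup_le: "Sup (vals j l f) \<le> c"
    if "l \<in> L" "\<And>m x. m \<in> Ml l \<Longrightarrow> x \<in> Omega \<Longrightarrow> cmod (T m f x) * nu j l m x \<le> c" for j l f c
    using vals_ne[OF that(1), of j f] that(2) by (intro cSup_least) (auto simp: vals_def FV_vals_def)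
  have add_le: "cmod (T m (f + g) x) * nu j l m x \<le> Sup (vals j l f) + Sup (vals j l g)"
    if f: "f \<in> V" and g: "g \<in> V" and jl: "j \<in> J" "l \<in> L" and mx: "m \<in> Ml l" "x \<in> Omega" for f g j l m x
  proof -
    have nu: "0 \<le> nu j l m x" using nu_nonneg jl mx by blast
    have "T m (f + g) x = T m f x + T m g x"
      using f g by (intro T_add topm[OF jl(2) mx]) (auto simp: V_iff)
    then have "cmod (T m (f + g) x) * nu j l m x \<le> (cmod (T m f x) + cmod (T m g x)) * nu j l m x"
      using nu norm_triangle_ineq[of "T m f x" "T m g x"] by (simp add: mult_right_mono)
    also have "\<dots> \<le> Sup (vals j l f) + Sup (vals j l g)"
      using f g jl vals_le[OF _ mx, of j f] vals_le[OF _ mx, of j g] by (simp add: V_iff distrib_right add_mono)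
    finally show ?thesis .
  qed
  have sc_le: "cmod (T m (fsc a f) x) * nu j l m x \<le> cmod a * Sup (vals j l f)"
    if f: "f \<in> V" and a: "a \<in> K" and jl: "j \<in> J" "l \<in> L" and mx: "m \<in> Ml l" "x \<in> Omega" for a f j l m x
  proof -
    have "T m (fsc a f) x = a * T m f x"
      using f a by (intro T_sc topm[OF jl(2) mx]) (auto simp: V_iff)
    moreover have "cmod (T m f x) * nu j l m x \<le> Sup (vals j l f)"
      using f jl by (intro vals_le mx) (auto simp: V_iff)
    ultimately show ?thesis by (simp add: norm_mult mult.assoc mult_left_mono)
  qed
  have V0: "0 \<in> V"
    unfolding V_iff
  proof (intro conjI ballI ok_0)
    fix j l assume "j \<in> J" "l \<in> L"
    then show "bdd_above (vals j l 0)"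
      using T0[OF topm] by (intro bddI[of l _ _ 0]) simp
  qed
  have V_add: "f + g \<in> V" if f: "f \<in> V" and g: "g \<in> V" for f g
    unfolding V_iff
  proof (intro conjI ballI)
    show "ok (f + g)" using f g by (intro ok_add) (simp_all add: V_iff)
    show "bdd_above (vals j l (f + g))" if "j \<in> J" "l \<in> L" for j l
      by (rule bddI) (rule add_le[OF f g that])
  qed
  have V_sc: "fsc a f \<in> V" if f: "f \<in> V" and a: "a \<in> K" for a f
    unfolding V_iff
  proof (intro conjI ballI)
    show "ok (fsc a f)" using f a by (intro ok_sc) (simp_all add: V_iff)
    show "bdd_above (vals j l (fsc a f))" if "j \<in> J" "l \<in> L" for j l
      by (rule bddI) (rule sc_le[OF f a that])
  qed
  have "fsc a (f + g) = fsc a f + fsc a g" "fsc (a + b) f = fsc a f + fsc b f"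
    "fsc (a * b) f = fsc a (fsc b f)" "fsc 1 f = f" for a b and f g :: "'y \<Rightarrow> complex"
    by (simp_all add: fsc_def fun_eq_iff algebra_simps)
  then have vs: "vs K fsc V"
    unfolding vs_def using V0 V_add V_sc by blast
  have "seminorm_on K fsc V (\<lambda>f. Sup (vals j l f))" if jl: "j \<in> J" "l \<in> L" for j l
    unfolding seminorm_on_def
  proof (intro conjI ballI)
    fix f assume f: "f \<in> V"
    show nonneg: "0 \<le> Sup (vals j l f)"
    proof -
      obtain m x where mx: "m \<in> Ml l" "x \<in> Omega" using Ml_ne Omega_ne jl by blast
      have "0 \<le> cmod (T m f x) * nu j l m x" using nu_nonneg jl mx by simp
      also have "\<dots> \<le> Sup (vals j l f)" using f jl by (intro vals_le mx) (auto simp: V_iff)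
      finally show ?thesis .
    qed
    show "Sup (vals j l (f + g)) \<le> Sup (vals j l f) + Sup (vals j l g)" if g: "g \<in> V" for g
      by (rule Sup_le[OF jl(2)]) (rule add_le[OF f g jl])
  next
    \<comment> \<open>Only this inequality is direct; its instance for \<open>inverse a\<close>
      gives the reverse one when \<open>a\<close> is nonzero.\<close>
    have le: "Sup (vals j l (fsc a f)) \<le> cmod a * Sup (vals j l f)" if "a \<in> K" "f \<in> V" for a f
      by (rule Sup_le[OF jl(2)]) (rule sc_le[OF that(2,1) jl])
    fix a f assume a: "a \<in> K" and f: "f \<in> V"
    show "Sup (vals j l (fsc a f)) = cmod a * Sup (vals j l f)"
    proof (cases "a = 0")
      case True
      have "fsc a f = 0" using True by (simp add: fsc_def fun_eq_iff)
      moreover have "Sup (vals j l 0) = 0"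
      proof -
        have "vals j l 0 \<subseteq> {0}"
          using T0[OF topm[OF jl(2)]] unfolding vals_def FV_vals_def by auto
        then have "vals j l 0 = {0}" using vals_ne[OF jl(2), of j 0] by blast
        then show ?thesis by simp
      qed
      ultimately show ?thesis using True by simp
    next
      case False
      have ia: "inverse a \<in> K" using K a by auto
      have "fsc (inverse a) (fsc a f) = f" using False by (simp add: fsc_def fun_eq_iff)
      with le[OF ia V_sc[OF f a]] have "Sup (vals j l f) \<le> cmod (inverse a) * Sup (vals j l (fsc a f))" by simp
      then have "cmod a * Sup (vals j l f) \<le> Sup (vals j l (fsc a f))"
        using False by (simp add: norm_inverse norm_divide field_simps)
      with le[OF a f] show ?thesis by simp
    qed
  qed
  then have "seminorm_on K fsc V p" if "p \<in> FV_sns {cmod} Omega J L Ml nu T" for p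
    using that unfolding FV_sns_def vals_def by blast
  then show ?thesis
    using K vs unfolding V_def[symmetric] by (intro lcs.intro kvs.intro lcs_axioms.intro)
qed

theorem theorem3p14:
  fixes K :: "complex set"
    and Omega :: "'y set" and J :: "'j set" and L :: "'l set" and Ml :: "'l \<Rightarrow> 'm set"
    and nu :: "'j \<Rightarrow> 'l \<Rightarrow> 'm \<Rightarrow> 'y \<Rightarrow> real" and M0 Mr :: "'m set" and om :: "'m \<Rightarrow> 'y set"
    and VE :: "'e::ab_group_add set" and scE :: "complex \<Rightarrow> 'e \<Rightarrow> 'e" and PE :: "('e \<Rightarrow> real) set"
    and domTK :: "'m \<Rightarrow> ('y \<Rightarrow> complex) set" and TK :: "'m \<Rightarrow> ('y \<Rightarrow> complex) \<Rightarrow> 'y \<Rightarrow> complex"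
    and domTE :: "'m \<Rightarrow> ('y \<Rightarrow> 'e) set" and TE :: "'m \<Rightarrow> ('y \<Rightarrow> 'e) \<Rightarrow> 'y \<Rightarrow> 'e"
    and U :: "('m \<times> 'y) set"
  defines "MM \<equiv> Mall L Ml M0 Mr"
    and "FVK \<equiv> FV_space K {cmod} Omega J L Ml nu M0 Mr om domTK TK"
    and "PK \<equiv> FV_sns {cmod} Omega J L Ml nu TK"
    and "FVE \<equiv> FV_space VE PE Omega J L Ml nu M0 Mr om domTE TE"
    and "PFVE \<equiv> FV_sns PE Omega J L Ml nu TE"
    and "E' \<equiv> lc_dual K scE VE PE"
    and "FVdual \<equiv> lc_dual K fsc (FV_space K {cmod} Omega J L Ml nu M0 Mr om domTK TK) (FV_sns {cmod} Omega J L Ml nu TK)"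
    and "eps \<equiv> eps_prod K (FV_space K {cmod} Omega J L Ml nu M0 Mr om domTK TK) (FV_sns {cmod} Omega J L Ml nu TK) scE VE PE"
  assumes K: "K = \<real> \<or> K = UNIV"
    \<comment> \<open>weights\<close>
    and Omega_ne: "Omega \<noteq> {}" and J_ne: "J \<noteq> {}" and L_ne: "L \<noteq> {}"
    and Ml_ne: "\<forall>l\<in>L. Ml l \<noteq> {}"
    and nu_nonneg: "\<forall>j\<in>J. \<forall>l\<in>L. \<forall>m\<in>Ml l. \<forall>x\<in>Omega. 0 \<le> nu j l m x"
    and nu_pos: "\<forall>x\<in>Omega. \<forall>l\<in>L. \<exists>j\<in>J. \<forall>m\<in>Ml l. nu j l m x > 0"
    and disj: "(\<Union>l\<in>L. Ml l) \<inter> M0 = {}" "(\<Union>l\<in>L. Ml l) \<inter> Mr = {}" "M0 \<inter> Mr = {}"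
    and om_ne: "\<forall>m\<in>MM. om m \<noteq> {}"
    and om_top: "\<forall>m\<in>(\<Union>l\<in>L. Ml l). Omega \<subseteq> om m"
    \<comment> \<open>the space E\<close>
    and E_lcHs: "lcHs K scE VE PE" and PE_ne: "PE \<noteq> {}" and PE_dir: "directed_sns VE PE"
    and E_nontriv: "VE \<noteq> {0}"
    and E_complete: "lc_complete VE PE"
    \<comment> \<open>the operators\<close>
    and TK_lin: "\<forall>m\<in>MM. lin_op K (*) K Omega (om m) (domTK m) (TK m)"
    and TE_lin: "\<forall>m\<in>MM. lin_op K scE VE Omega (om m) (domTE m) (TE m)"
    \<comment> \<open>FV(Omega) and FV(Omega,E) are dom-spaces\<close>
    and dom_K: "directed_sns FVK PK" "\<forall>x\<in>Omega. delta_on FVK x \<in> FVdual"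
    and dom_E: "directed_sns FVE PFVE"
    \<comment> \<open>consistency\<close>
    and consistent: "\<forall>u\<in>eps. \<forall>m\<in>MM. \<forall>x\<in>om m.
        S_map FVK Omega u \<in> domTE m \<and> Tfun_on FVK (TK m) x \<in> FVdual
        \<and> TE m (S_map FVK Omega u) x = u (Tfun_on FVK (TK m) x)"
    \<comment> \<open>strength\<close>
    and strong: "\<forall>e'\<in>E'. \<forall>f\<in>FVE. \<forall>m\<in>MM.
        e' \<circ> f \<in> domTK m \<and> (\<forall>x\<in>om m. TK m (e' \<circ> f) x = e' (TE m f x))"
    \<comment> \<open>semi-Montel\<close>
    and montel: "semi_montel FVK PK"
    \<comment> \<open>U is a set of uniqueness\<close>
    and U_sub: "U \<subseteq> Sigma MM om"
    and U_cont: "\<forall>(m, x)\<in>U. Tfun_on FVK (TK m) x \<in> FVdual"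
    and U_uniq: "\<forall>f\<in>FVK. (\<forall>(m, x)\<in>U. TK m f x = 0) \<longrightarrow> f = 0"
    \<comment> \<open>(a) webbed, (b) B_r-complete, (c) infra-(s)\<close>
    and abc: "webbed K fsc FVK PK \<or> Br_complete K fsc FVK PK \<or> infra_s K fsc FVK PK"
  shows "{F :: 'm \<times> 'y \<Rightarrow> 'e. (\<forall>z\<in>U. F z \<in> VE) \<and> (\<forall>z. z \<notin> U \<longrightarrow> F z = 0)
            \<and> (\<forall>e'\<in>E'. \<exists>g\<in>FVK. \<forall>(m, x)\<in>U. TK m g x = e' (F (m, x)))}
         \<subseteq> (\<lambda>u. (\<lambda>(m, x). if (m, x) \<in> U then TE m (S_map FVK Omega u) x else 0)) ` eps"
proof
  fix F :: "'m \<times> 'y \<Rightarrow> 'e"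
  assume "F \<in> {F. (\<forall>z\<in>U. F z \<in> VE) \<and> (\<forall>z. z \<notin> U \<longrightarrow> F z = 0)
            \<and> (\<forall>e'\<in>E'. \<exists>g\<in>FVK. \<forall>(m, x)\<in>U. TK m g x = e' (F (m, x)))}"
  then have F: "\<And>z. z \<in> U \<Longrightarrow> F z \<in> VE" "\<And>z. z \<notin> U \<Longrightarrow> F z = 0"
    and F_weak: "\<And>e'. e' \<in> E' \<Longrightarrow> \<exists>g\<in>FVK. \<forall>(m, x)\<in>U. TK m g x = e' (F (m, x))" by auto
  define t where "t = (\<lambda>(m, x). Tfun_on FVK (TK m) x)"
  have t_eq: "t (m, x) g = TK m g x" if "g \<in> FVK" for m x g
    using that by (simp add: t_def Tfun_on_def)
  interpret V: lcs K fsc FVK PK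
    unfolding FVK_def PK_def by (rule lcs_FV_space[OF K Omega_ne Ml_ne nu_nonneg om_top TK_lin[unfolded MM_def]])
  interpret E: lcs K scE VE PE
    using E_lcHs K unfolding lcHs_def by (intro lcs.intro kvs.intro lcs_axioms.intro) auto
  have FVdual_eq: "FVdual = V.Dual" unfolding FVdual_def FVK_def PK_def ..
  \<comment> \<open>With \<open>U\<close> as index set and \<open>t (m, x)\<close> the functional of
    \<open>TK m\<close> at \<open>x\<close>, the clause \<open>weak\<close> becomes membership of
    \<open>F\<close> in the target space.\<close>
  interpret W: weak_family K fsc FVK PK scE VE PE U t F
  proof
    show "t i \<in> V.Dual" if "i \<in> U" for i
      using U_cont that unfolding t_def FVdual_eq by auto
    show "f = 0" if f: "f \<in> FVK" and "\<And>i. i \<in> U \<Longrightarrow> t i f = 0" for f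
      using U_uniq f that(2) t_eq[OF f] by fastforce
    show "F i \<in> VE" if "i \<in> U" for i using F(1) that .
    show "\<exists>g\<in>FVK. \<forall>i\<in>U. t i g = e' (F i)" if e': "e' \<in> E.Dual" for e'
    proof -
      obtain g where g: "g \<in> FVK" "\<forall>(m, x)\<in>U. TK m g x = e' (F (m, x))"
        using F_weak e' unfolding E'_def by blast
      then have "\<forall>i\<in>U. t i g = e' (F i)" using t_eq[OF g(1)] by auto
      with g(1) show ?thesis by blast
    qed
  qed
  interpret W: bounded_weak_family K fsc FVK PK scE VE PE U t F
  proof
    show "\<exists>c. \<forall>d\<in>W.R ` W.B p. q d \<le> c" if p: "p \<in> PE" and q: "q \<in> PK" for p q
    proof -
      interpret D: separated_disc K fsc FVK PK "W.R ` W.B p" "t ` U"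
        by (rule W.separated_disc_R[OF p])
      \<comment> \<open>The three alternatives enter only here, each through its own closed graph
        argument.\<close>
      show ?thesis
        using abc D.bounded_if_webbed[OF _ q] D.bounded_if_Br_complete[OF _ q] D.bounded_if_infra_s[OF _ q] by blast
    qed
    show "x = 0" if "x \<in> VE" "\<And>p. p \<in> PE \<Longrightarrow> p x = 0" for x
      using E_lcHs that unfolding lcHs_def by blast
  qed (fact montel PE_dir PE_ne E_complete)+
  obtain u where u: "lin_map K fsc V.Dual scE VE u"
    "continuous_map (lc_top V.Dual (kappa_sns K fsc FVK PK)) (lc_top VE PE) u"
    "\<And>\<phi>. \<phi> \<notin> V.Dual \<Longrightarrow> u \<phi> = 0" "\<And>i. i \<in> U \<Longrightarrow> u (t i) = F i"
    using W.exists_extension by blast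
  have u_eps: "u \<in> eps"
    unfolding eps_def eps_prod_def FVK_def[symmetric] PK_def[symmetric] using u by blast
  have "F (m, x) = (if (m, x) \<in> U then TE m (S_map FVK Omega u) x else 0)" for m x
  proof (cases "(m, x) \<in> U")
    case True
    then have "m \<in> MM" "x \<in> om m" using U_sub by auto
    \<comment> \<open>Consistency turns the value of \<open>u\<close> at the functional of
      \<open>(m, x)\<close>, which is \<open>F (m, x)\<close>, into the restriction of
      \<open>S_map FVK Omega u\<close>.\<close>
    then have "TE m (S_map FVK Omega u) x = u (Tfun_on FVK (TK m) x)"
      using consistent u_eps by blast
    then show ?thesis using True u(4)[OF True] by (simp add: t_def)
  qed (simp add: F(2))
  then have "F = (\<lambda>(m, x). if (m, x) \<in> U then TE m (S_map FVK Omega u) x else 0)"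
    by (simp add: fun_eq_iff)
  with u_eps show "F \<in> (\<lambda>u. (\<lambda>(m, x). if (m, x) \<in> U then TE m (S_map FVK Omega u) x else 0)) ` eps"
    by blast
qed

end
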